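(* Let $\Bbbk$ be a field, let $\chi\colon E\to H$ be a crossed module, and let $A=\{A_x\}_{x\in H}$ be a Hopf $\chi$-coalgebra over $\Bbbk$ of finite type (that is, each $A_x$ is finite dimensional over $\Bbbk$). Then the space $\mathcal I_A^l$ of left $\chi$-integrals for $A$ and the space $\mathcal I_A^r$ of right $\chi$-integrals for $A$ are both one dimensional over $\Bbbk$.
   Context: All tensor products are over $\Bbbk$. **Crossed module.** A group homomorphism $\chi\colon E\to H$ with a left action $(x,e)\mapsto {}^{x}e$ of $H$ on $E$ by group automorphisms such that $\chi({}^{x}e)=x\chi(e)x^{-1}$ and ${}^{\chi(e)}f=efe^{-1}$ for all $x\in H$, $e,f\in E$. **Hopf $\chi$-coalgebra.** A family $A=\{A_x\}_{x\in H}$ of $\Bbbk$-algebras (products $\mu_x$, unit maps $\eta_x\colon\Bbbk\to A_x$) with algebra homomorphisms $\Delta_{x,y}\colon A_{xy}\to A_x\otimes A_y$ and $\varepsilon\colon A_1\to\Bbbk$ such that $(\Delta_{x,y}\otimes\mathrm{id})\Delta_{xy,z}=(\mathrm{id}\otimes\Delta_{y,z})\Delta_{x,yz}$ and $(\mathrm{id}\otimes\varepsilon)\Delta_{x,1}=\mathrm{id}_{A_x}=(\varepsilon\otimes\mathrm{id})\Delta_{1,x}$; with $\Bbbk$-linear isomorphisms $S_x\colon A_{x^{-1}}\to A_x$ with $\mu_x(S_x\otimes\mathrm{id})\Delta_{x^{-1},x}=\eta_x\varepsilon=\mu_x(\mathrm{id}\otimes S_x)\Delta_{x,x^{-1}}$;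 and with algebra homomorphisms $\phi_{x,e}\colon A_x\to A_{\chi(e)x}$ ($x\in H,e\in E$) such that $\phi_{x,1}=\mathrm{id}_{A_x}$, $\phi_{\chi(e)x,f}\,\phi_{x,e}=\phi_{x,fe}$, and $(\phi_{x,e}\otimes\phi_{y,f})\Delta_{x,y}=\Delta_{\chi(e)x,\chi(f)y}\,\phi_{xy,\,e\,{}^{x}f}$. **$\chi$-integrals.** A left (resp. right) $\chi$-integral for $A$ is a family of $\Bbbk$-linear forms $\lambda=(\lambda_x\colon A_x\to\Bbbk)_{x\in H}$ such that for all $x,y\in H$, $e\in E$: $(\mathrm{id}_{A_x}\otimes\lambda_y)\Delta_{x,y}=\eta_x\lambda_{xy}$ (resp. $(\lambda_x\otimes\mathrm{id}_{A_y})\Delta_{x,y}=\eta_y\lambda_{xy}$), and $\lambda_{\chi(e)x}\phi_{x,e}=\lambda_x$. The sets $\mathcal I_A^l$ and $\mathcal I_A^r$ of left and right $\chi$-integrals are $\Bbbk$-subspaces of $\prod_{x\in H}\mathrm{Hom}_\Bbbk(A_x,\Bbbk)$. *)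

theory Defs
  imports "Jordan_Normal_Form.Missing_VectorSpace" "HOL-Algebra.QuotRing" "HOL-Algebra.Group_Action"
begin

section \<open>Algebras over a field\<close>

text \<open>
  The locale \<open>algebra\<close> of the library is restricted to commutative algebras, so associative unital
  algebras over a field are introduced here. They are \<open>module\<close> records, which carry a ring
  structure as well. The zero algebra is allowed.
\<close>

locale assoc_algebra = vectorspace K A for K and A (structure) +
  assumes ring: "ring A"
    and smult_mult_left: "\<lbrakk>c \<in> carrier K; a \<in> carrier A; b \<in> carrier A\<rbrakk>
      \<Longrightarrow> (c \<odot> a) \<otimes> b = c \<odot> (a \<otimes> b)"
    and smult_mult_right: "\<lbrakk>c \<in> carrier K; a \<in> carrier A; b \<in> carrier A\<rbrakk>
      \<Longrightarrow> a \<otimes> (c \<odot> b) = c \<odot> (a \<otimes> b)"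

definition algebra_hom ::
  "('k, 'm) ring_scheme \<Rightarrow> ('k, 'a) module \<Rightarrow> ('k, 'b) module \<Rightarrow> ('a \<Rightarrow> 'b) set"
  where "algebra_hom K A B = ring_hom A B \<inter> module_hom K A B"

definition linear_iso ::
  "('k, 'm) ring_scheme \<Rightarrow> ('k, 'a) module \<Rightarrow> ('k, 'b) module \<Rightarrow> ('a \<Rightarrow> 'b) set"
  where "linear_iso K A B = {f \<in> module_hom K A B. bij_betw f (carrier A) (carrier B)}"

definition ground_algebra :: "('k, 'm) ring_scheme \<Rightarrow> ('k, 'k) module"
  where "ground_algebra K =
    \<lparr>carrier = carrier K, mult = mult K, one = one K, zero = zero K, add = add K, smult = mult K\<rparr>"

definition unit_map :: "('k, 'a) module \<Rightarrow> 'k \<Rightarrow> 'a"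
  where "unit_map A c = c \<odot>\<^bsub>A\<^esub> \<one>\<^bsub>A\<^esub>"

definition one_dimensional :: "('k, 'm) ring_scheme \<Rightarrow> ('k, 'a) module \<Rightarrow> bool"
  where "one_dimensional K V \<longleftrightarrow>
    vectorspace K V \<and> vectorspace.fin_dim K V \<and> vectorspace.dim K V = 1"


section \<open>Tensor products of algebras\<close>

text \<open>
  The tensor product of \<open>A\<close> and \<open>B\<close> is the quotient of the free vector space on
  \<open>carrier A \<times> carrier B\<close> by the span of the bilinearity relations. Its product
  \<open>(a \<otimes> b) (a' \<otimes> b') = a a' \<otimes> b b'\<close> is induced by the product of the monoid algebra of the
  product monoid \<open>A \<times>\<times> B\<close>, in which the span of the relations is an ideal.
\<close>

definition free_gen :: "('k, 'm) ring_scheme \<Rightarrow> 'g \<Rightarrow> 'g \<Rightarrow> 'k"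
  where "free_gen K p = (\<lambda>q. if q = p then \<one>\<^bsub>K\<^esub> else \<zero>\<^bsub>K\<^esub>)"

definition monoid_algebra ::
  "('k, 'm) ring_scheme \<Rightarrow> ('g, 'n) monoid_scheme \<Rightarrow> ('k, 'g \<Rightarrow> 'k) module"
  where "monoid_algebra K G =
    \<lparr>carrier = {f. (\<forall>p. f p \<in> carrier K) \<and> (\<forall>p. p \<notin> carrier G \<longrightarrow> f p = \<zero>\<^bsub>K\<^esub>)
        \<and> finite {p. f p \<noteq> \<zero>\<^bsub>K\<^esub>}},
     mult = (\<lambda>f g r. \<Oplus>\<^bsub>K\<^esub>u \<in> {(p, q). f p \<noteq> \<zero>\<^bsub>K\<^esub> \<and> g q \<noteq> \<zero>\<^bsub>K\<^esub> \<and> p \<otimes>\<^bsub>G\<^esub> q = r}.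
        f (fst u) \<otimes>\<^bsub>K\<^esub> g (snd u)),
     one = free_gen K \<one>\<^bsub>G\<^esub>,
     zero = (\<lambda>p. \<zero>\<^bsub>K\<^esub>),
     add = (\<lambda>f g p. f p \<oplus>\<^bsub>K\<^esub> g p),
     smult = (\<lambda>c f p. c \<otimes>\<^bsub>K\<^esub> f p)\<rparr>"

definition bilinear_relations ::
  "('k, 'm) ring_scheme \<Rightarrow> ('k, 'a) module \<Rightarrow> ('k, 'b) module \<Rightarrow> ('a \<times> 'b \<Rightarrow> 'k) set"
  where "bilinear_relations K A B =
    (let F = monoid_algebra K (A \<times>\<times> B); e = (\<lambda>a b. free_gen K (a, b)) in
      {e (a \<oplus>\<^bsub>A\<^esub> a') b \<ominus>\<^bsub>F\<^esub> (e a b \<oplus>\<^bsub>F\<^esub> e a' b) | a a' b.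
        a \<in> carrier A \<and> a' \<in> carrier A \<and> b \<in> carrier B} \<union>
      {e a (b \<oplus>\<^bsub>B\<^esub> b') \<ominus>\<^bsub>F\<^esub> (e a b \<oplus>\<^bsub>F\<^esub> e a b') | a b b'.
        a \<in> carrier A \<and> b \<in> carrier B \<and> b' \<in> carrier B} \<union>
      {e (c \<odot>\<^bsub>A\<^esub> a) b \<ominus>\<^bsub>F\<^esub> c \<odot>\<^bsub>F\<^esub> e a b | c a b.
        c \<in> carrier K \<and> a \<in> carrier A \<and> b \<in> carrier B} \<union>
      {e a (c \<odot>\<^bsub>B\<^esub> b) \<ominus>\<^bsub>F\<^esub> c \<odot>\<^bsub>F\<^esub> e a b | c a b.
        c \<in> carrier K \<and> a \<in> carrier A \<and> b \<in> carrier B})"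

definition tensor_kernel ::
  "('k, 'm) ring_scheme \<Rightarrow> ('k, 'a) module \<Rightarrow> ('k, 'b) module \<Rightarrow> ('a \<times> 'b \<Rightarrow> 'k) set"
  where "tensor_kernel K A B =
    module.span K (monoid_algebra K (A \<times>\<times> B)) (bilinear_relations K A B)"

definition tensor ::
  "('k, 'm) ring_scheme \<Rightarrow> ('k, 'a) module \<Rightarrow> ('k, 'b) module \<Rightarrow> ('k, ('a \<times> 'b \<Rightarrow> 'k) set) module"
  where "tensor K A B =
    (let F = monoid_algebra K (A \<times>\<times> B); N = tensor_kernel K A B in
      ring.extend (FactRing F N) (module.fields (\<lambda>c T. \<Union>f\<in>T. N +>\<^bsub>F\<^esub> (c \<odot>\<^bsub>F\<^esub> f))))"

definition pure_tensor ::
  "('k, 'm) ring_scheme \<Rightarrow> ('k, 'a) module \<Rightarrow> ('k, 'b) module \<Rightarrow> 'a \<Rightarrow> 'b \<Rightarrow> ('a \<times> 'b \<Rightarrow> 'k) set"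
  where "pure_tensor K A B a b =
    tensor_kernel K A B +>\<^bsub>monoid_algebra K (A \<times>\<times> B)\<^esub> free_gen K (a, b)"

text \<open>
  The linear map \<open>a \<otimes> b \<mapsto> \<beta> a b\<close> into \<open>W\<close> induced by a bilinear map \<open>\<beta>\<close>: evaluate any
  representative; the result does not depend on its choice because \<open>\<beta>\<close> is bilinear.
\<close>

definition tensor_lift ::
  "('k, 'm) ring_scheme \<Rightarrow> ('k, 'c) module \<Rightarrow> ('a \<Rightarrow> 'b \<Rightarrow> 'c) \<Rightarrow> ('a \<times> 'b \<Rightarrow> 'k) set \<Rightarrow> 'c"
  where "tensor_lift K W \<beta> T =
    the_elem ((\<lambda>f. \<Oplus>\<^bsub>W\<^esub>p \<in> {p. f p \<noteq> \<zero>\<^bsub>K\<^esub>}. f p \<odot>\<^bsub>W\<^esub> \<beta> (fst p) (snd p)) ` T)"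

text \<open>For linear \<open>f\<close> and \<open>g\<close> with values in \<open>A'\<close> and \<open>B'\<close>, this is \<open>f \<otimes> g\<close>.\<close>

definition tensor_map ::
  "('k, 'm) ring_scheme \<Rightarrow> ('k, 'c) module \<Rightarrow> ('k, 'd) module \<Rightarrow> ('a \<Rightarrow> 'c) \<Rightarrow> ('b \<Rightarrow> 'd)
    \<Rightarrow> ('a \<times> 'b \<Rightarrow> 'k) set \<Rightarrow> ('c \<times> 'd \<Rightarrow> 'k) set"
  where "tensor_map K A' B' f g =
    tensor_lift K (tensor K A' B') (\<lambda>a b. pure_tensor K A' B' (f a) (g b))"

text \<open>
  The canonical isomorphisms \<open>(A \<otimes> B) \<otimes> C \<cong> A \<otimes> (B \<otimes> C)\<close>, \<open>A \<otimes> \<bbbk> \<cong> A\<close> and \<open>\<bbbk> \<otimes> A \<cong> A\<close>, usually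
  left implicit.
\<close>

definition tensor_assoc ::
  "('k, 'm) ring_scheme \<Rightarrow> ('k, 'a) module \<Rightarrow> ('k, 'b) module \<Rightarrow> ('k, 'c) module
    \<Rightarrow> (('a \<times> 'b \<Rightarrow> 'k) set \<times> 'c \<Rightarrow> 'k) set \<Rightarrow> ('a \<times> ('b \<times> 'c \<Rightarrow> 'k) set \<Rightarrow> 'k) set"
  where "tensor_assoc K A B C =
    (let W = tensor K A (tensor K B C) in
      tensor_lift K W (\<lambda>t c. tensor_lift K W
        (\<lambda>a b. pure_tensor K A (tensor K B C) a (pure_tensor K B C b c)) t))"

definition tensor_unit_right ::
  "('k, 'm) ring_scheme \<Rightarrow> ('k, 'a) module \<Rightarrow> ('a \<times> 'k \<Rightarrow> 'k) set \<Rightarrow> 'a"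
  where "tensor_unit_right K A = tensor_lift K A (\<lambda>a c. c \<odot>\<^bsub>A\<^esub> a)"

definition tensor_unit_left ::
  "('k, 'm) ring_scheme \<Rightarrow> ('k, 'a) module \<Rightarrow> ('k \<times> 'a \<Rightarrow> 'k) set \<Rightarrow> 'a"
  where "tensor_unit_left K A = tensor_lift K A (\<lambda>c a. c \<odot>\<^bsub>A\<^esub> a)"

definition mult_map ::
  "('k, 'm) ring_scheme \<Rightarrow> ('k, 'a) module \<Rightarrow> ('a \<times> 'a \<Rightarrow> 'k) set \<Rightarrow> 'a"
  where "mult_map K A = tensor_lift K A (mult A)"


section \<open>Crossed modules\<close>

text \<open>\<open>act x e\<close> is the left action of \<open>x \<in> H\<close> on \<open>e \<in> E\<close>.\<close>

locale crossed_module = E: group E + H: group H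
  for E :: "('e, 'p) monoid_scheme" and H :: "('h, 'q) monoid_scheme" +
  fixes \<chi> :: "'e \<Rightarrow> 'h" and act :: "'h \<Rightarrow> 'e \<Rightarrow> 'e"
  assumes hom: "\<chi> \<in> hom E H"
    and action: "group_action H (carrier E) act"
    and act_hom: "x \<in> carrier H \<Longrightarrow> act x \<in> hom E E"
    and equivariant: "\<lbrakk>x \<in> carrier H; e \<in> carrier E\<rbrakk>
      \<Longrightarrow> \<chi> (act x e) = x \<otimes>\<^bsub>H\<^esub> \<chi> e \<otimes>\<^bsub>H\<^esub> inv\<^bsub>H\<^esub> x"
    and peiffer: "\<lbrakk>e \<in> carrier E; f \<in> carrier E\<rbrakk>
      \<Longrightarrow> act (\<chi> e) f = e \<otimes>\<^bsub>E\<^esub> f \<otimes>\<^bsub>E\<^esub> inv\<^bsub>E\<^esub> e"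


section \<open>Hopf coalgebras over a crossed module\<close>

text \<open>
  All \<open>A x\<close> have their carriers in one type \<open>'a\<close>; the carriers may overlap and no relation between
  the algebra structures is assumed.
\<close>

locale hopf_chi_coalgebra = crossed_module E H \<chi> act + field K
  for K :: "('k, 'm) ring_scheme" (structure)
    and E :: "('e, 'p) monoid_scheme" and H :: "('h, 'q) monoid_scheme"
    and \<chi> :: "'e \<Rightarrow> 'h" and act :: "'h \<Rightarrow> 'e \<Rightarrow> 'e" +
  fixes A :: "'h \<Rightarrow> ('k, 'a) module"
    and \<Delta> :: "'h \<Rightarrow> 'h \<Rightarrow> 'a \<Rightarrow> ('a \<times> 'a \<Rightarrow> 'k) set"
    and \<epsilon> :: "'a \<Rightarrow> 'k"
    and S :: "'h \<Rightarrow> 'a \<Rightarrow> 'a"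
    and \<phi> :: "'h \<Rightarrow> 'e \<Rightarrow> 'a \<Rightarrow> 'a"
  assumes algebras: "x \<in> carrier H \<Longrightarrow> assoc_algebra K (A x)"
    and comult_hom: "\<lbrakk>x \<in> carrier H; y \<in> carrier H\<rbrakk>
      \<Longrightarrow> \<Delta> x y \<in> algebra_hom K (A (x \<otimes>\<^bsub>H\<^esub> y)) (tensor K (A x) (A y))"
    and counit_hom: "\<epsilon> \<in> algebra_hom K (A \<one>\<^bsub>H\<^esub>) (ground_algebra K)"
    and coassoc: "\<lbrakk>x \<in> carrier H; y \<in> carrier H; z \<in> carrier H;
        a \<in> carrier (A (x \<otimes>\<^bsub>H\<^esub> y \<otimes>\<^bsub>H\<^esub> z))\<rbrakk>
      \<Longrightarrow> tensor_assoc K (A x) (A y) (A z)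
            (tensor_map K (tensor K (A x) (A y)) (A z) (\<Delta> x y) id (\<Delta> (x \<otimes>\<^bsub>H\<^esub> y) z a))
        = tensor_map K (A x) (tensor K (A y) (A z)) id (\<Delta> y z) (\<Delta> x (y \<otimes>\<^bsub>H\<^esub> z) a)"
    and counit_right: "\<lbrakk>x \<in> carrier H; a \<in> carrier (A x)\<rbrakk>
      \<Longrightarrow> tensor_unit_right K (A x)
            (tensor_map K (A x) (ground_algebra K) id \<epsilon> (\<Delta> x \<one>\<^bsub>H\<^esub> a)) = a"
    and counit_left: "\<lbrakk>x \<in> carrier H; a \<in> carrier (A x)\<rbrakk>
      \<Longrightarrow> tensor_unit_left K (A x)
            (tensor_map K (ground_algebra K) (A x) \<epsilon> id (\<Delta> \<one>\<^bsub>H\<^esub> x a)) = a"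
    and antipode_iso: "x \<in> carrier H \<Longrightarrow> S x \<in> linear_iso K (A (inv\<^bsub>H\<^esub> x)) (A x)"
    and antipode_left: "\<lbrakk>x \<in> carrier H; a \<in> carrier (A \<one>\<^bsub>H\<^esub>)\<rbrakk>
      \<Longrightarrow> mult_map K (A x) (tensor_map K (A x) (A x) (S x) id (\<Delta> (inv\<^bsub>H\<^esub> x) x a))
        = unit_map (A x) (\<epsilon> a)"
    and antipode_right: "\<lbrakk>x \<in> carrier H; a \<in> carrier (A \<one>\<^bsub>H\<^esub>)\<rbrakk>
      \<Longrightarrow> mult_map K (A x) (tensor_map K (A x) (A x) id (S x) (\<Delta> x (inv\<^bsub>H\<^esub> x) a))
        = unit_map (A x) (\<epsilon> a)"
    and phi_hom: "\<lbrakk>x \<in> carrier H; e \<in> carrier E\<rbrakk>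
      \<Longrightarrow> \<phi> x e \<in> algebra_hom K (A x) (A (\<chi> e \<otimes>\<^bsub>H\<^esub> x))"
    and phi_one: "\<lbrakk>x \<in> carrier H; a \<in> carrier (A x)\<rbrakk> \<Longrightarrow> \<phi> x \<one>\<^bsub>E\<^esub> a = a"
    and phi_mult: "\<lbrakk>x \<in> carrier H; e \<in> carrier E; f \<in> carrier E; a \<in> carrier (A x)\<rbrakk>
      \<Longrightarrow> \<phi> (\<chi> e \<otimes>\<^bsub>H\<^esub> x) f (\<phi> x e a) = \<phi> x (f \<otimes>\<^bsub>E\<^esub> e) a"
    and phi_comult: "\<lbrakk>x \<in> carrier H; y \<in> carrier H; e \<in> carrier E; f \<in> carrier E;
        a \<in> carrier (A (x \<otimes>\<^bsub>H\<^esub> y))\<rbrakk>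
      \<Longrightarrow> tensor_map K (A (\<chi> e \<otimes>\<^bsub>H\<^esub> x)) (A (\<chi> f \<otimes>\<^bsub>H\<^esub> y)) (\<phi> x e) (\<phi> y f) (\<Delta> x y a)
        = \<Delta> (\<chi> e \<otimes>\<^bsub>H\<^esub> x) (\<chi> f \<otimes>\<^bsub>H\<^esub> y) (\<phi> (x \<otimes>\<^bsub>H\<^esub> y) (e \<otimes>\<^bsub>E\<^esub> act x f) a)"


section \<open>Integrals\<close>

text \<open>
  The vector space of all families of linear forms on the \<open>A x\<close>, \<open>x \<in> carrier H\<close>. Families and forms
  are extensional, so that equality of functions is equality of families. The record fields
  \<open>mult\<close> and \<open>one\<close> play no role.
\<close>

definition form_families ::
  "('k, 'm) ring_scheme \<Rightarrow> ('h, 'q) monoid_scheme \<Rightarrow> ('h \<Rightarrow> ('k, 'a) module)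
    \<Rightarrow> ('k, 'h \<Rightarrow> 'a \<Rightarrow> 'k) module"
  where "form_families K H A =
    (let z = (\<lambda>x\<in>carrier H. \<lambda>a\<in>carrier (A x). \<zero>\<^bsub>K\<^esub>) in
    \<lparr>carrier = (\<Pi>\<^sub>E x\<in>carrier H.
        module_hom K (A x) (ground_algebra K) \<inter> extensional (carrier (A x))),
     mult = (\<lambda>l l'. z),
     one = z,
     zero = z,
     add = (\<lambda>l l'. \<lambda>x\<in>carrier H. \<lambda>a\<in>carrier (A x). l x a \<oplus>\<^bsub>K\<^esub> l' x a),
     smult = (\<lambda>c l. \<lambda>x\<in>carrier H. \<lambda>a\<in>carrier (A x). c \<otimes>\<^bsub>K\<^esub> l x a)\<rparr>)"

definition phi_invariant ::
  "('e, 'p) monoid_scheme \<Rightarrow> ('h, 'q) monoid_scheme \<Rightarrow> ('e \<Rightarrow> 'h) \<Rightarrow> ('h \<Rightarrow> ('k, 'a) module)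
    \<Rightarrow> ('h \<Rightarrow> 'e \<Rightarrow> 'a \<Rightarrow> 'a) \<Rightarrow> ('h \<Rightarrow> 'a \<Rightarrow> 'k) \<Rightarrow> bool"
  where "phi_invariant E H \<chi> A \<phi> l \<longleftrightarrow>
    (\<forall>x\<in>carrier H. \<forall>e\<in>carrier E. \<forall>a\<in>carrier (A x). l (\<chi> e \<otimes>\<^bsub>H\<^esub> x) (\<phi> x e a) = l x a)"

definition left_integrals ::
  "('k, 'm) ring_scheme \<Rightarrow> ('e, 'p) monoid_scheme \<Rightarrow> ('h, 'q) monoid_scheme \<Rightarrow> ('e \<Rightarrow> 'h)
    \<Rightarrow> ('h \<Rightarrow> ('k, 'a) module) \<Rightarrow> ('h \<Rightarrow> 'h \<Rightarrow> 'a \<Rightarrow> ('a \<times> 'a \<Rightarrow> 'k) set)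
    \<Rightarrow> ('h \<Rightarrow> 'e \<Rightarrow> 'a \<Rightarrow> 'a) \<Rightarrow> ('h \<Rightarrow> 'a \<Rightarrow> 'k) set"
  where "left_integrals K E H \<chi> A \<Delta> \<phi> =
    {l \<in> carrier (form_families K H A). phi_invariant E H \<chi> A \<phi> l \<and>
      (\<forall>x\<in>carrier H. \<forall>y\<in>carrier H. \<forall>a\<in>carrier (A (x \<otimes>\<^bsub>H\<^esub> y)).
        tensor_unit_right K (A x) (tensor_map K (A x) (ground_algebra K) id (l y) (\<Delta> x y a))
        = unit_map (A x) (l (x \<otimes>\<^bsub>H\<^esub> y) a))}"

definition right_integrals ::
  "('k, 'm) ring_scheme \<Rightarrow> ('e, 'p) monoid_scheme \<Rightarrow> ('h, 'q) monoid_scheme \<Rightarrow> ('e \<Rightarrow> 'h)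
    \<Rightarrow> ('h \<Rightarrow> ('k, 'a) module) \<Rightarrow> ('h \<Rightarrow> 'h \<Rightarrow> 'a \<Rightarrow> ('a \<times> 'a \<Rightarrow> 'k) set)
    \<Rightarrow> ('h \<Rightarrow> 'e \<Rightarrow> 'a \<Rightarrow> 'a) \<Rightarrow> ('h \<Rightarrow> 'a \<Rightarrow> 'k) set"
  where "right_integrals K E H \<chi> A \<Delta> \<phi> =
    {l \<in> carrier (form_families K H A). phi_invariant E H \<chi> A \<phi> l \<and>
      (\<forall>x\<in>carrier H. \<forall>y\<in>carrier H. \<forall>a\<in>carrier (A (x \<otimes>\<^bsub>H\<^esub> y)).
        tensor_unit_left K (A y) (tensor_map K (ground_algebra K) (A y) (l x) id (\<Delta> x y a))
        = unit_map (A y) (l (x \<otimes>\<^bsub>H\<^esub> y) a))}"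

definition left_integral_space ::
  "('k, 'm) ring_scheme \<Rightarrow> ('e, 'p) monoid_scheme \<Rightarrow> ('h, 'q) monoid_scheme \<Rightarrow> ('e \<Rightarrow> 'h)
    \<Rightarrow> ('h \<Rightarrow> ('k, 'a) module) \<Rightarrow> ('h \<Rightarrow> 'h \<Rightarrow> 'a \<Rightarrow> ('a \<times> 'a \<Rightarrow> 'k) set)
    \<Rightarrow> ('h \<Rightarrow> 'e \<Rightarrow> 'a \<Rightarrow> 'a) \<Rightarrow> ('k, 'h \<Rightarrow> 'a \<Rightarrow> 'k) module"
  where "left_integral_space K E H \<chi> A \<Delta> \<phi> =
    (form_families K H A)\<lparr>carrier := left_integrals K E H \<chi> A \<Delta> \<phi>\<rparr>"

definition right_integral_space ::
  "('k, 'm) ring_scheme \<Rightarrow> ('e, 'p) monoid_scheme \<Rightarrow> ('h, 'q) monoid_scheme \<Rightarrow> ('e \<Rightarrow> 'h)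
    \<Rightarrow> ('h \<Rightarrow> ('k, 'a) module) \<Rightarrow> ('h \<Rightarrow> 'h \<Rightarrow> 'a \<Rightarrow> ('a \<times> 'a \<Rightarrow> 'k) set)
    \<Rightarrow> ('h \<Rightarrow> 'e \<Rightarrow> 'a \<Rightarrow> 'a) \<Rightarrow> ('k, 'h \<Rightarrow> 'a \<Rightarrow> 'k) module"
  where "right_integral_space K E H \<chi> A \<Delta> \<phi> =
    (form_families K H A)\<lparr>carrier := right_integrals K E H \<chi> A \<Delta> \<phi>\<rparr>"

end

theory Submission
  imports Defs
begin

text \<open>
  Tensors enter only through their pairings with bilinear forms: \<open>sw x y \<beta> a\<close> denotes
  \<open>\<beta>(a\<^sub>1, a\<^sub>2)\<close>, where \<open>\<Delta>\<^sub>x\<^sub>,\<^sub>y(a) = a\<^sub>1 \<otimes> a\<^sub>2\<close> in Sweedler notation.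

  Existence and uniqueness of integrals on the Hopf algebra \<open>A\<^sub>1\<close> come from a trace formula. With a basis
  \<open>u\<^sub>j\<close> and the dual basis \<open>v\<^sub>j\<close>, the forms \<open>\<tau>\<^sub>i(a) = \<Sum>\<^sub>j v\<^sub>i(u\<^sub>j\<^sub>1) v\<^sub>j(S(a S(u\<^sub>j\<^sub>2)))\<close> are left integrals, they are not
  all zero, and for each \<open>b\<close> the vector \<open>\<Lambda> = \<Sum>\<^sub>i \<tau>\<^sub>i(b) u\<^sub>i\<close> is a left integral in \<open>A\<^sub>1\<close>, i.e. \<open>c \<Lambda> = \<epsilon>(c) \<Lambda>\<close>. A left
  integral vanishing at some \<open>\<Lambda> \<noteq> 0\<close> is zero, so evaluation at \<open>\<Lambda>\<close> is injective on integrals.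
  This uses neither that \<open>S\<close> is anti-multiplicative nor that it is bijective.

  A left integral \<open>\<lambda>\<^sub>1\<close> on \<open>A\<^sub>1\<close> determines \<open>\<lambda>\<^sub>x\<close> through \<open>(id \<otimes> \<lambda>\<^sub>1) \<Delta>\<^sub>x\<^sub>,\<^sub>1 = \<eta>\<^sub>x \<lambda>\<^sub>x\<close>: an element \<open>b\<close> in the image of the left
  side satisfies \<open>\<Delta>\<^sub>x\<^sub>,\<^sub>1(b) = b \<otimes> 1\<close>, hence \<open>b \<otimes> 1 = 1 \<otimes> b\<close>, so \<open>b\<close> is a scalar. The \<open>x\<close> with
  \<open>A\<^sub>x \<noteq> 0\<close> form a subgroup, so \<open>\<lambda>\<^sub>x = 0\<close> is consistent for the others. Invariance under \<open>\<phi>\<close> is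
  automatic. Right integrals are the left integrals of the family with opposite products over the opposite group.
\<close>


section \<open>Tensor products\<close>

text \<open>The trace formula has a structural origin. A family of forms W_j is the coordinate
  description of an endomorphism T of \<open>A\<^sub>1\<close>, and sending T to the map taking a to
  the sum of W_j(a u_j1') u_j1, where u_j1' denotes the second leg of u_j, is an invertible operator
  by the antipode axioms. The \<tau>_i are the coordinates of the preimage of S under it. A
  statement about the \<tau>_i is therefore proved by applying this operator, which turns it into an
  identity about S.

  Pairing with forms avoids iterated tensor products, which are cosets in ever larger types, whereas
  scalars stay in K. The price is a way back from scalars to elements: linear forms must separate
  the points of each \<open>A\<^sub>x\<close>, and finite dimension provides this.

  The passage from \<Delta>(b) = b \<otimes> 1 to b \<otimes> 1 = 1 \<otimes> b is made by the map
  sending p \<otimes> t to p S(t_1) \<otimes> t_2: it takes \<Delta>(b) to 1 \<otimes> b, and b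
  \<otimes> 1 to b \<otimes> 1.\<close>

definition bilinear ::
  "('k, 'm) ring_scheme \<Rightarrow> ('k, 'a) module \<Rightarrow> ('k, 'b) module \<Rightarrow> ('k, 'c) module
    \<Rightarrow> ('a \<Rightarrow> 'b \<Rightarrow> 'c) \<Rightarrow> bool"
  where "bilinear K A B W \<beta> \<longleftrightarrow>
    (\<forall>a\<in>carrier A. \<beta> a \<in> module_hom K B W) \<and> (\<forall>b\<in>carrier B. (\<lambda>a. \<beta> a b) \<in> module_hom K A W)"

text \<open>This is the sum inside \<open>tensor_lift\<close> for one fixed representative.
  Linearity is established for it on the free module and passes to the quotient afterwards.\<close>

definition tensor_eval ::
  "('k, 'm) ring_scheme \<Rightarrow> ('k, 'c) module \<Rightarrow> ('a \<Rightarrow> 'b \<Rightarrow> 'c) \<Rightarrow> ('a \<times> 'b \<Rightarrow> 'k) \<Rightarrow> 'c"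
  where "tensor_eval K W \<beta> f = (\<Oplus>\<^bsub>W\<^esub>p \<in> {p. f p \<noteq> \<zero>\<^bsub>K\<^esub>}. f p \<odot>\<^bsub>W\<^esub> \<beta> (fst p) (snd p))"

lemma module_homI:
  assumes "\<And>a. a \<in> carrier M \<Longrightarrow> f a \<in> carrier N"
    and "\<And>a b. \<lbrakk>a \<in> carrier M; b \<in> carrier M\<rbrakk> \<Longrightarrow> f (a \<oplus>\<^bsub>M\<^esub> b) = f a \<oplus>\<^bsub>N\<^esub> f b"
    and "\<And>c a. \<lbrakk>c \<in> carrier K; a \<in> carrier M\<rbrakk> \<Longrightarrow> f (c \<odot>\<^bsub>M\<^esub> a) = c \<odot>\<^bsub>N\<^esub> f a"
  shows "f \<in> module_hom K M N"
  using assms by (auto simp: module_hom_def)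

lemma module_hom_carrier: "\<lbrakk>f \<in> module_hom K M N; a \<in> carrier M\<rbrakk> \<Longrightarrow> f a \<in> carrier N"
  by (auto simp: module_hom_def)

lemma module_hom_comp:
  "\<lbrakk>f \<in> module_hom K M N; g \<in> module_hom K N P\<rbrakk> \<Longrightarrow> (\<lambda>a. g (f a)) \<in> module_hom K M P"
  by (auto simp: module_hom_def Pi_iff)

lemma module_hom_cong:
  assumes "module K M" "\<And>a. a \<in> carrier M \<Longrightarrow> f a = g a"
  shows "f \<in> module_hom K M N \<longleftrightarrow> g \<in> module_hom K M N"
proof -
  interpret module K M by fact
  show ?thesis
    using assms(2) by (auto simp: module_hom_def Pi_iff)
qed

lemma module_hom_finsum:
  assumes "module K M" "module K N" "f \<in> module_hom K M N" "g \<in> I \<rightarrow> carrier M"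
  shows "f (\<Oplus>\<^bsub>M\<^esub>i\<in>I. g i) = (\<Oplus>\<^bsub>N\<^esub>i\<in>I. f (g i))"
proof -
  interpret mod_hom K M N f
    using assms(1-3) by (simp add: mod_hom_def mod_hom_axioms_def)
  show ?thesis
    using assms(4)
  proof (induct I rule: infinite_finite_induct)
    case (insert i I)
    then have "f (g j) \<in> carrier N" if "j \<in> insert i I" for j
      using that by (auto simp: Pi_iff)
    with insert show ?case
      by (simp add: M.finsum_insert f_add Pi_iff)
  qed auto
qed

lemma bilinearD:
  assumes "bilinear K A B W \<beta>"
  shows "a \<in> carrier A \<Longrightarrow> \<beta> a \<in> module_hom K B W"
    and "b \<in> carrier B \<Longrightarrow> (\<lambda>a. \<beta> a b) \<in> module_hom K A W"
    and "\<lbrakk>a \<in> carrier A; b \<in> carrier B\<rbrakk> \<Longrightarrow> \<beta> a b \<in> carrier W"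
  using assms by (auto simp: bilinear_def module_hom_def Pi_iff)

lemma bilinearI:
  assumes "\<And>a. a \<in> carrier A \<Longrightarrow> \<beta> a \<in> module_hom K B W"
    and "\<And>b. b \<in> carrier B \<Longrightarrow> (\<lambda>a. \<beta> a b) \<in> module_hom K A W"
  shows "bilinear K A B W \<beta>"
  using assms by (auto simp: bilinear_def)

lemma bilinear_comp:
  assumes "bilinear K A' B' W \<beta>" "f \<in> module_hom K A A'" "g \<in> module_hom K B B'"
  shows "bilinear K A B W (\<lambda>a b. \<beta> (f a) (g b))"
proof (rule bilinearI)
  fix a assume "a \<in> carrier A"
  then show "(\<lambda>b. \<beta> (f a) (g b)) \<in> module_hom K B W"
    by (intro module_hom_comp[OF assms(3)] bilinearD(1)[OF assms(1)] module_hom_carrier[OF assms(2)])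
next
  fix b assume "b \<in> carrier B"
  then show "(\<lambda>a. \<beta> (f a) (g b)) \<in> module_hom K A W"
    by (intro module_hom_comp[OF assms(2)] bilinearD(2)[OF assms(1)] module_hom_carrier[OF assms(3)])
qed

lemma bilinear_comp_left:
  assumes "bilinear K A B W \<beta>" "g \<in> module_hom K W W'"
  shows "bilinear K A B W' (\<lambda>a b. g (\<beta> a b))"
  using assms by (auto intro!: bilinearI module_hom_comp[OF _ assms(2)] dest: bilinearD)

section \<open>The free module underlying the monoid algebra\<close>

context cring
begin

lemma free_carrier_iff:
  "f \<in> carrier (monoid_algebra R G) \<longleftrightarrow> (\<forall>p. f p \<in> carrier R) \<and> (\<forall>p. p \<notin> carrier G \<longrightarrow> f p = \<zero>)
    \<and> finite {p. f p \<noteq> \<zero>}"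
  by (simp add: monoid_algebra_def)

lemma free_closed: "f \<in> carrier (monoid_algebra R G) \<Longrightarrow> f p \<in> carrier R"
  by (simp add: free_carrier_iff)

lemma free_finite: "f \<in> carrier (monoid_algebra R G) \<Longrightarrow> finite {p. f p \<noteq> \<zero>}"
  by (simp add: free_carrier_iff)

lemma free_simps:
  "(f \<oplus>\<^bsub>monoid_algebra R G\<^esub> g) = (\<lambda>p. f p \<oplus> g p)"
  "c \<odot>\<^bsub>monoid_algebra R G\<^esub> f = (\<lambda>p. c \<otimes> f p)"
  "\<zero>\<^bsub>monoid_algebra R G\<^esub> = (\<lambda>p. \<zero>)"
  by (auto simp: monoid_algebra_def)

lemma free_add_closed:
  assumes "f \<in> carrier (monoid_algebra R G)" "g \<in> carrier (monoid_algebra R G)"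
  shows "(\<lambda>p. f p \<oplus> g p) \<in> carrier (monoid_algebra R G)"
proof -
  have "{p. f p \<oplus> g p \<noteq> \<zero>} \<subseteq> {p. f p \<noteq> \<zero>} \<union> {p. g p \<noteq> \<zero>}"
    using assms by (auto simp: free_carrier_iff)
  with assms show ?thesis
    by (auto simp: free_carrier_iff intro: finite_subset)
qed

lemma free_smult_closed:
  assumes "f \<in> carrier (monoid_algebra R G)" "c \<in> carrier R"
  shows "(\<lambda>p. c \<otimes> f p) \<in> carrier (monoid_algebra R G)"
proof -
  have "{p. c \<otimes> f p \<noteq> \<zero>} \<subseteq> {p. f p \<noteq> \<zero>}"
    using assms by (auto simp: free_carrier_iff)
  with assms show ?thesis
    by (auto simp: free_carrier_iff intro: finite_subset)
qed

lemma free_gen_carrier: "p \<in> carrier G \<Longrightarrow> free_gen R p \<in> carrier (monoid_algebra R G)"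
proof -
  have "{q. free_gen R p q \<noteq> \<zero>} \<subseteq> {p}"
    by (auto simp: free_gen_def)
  then have "finite {q. free_gen R p q \<noteq> \<zero>}"
    by (rule finite_subset) simp
  then show "p \<in> carrier G \<Longrightarrow> ?thesis"
    by (auto simp: free_carrier_iff free_gen_def)
qed

lemma free_module: "module R (monoid_algebra R G)"
proof (rule moduleI)
  show "abelian_group (monoid_algebra R G)"
  proof (rule abelian_groupI, unfold free_simps)
    fix f assume f: "f \<in> carrier (monoid_algebra R G)"
    have "(\<lambda>p. \<ominus> f p) = (\<lambda>p. (\<ominus> \<one>) \<otimes> f p)"
      using f by (auto simp: free_carrier_iff l_minus)
    then have "(\<lambda>p. \<ominus> f p) \<in> carrier (monoid_algebra R G)"
      using free_smult_closed[OF f, of "\<ominus> \<one>"] by simp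
    moreover have "(\<lambda>p. (\<ominus> f p) \<oplus> f p) = (\<lambda>p. \<zero>)"
      using f by (auto simp: free_carrier_iff l_neg)
    ultimately show "\<exists>g\<in>carrier (monoid_algebra R G). (\<lambda>p. g p \<oplus> f p) = (\<lambda>p. \<zero>)"
      by (intro bexI[of _ "\<lambda>p. \<ominus> f p"])
  qed (auto simp: free_add_closed, auto simp: free_carrier_iff a_ac)
qed (auto simp: free_simps free_smult_closed is_cring l_distr r_distr m_assoc free_closed)

end

section \<open>Evaluation of a bilinear map on formal sums\<close>

locale bilinear_map = A: module K A + B: module K B + W: module K W
  for K (structure) and A :: "('k, 'a) module" and B :: "('k, 'b) module" and W :: "('k, 'c) module" +
  fixes \<beta> :: "'a \<Rightarrow> 'b \<Rightarrow> 'c"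
  assumes bilinear: "bilinear K A B W \<beta>"
begin

abbreviation "F \<equiv> monoid_algebra K (A \<times>\<times> B)"

lemma \<beta>_closed [simp]: "\<lbrakk>a \<in> carrier A; b \<in> carrier B\<rbrakk> \<Longrightarrow> \<beta> a b \<in> carrier W"
  using bilinearD(3)[OF bilinear] .

lemma support_subset: "f \<in> carrier F \<Longrightarrow> {p. f p \<noteq> \<zero>} \<subseteq> carrier A \<times> carrier B"
  by (auto simp: A.free_carrier_iff)

lemma summand_closed:
  "\<lbrakk>f \<in> carrier F; p \<in> carrier A \<times> carrier B\<rbrakk> \<Longrightarrow> f p \<odot>\<^bsub>W\<^esub> \<beta> (fst p) (snd p) \<in> carrier W"
  by (auto intro: A.free_closed)

text \<open>Summands outside the support vanish. Cancellation may shrink the support of a sum or a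
  multiple, so linearity is computed over one common finite set instead of the individual
  supports.\<close>

lemma tensor_eval_superset:
  assumes f: "f \<in> carrier F" and P: "finite P" "{p. f p \<noteq> \<zero>} \<subseteq> P" "P \<subseteq> carrier A \<times> carrier B"
  shows "tensor_eval K W \<beta> f = (\<Oplus>\<^bsub>W\<^esub>p\<in>P. f p \<odot>\<^bsub>W\<^esub> \<beta> (fst p) (snd p))"
  unfolding tensor_eval_def
proof (rule W.add.finprod_mono_neutral_cong_left)
  show "f p \<odot>\<^bsub>W\<^esub> \<beta> (fst p) (snd p) = \<zero>\<^bsub>W\<^esub>" if "p \<in> P - {p. f p \<noteq> \<zero>}" for p
  proof -
    from that have "f p = \<zero>" "p \<in> carrier A \<times> carrier B"
      using P by auto
    then show ?thesis
      by auto
  qed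
qed (use P summand_closed[OF f] in auto)

lemma tensor_eval_gen:
  assumes "a \<in> carrier A" "b \<in> carrier B"
  shows "tensor_eval K W \<beta> (free_gen K (a, b)) = \<beta> a b"
proof -
  have "tensor_eval K W \<beta> (free_gen K (a, b)) =
      (\<Oplus>\<^bsub>W\<^esub>p\<in>{(a, b)}. free_gen K (a, b) p \<odot>\<^bsub>W\<^esub> \<beta> (fst p) (snd p))"
    by (rule tensor_eval_superset) (use assms in \<open>auto simp: free_gen_def intro!: A.free_gen_carrier[unfolded free_gen_def]\<close>)
  also have "\<dots> = \<beta> a b"
    using assms by (simp add: free_gen_def)
  finally show ?thesis .
qed

lemma tensor_eval_closed: "f \<in> carrier F \<Longrightarrow> tensor_eval K W \<beta> f \<in> carrier W"
  unfolding tensor_eval_def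
  by (rule W.finsum_closed) (use summand_closed support_subset in blast)

lemma tensor_eval_hom: "tensor_eval K W \<beta> \<in> module_hom K F W"
proof (rule module_homI)
  fix f g assume f: "f \<in> carrier F" and g: "g \<in> carrier F"
  define P where "P = {p. f p \<noteq> \<zero>} \<union> {p. g p \<noteq> \<zero>}"
  have P: "finite P" "P \<subseteq> carrier A \<times> carrier B" "{p. f p \<noteq> \<zero>} \<subseteq> P" "{p. g p \<noteq> \<zero>} \<subseteq> P"
    using support_subset[OF f] support_subset[OF g] A.free_finite[OF f] A.free_finite[OF g]
    by (auto simp: P_def)
  have "{p. f p \<oplus> g p \<noteq> \<zero>} \<subseteq> P"
    by (auto simp: P_def)
  then have "tensor_eval K W \<beta> (f \<oplus>\<^bsub>F\<^esub> g) = (\<Oplus>\<^bsub>W\<^esub>p\<in>P. (f p \<oplus> g p) \<odot>\<^bsub>W\<^esub> \<beta> (fst p) (snd p))"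
    unfolding A.free_simps
    by (intro tensor_eval_superset A.free_add_closed f g P)
  also have "\<dots> = (\<Oplus>\<^bsub>W\<^esub>p\<in>P. f p \<odot>\<^bsub>W\<^esub> \<beta> (fst p) (snd p) \<oplus>\<^bsub>W\<^esub> g p \<odot>\<^bsub>W\<^esub> \<beta> (fst p) (snd p))"
  proof (rule W.add.finprod_cong'[simplified])
    fix p assume "p \<in> P"
    then have "p \<in> carrier A \<times> carrier B"
      using P by blast
    then show "(f p \<oplus> g p) \<odot>\<^bsub>W\<^esub> \<beta> (fst p) (snd p) =
        f p \<odot>\<^bsub>W\<^esub> \<beta> (fst p) (snd p) \<oplus>\<^bsub>W\<^esub> g p \<odot>\<^bsub>W\<^esub> \<beta> (fst p) (snd p)"
      by (intro W.smult_l_distr A.free_closed[OF f] A.free_closed[OF g] \<beta>_closed) auto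
  qed (use P summand_closed[OF f] summand_closed[OF g] in auto)
  also have "\<dots> = (\<Oplus>\<^bsub>W\<^esub>p\<in>P. f p \<odot>\<^bsub>W\<^esub> \<beta> (fst p) (snd p)) \<oplus>\<^bsub>W\<^esub> (\<Oplus>\<^bsub>W\<^esub>p\<in>P. g p \<odot>\<^bsub>W\<^esub> \<beta> (fst p) (snd p))"
    by (rule W.finsum_addf) (use P summand_closed[OF f] summand_closed[OF g] in auto)
  also have "\<dots> = tensor_eval K W \<beta> f \<oplus>\<^bsub>W\<^esub> tensor_eval K W \<beta> g"
    using P by (simp add: tensor_eval_superset[OF f, of P] tensor_eval_superset[OF g, of P])
  finally show "tensor_eval K W \<beta> (f \<oplus>\<^bsub>F\<^esub> g) = tensor_eval K W \<beta> f \<oplus>\<^bsub>W\<^esub> tensor_eval K W \<beta> g" .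
next
  fix c f assume c: "c \<in> carrier K" and f: "f \<in> carrier F"
  define P where "P = {p. f p \<noteq> \<zero>}"
  have P: "finite P" "P \<subseteq> carrier A \<times> carrier B"
    using support_subset[OF f] A.free_finite[OF f] by (auto simp: P_def)
  have "{p. c \<otimes> f p \<noteq> \<zero>} \<subseteq> P"
    using c by (auto simp: P_def)
  then have "tensor_eval K W \<beta> (c \<odot>\<^bsub>F\<^esub> f) = (\<Oplus>\<^bsub>W\<^esub>p\<in>P. (c \<otimes> f p) \<odot>\<^bsub>W\<^esub> \<beta> (fst p) (snd p))"
    unfolding A.free_simps
    by (intro tensor_eval_superset A.free_smult_closed f c P)
  also have "\<dots> = (\<Oplus>\<^bsub>W\<^esub>p\<in>P. c \<odot>\<^bsub>W\<^esub> (f p \<odot>\<^bsub>W\<^esub> \<beta> (fst p) (snd p)))"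
  proof (rule W.add.finprod_cong'[simplified])
    fix p assume "p \<in> P"
    then have "p \<in> carrier A \<times> carrier B"
      using P by blast
    then show "(c \<otimes> f p) \<odot>\<^bsub>W\<^esub> \<beta> (fst p) (snd p) = c \<odot>\<^bsub>W\<^esub> (f p \<odot>\<^bsub>W\<^esub> \<beta> (fst p) (snd p))"
      by (intro W.smult_assoc1 A.free_closed[OF f] c \<beta>_closed) auto
  qed (use P summand_closed[OF f] c in auto)
  also have "\<dots> = c \<odot>\<^bsub>W\<^esub> tensor_eval K W \<beta> f"
    unfolding tensor_eval_def P_def[symmetric]
    by (rule W.finsum_smult_ldistr[symmetric]) (use c P summand_closed[OF f] in auto)
  finally show "tensor_eval K W \<beta> (c \<odot>\<^bsub>F\<^esub> f) = c \<odot>\<^bsub>W\<^esub> tensor_eval K W \<beta> f" .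
qed (rule tensor_eval_closed)

end

section \<open>The tensor product as a quotient module\<close>

locale tensor_product = A: module K A + B: module K B
  for K (structure) and A :: "('k, 'a) module" and B :: "('k, 'b) module"
begin

abbreviation "F \<equiv> monoid_algebra K (A \<times>\<times> B)"
abbreviation "N \<equiv> tensor_kernel K A B"
abbreviation "T \<equiv> tensor K A B"

sublocale F: module K F
  by (rule A.free_module)

lemma gen_carrier: "\<lbrakk>a \<in> carrier A; b \<in> carrier B\<rbrakk> \<Longrightarrow> free_gen K (a, b) \<in> carrier F"
  by (simp add: A.free_gen_carrier)

lemma relations_carrier: "bilinear_relations K A B \<subseteq> carrier F"
  unfolding bilinear_relations_def Let_def
  by (auto intro!: F.minus_closed F.add.m_closed F.smult_closed gen_carrier)

lemma kernel_submodule: "submodule K N F"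
  unfolding tensor_kernel_def by (rule F.span_is_submodule[OF relations_carrier])

lemma kernel_subset: "N \<subseteq> carrier F"
  using submodule.subset[OF kernel_submodule] .

lemma kernel_zero: "\<zero>\<^bsub>F\<^esub> \<in> N"
  using submodule.zero_closed[OF kernel_submodule] .

sublocale N: abelian_subgroup N F
proof (rule abelian_subgroupI3)
  have "subgroup N (add_monoid F)"
  proof (rule F.add.subgroupI)
    fix f assume f: "f \<in> N"
    then have "\<ominus>\<^bsub>F\<^esub> f = (\<ominus> \<one>) \<odot>\<^bsub>F\<^esub> f"
      using kernel_subset by (subst F.smult_l_minus) auto
    with f show "\<ominus>\<^bsub>F\<^esub> f \<in> N"
      by (simp add: submodule.smult_closed[OF kernel_submodule])
  qed (use kernel_subset kernel_zero submodule.m_closed[OF kernel_submodule] in auto)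
  then show "additive_subgroup N F"
    by (rule additive_subgroupI)
qed (rule F.abelian_group_axioms)

lemma coset_self: "f \<in> carrier F \<Longrightarrow> f \<in> N +>\<^bsub>F\<^esub> f"
  by (rule N.a_rcos_self)

lemma coset_memD: "\<lbrakk>f \<in> carrier F; g \<in> N +>\<^bsub>F\<^esub> f\<rbrakk> \<Longrightarrow> g \<in> carrier F \<and> N +>\<^bsub>F\<^esub> g = N +>\<^bsub>F\<^esub> f"
  using F.a_repr_independence[OF _ _ N.a_subgroup] F.a_r_coset_subset_G[OF kernel_subset] by blast

lemma tensor_carrier: "t \<in> carrier T \<longleftrightarrow> (\<exists>f\<in>carrier F. t = N +>\<^bsub>F\<^esub> f)"
  by (auto simp: tensor_def Let_def ring.defs module.defs FactRing_def A_RCOSETS_def RCOSETS_def a_r_coset_def)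

lemma tensor_memE:
  assumes "t \<in> carrier T"
  obtains f where "f \<in> carrier F" "t = N +>\<^bsub>F\<^esub> f"
  using assms by (auto simp: tensor_carrier)

lemma tensor_memD:
  assumes "t \<in> carrier T" "f \<in> t"
  shows "f \<in> carrier F" "t = N +>\<^bsub>F\<^esub> f"
proof -
  obtain g where "g \<in> carrier F" "t = N +>\<^bsub>F\<^esub> g"
    using assms(1) by (rule tensor_memE)
  then show "f \<in> carrier F" "t = N +>\<^bsub>F\<^esub> f"
    using coset_memD[of g f] assms(2) by blast+
qed

lemma coset_carrier: "f \<in> carrier F \<Longrightarrow> N +>\<^bsub>F\<^esub> f \<in> carrier T"
  by (auto simp: tensor_carrier)

lemma tensor_nonempty: "t \<in> carrier T \<Longrightarrow> \<exists>f. f \<in> t"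
  using coset_self by (auto simp: tensor_carrier)

lemma tensor_zero: "\<zero>\<^bsub>T\<^esub> = N"
  by (simp add: tensor_def Let_def ring.defs module.defs FactRing_def)

lemma tensor_add_eq: "s \<oplus>\<^bsub>T\<^esub> t = s <+>\<^bsub>F\<^esub> t"
  by (simp add: tensor_def Let_def ring.defs module.defs FactRing_def)

lemma tensor_mult_eq: "s \<otimes>\<^bsub>T\<^esub> t = (\<Union>f\<in>s. \<Union>g\<in>t. N +>\<^bsub>F\<^esub> (f \<otimes>\<^bsub>F\<^esub> g))"
  by (simp add: tensor_def Let_def ring.defs module.defs FactRing_def rcoset_mult_def)

lemma tensor_one_eq: "\<one>\<^bsub>T\<^esub> = N +>\<^bsub>F\<^esub> \<one>\<^bsub>F\<^esub>"
  by (simp add: tensor_def Let_def ring.defs module.defs FactRing_def)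

lemma tensor_smult_eq: "c \<odot>\<^bsub>T\<^esub> t = (\<Union>f\<in>t. N +>\<^bsub>F\<^esub> (c \<odot>\<^bsub>F\<^esub> f))"
  by (simp add: tensor_def Let_def ring.defs module.defs FactRing_def)

lemma coset_add:
  "\<lbrakk>f \<in> carrier F; g \<in> carrier F\<rbrakk> \<Longrightarrow> (N +>\<^bsub>F\<^esub> f) \<oplus>\<^bsub>T\<^esub> (N +>\<^bsub>F\<^esub> g) = N +>\<^bsub>F\<^esub> (f \<oplus>\<^bsub>F\<^esub> g)"
  by (simp add: tensor_add_eq N.a_rcos_sum)

text \<open>Scalar multiplication is defined as a union over all representatives. As the kernel is a
  submodule, every representative contributes the same coset and the union collapses.\<close>

lemma coset_smult:
  assumes "c \<in> carrier K" "f \<in> carrier F"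
  shows "c \<odot>\<^bsub>T\<^esub> (N +>\<^bsub>F\<^esub> f) = N +>\<^bsub>F\<^esub> (c \<odot>\<^bsub>F\<^esub> f)"
proof -
  have "N +>\<^bsub>F\<^esub> (c \<odot>\<^bsub>F\<^esub> g) = N +>\<^bsub>F\<^esub> (c \<odot>\<^bsub>F\<^esub> f)" if g: "g \<in> N +>\<^bsub>F\<^esub> f" for g
  proof -
    obtain n where n: "n \<in> N" "g = n \<oplus>\<^bsub>F\<^esub> f"
      using g by (auto simp: a_r_coset_def')
    then have "c \<odot>\<^bsub>F\<^esub> g = c \<odot>\<^bsub>F\<^esub> n \<oplus>\<^bsub>F\<^esub> c \<odot>\<^bsub>F\<^esub> f"
      using assms kernel_subset by (auto intro!: F.smult_r_distr)
    moreover have "c \<odot>\<^bsub>F\<^esub> n \<in> N"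
      using n assms by (simp add: submodule.smult_closed[OF kernel_submodule])
    ultimately have "c \<odot>\<^bsub>F\<^esub> g \<in> N +>\<^bsub>F\<^esub> (c \<odot>\<^bsub>F\<^esub> f)"
      by (auto simp: a_r_coset_def')
    then show ?thesis
      using coset_memD assms F.smult_closed by blast
  qed
  then show ?thesis
    unfolding tensor_smult_eq using coset_self[OF assms(2)] by blast
qed

lemma coset_zero: "N +>\<^bsub>F\<^esub> \<zero>\<^bsub>F\<^esub> = \<zero>\<^bsub>T\<^esub>"
  unfolding tensor_zero by (rule F.a_coset_add_zero[OF kernel_subset])

lemma tensor_module: "module K T"
proof (rule moduleI)
  show "abelian_group T"
  proof (rule abelian_groupI)
    fix t assume "t \<in> carrier T"
    then obtain f where f: "f \<in> carrier F" "t = N +>\<^bsub>F\<^esub> f"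
      by (rule tensor_memE)
    then have "(N +>\<^bsub>F\<^esub> (\<ominus>\<^bsub>F\<^esub> f)) \<oplus>\<^bsub>T\<^esub> t = \<zero>\<^bsub>T\<^esub>"
      by (simp add: coset_add F.l_neg coset_zero)
    then show "\<exists>s\<in>carrier T. s \<oplus>\<^bsub>T\<^esub> t = \<zero>\<^bsub>T\<^esub>"
      using f coset_carrier by blast
    show "\<zero>\<^bsub>T\<^esub> \<oplus>\<^bsub>T\<^esub> t = t"
      using f by (simp add: coset_add flip: coset_zero)
  next
    show "\<zero>\<^bsub>T\<^esub> \<in> carrier T"
      using coset_zero coset_carrier by (metis F.zero_closed)
  next
    fix s t assume "s \<in> carrier T" "t \<in> carrier T"
    then obtain f g where fg: "f \<in> carrier F" "s = N +>\<^bsub>F\<^esub> f" "g \<in> carrier F" "t = N +>\<^bsub>F\<^esub> g"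
      by (elim tensor_memE)
    then show "s \<oplus>\<^bsub>T\<^esub> t \<in> carrier T" "s \<oplus>\<^bsub>T\<^esub> t = t \<oplus>\<^bsub>T\<^esub> s"
      by (simp_all add: coset_add coset_carrier F.a_comm[of f g])
    fix r assume "r \<in> carrier T"
    then obtain h where "h \<in> carrier F" "r = N +>\<^bsub>F\<^esub> h"
      by (elim tensor_memE)
    with fg show "s \<oplus>\<^bsub>T\<^esub> t \<oplus>\<^bsub>T\<^esub> r = s \<oplus>\<^bsub>T\<^esub> (t \<oplus>\<^bsub>T\<^esub> r)"
      by (simp add: coset_add F.a_assoc)
  qed
next
  fix c t assume c: "c \<in> carrier K" and "t \<in> carrier T"
  then obtain f where f: "f \<in> carrier F" "t = N +>\<^bsub>F\<^esub> f"
    by (elim tensor_memE)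
  then show "c \<odot>\<^bsub>T\<^esub> t \<in> carrier T"
    using c by (simp add: coset_smult coset_carrier)
  {
    fix d assume "d \<in> carrier K"
    then show "(c \<oplus>\<^bsub>K\<^esub> d) \<odot>\<^bsub>T\<^esub> t = c \<odot>\<^bsub>T\<^esub> t \<oplus>\<^bsub>T\<^esub> d \<odot>\<^bsub>T\<^esub> t"
      "(c \<otimes>\<^bsub>K\<^esub> d) \<odot>\<^bsub>T\<^esub> t = c \<odot>\<^bsub>T\<^esub> (d \<odot>\<^bsub>T\<^esub> t)"
      using f c by (simp_all add: coset_smult coset_add F.smult_l_distr F.smult_assoc1)
  }
  fix s assume "s \<in> carrier T"
  then obtain g where g: "g \<in> carrier F" "s = N +>\<^bsub>F\<^esub> g"
    by (elim tensor_memE)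
  with f c show "c \<odot>\<^bsub>T\<^esub> (t \<oplus>\<^bsub>T\<^esub> s) = c \<odot>\<^bsub>T\<^esub> t \<oplus>\<^bsub>T\<^esub> c \<odot>\<^bsub>T\<^esub> s"
    by (simp add: coset_smult coset_add F.smult_r_distr)
next
  fix t assume "t \<in> carrier T"
  then show "\<one>\<^bsub>K\<^esub> \<odot>\<^bsub>T\<^esub> t = t"
    by (auto simp: coset_smult elim: tensor_memE)
qed (rule A.is_cring)

sublocale T: module K T
  by (rule tensor_module)

lemma pure_tensor_closed [simp]:
  "\<lbrakk>a \<in> carrier A; b \<in> carrier B\<rbrakk> \<Longrightarrow> pure_tensor K A B a b \<in> carrier T"
  by (simp add: pure_tensor_def coset_carrier gen_carrier)

text \<open>Each bilinearity law for pure tensors corresponds to one generator of the kernel, so it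
  is enough to recognize a single difference as a relation.\<close>

lemma coset_eqI:
  assumes "f \<in> carrier F" "g \<in> carrier F" "f \<ominus>\<^bsub>F\<^esub> g \<in> bilinear_relations K A B"
  shows "N +>\<^bsub>F\<^esub> f = N +>\<^bsub>F\<^esub> g"
proof -
  have "f \<ominus>\<^bsub>F\<^esub> g \<in> N"
    unfolding tensor_kernel_def using F.in_own_span[OF relations_carrier] assms(3) by blast
  moreover have "f = (f \<ominus>\<^bsub>F\<^esub> g) \<oplus>\<^bsub>F\<^esub> g"
    using assms by (simp add: F.minus_eq F.a_assoc F.l_neg)
  ultimately have "f \<in> N +>\<^bsub>F\<^esub> g"
    by (auto simp: a_r_coset_def')
  then show ?thesis
    using coset_memD assms by blast
qed

lemma pure_tensor_bilinear: "bilinear K A B T (pure_tensor K A B)"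
proof (rule bilinearI)
  fix a assume a: "a \<in> carrier A"
  show "pure_tensor K A B a \<in> module_hom K B T"
  proof (rule module_homI)
    fix b b' assume b: "b \<in> carrier B" "b' \<in> carrier B"
    have "free_gen K (a, b \<oplus>\<^bsub>B\<^esub> b') \<ominus>\<^bsub>F\<^esub> (free_gen K (a, b) \<oplus>\<^bsub>F\<^esub> free_gen K (a, b')) \<in> bilinear_relations K A B"
      using a b unfolding bilinear_relations_def Let_def by blast
    then show "pure_tensor K A B a (b \<oplus>\<^bsub>B\<^esub> b') = pure_tensor K A B a b \<oplus>\<^bsub>T\<^esub> pure_tensor K A B a b'"
      using a b unfolding pure_tensor_def by (simp add: coset_add gen_carrier coset_eqI)
  next
    fix c b assume b: "c \<in> carrier K" "b \<in> carrier B"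
    have "free_gen K (a, c \<odot>\<^bsub>B\<^esub> b) \<ominus>\<^bsub>F\<^esub> c \<odot>\<^bsub>F\<^esub> free_gen K (a, b) \<in> bilinear_relations K A B"
      using a b unfolding bilinear_relations_def Let_def by blast
    then show "pure_tensor K A B a (c \<odot>\<^bsub>B\<^esub> b) = c \<odot>\<^bsub>T\<^esub> pure_tensor K A B a b"
      using a b unfolding pure_tensor_def by (simp add: coset_smult gen_carrier coset_eqI)
  qed (use a in simp)
next
  fix b assume b: "b \<in> carrier B"
  show "(\<lambda>a. pure_tensor K A B a b) \<in> module_hom K A T"
  proof (rule module_homI)
    fix a a' assume a: "a \<in> carrier A" "a' \<in> carrier A"
    have "free_gen K (a \<oplus>\<^bsub>A\<^esub> a', b) \<ominus>\<^bsub>F\<^esub> (free_gen K (a, b) \<oplus>\<^bsub>F\<^esub> free_gen K (a', b)) \<in> bilinear_relations K A B"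
      using a b unfolding bilinear_relations_def Let_def by blast
    then show "pure_tensor K A B (a \<oplus>\<^bsub>A\<^esub> a') b = pure_tensor K A B a b \<oplus>\<^bsub>T\<^esub> pure_tensor K A B a' b"
      using a b unfolding pure_tensor_def by (simp add: coset_add gen_carrier coset_eqI)
  next
    fix c a assume a: "c \<in> carrier K" "a \<in> carrier A"
    have "free_gen K (c \<odot>\<^bsub>A\<^esub> a, b) \<ominus>\<^bsub>F\<^esub> c \<odot>\<^bsub>F\<^esub> free_gen K (a, b) \<in> bilinear_relations K A B"
      using a b unfolding bilinear_relations_def Let_def by blast
    then show "pure_tensor K A B (c \<odot>\<^bsub>A\<^esub> a) b = c \<odot>\<^bsub>T\<^esub> pure_tensor K A B a b"
      using a b unfolding pure_tensor_def by (simp add: coset_smult gen_carrier coset_eqI)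
  qed (use b in simp)
qed

end

section \<open>The universal property of the tensor product\<close>

context bilinear_map
begin

sublocale AB: tensor_product K A B ..

sublocale eval: mod_hom K F W "tensor_eval K W \<beta>"
  by unfold_locales (rule tensor_eval_hom)

lemma tensor_eval_relations:
  "r \<in> bilinear_relations K A B \<Longrightarrow> tensor_eval K W \<beta> r = \<zero>\<^bsub>W\<^esub>"
proof -
  have h: "\<lbrakk>a \<in> carrier A; b \<in> carrier B; b' \<in> carrier B\<rbrakk> \<Longrightarrow> \<beta> a (b \<oplus>\<^bsub>B\<^esub> b') = \<beta> a b \<oplus>\<^bsub>W\<^esub> \<beta> a b'"
    "\<lbrakk>a \<in> carrier A; b \<in> carrier B; c \<in> carrier K\<rbrakk> \<Longrightarrow> \<beta> a (c \<odot>\<^bsub>B\<^esub> b) = c \<odot>\<^bsub>W\<^esub> \<beta> a b"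
    "\<lbrakk>a \<in> carrier A; a' \<in> carrier A; b \<in> carrier B\<rbrakk> \<Longrightarrow> \<beta> (a \<oplus>\<^bsub>A\<^esub> a') b = \<beta> a b \<oplus>\<^bsub>W\<^esub> \<beta> a' b"
    "\<lbrakk>a \<in> carrier A; b \<in> carrier B; c \<in> carrier K\<rbrakk> \<Longrightarrow> \<beta> (c \<odot>\<^bsub>A\<^esub> a) b = c \<odot>\<^bsub>W\<^esub> \<beta> a b" for a a' b b' c
    using module_hom_add[OF bilinearD(1)[OF bilinear]] module_hom_smult[OF bilinearD(1)[OF bilinear]]
      module_hom_add[OF bilinearD(2)[OF bilinear]] module_hom_smult[OF bilinearD(2)[OF bilinear]]
    by simp_all
  show "r \<in> bilinear_relations K A B \<Longrightarrow> ?thesis"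
    unfolding bilinear_relations_def Let_def
    by (elim UnE CollectE exE conjE)
      (simp_all add: AB.gen_carrier eval.f_add eval.f_smult eval.f_minus tensor_eval_gen h)
qed

text \<open>The kernel of the linear map \<open>tensor_eval K W \<beta>\<close> is a submodule
  containing the relations, hence it contains their span.\<close>

lemma tensor_eval_kernel: "r \<in> AB.N \<Longrightarrow> tensor_eval K W \<beta> r = \<zero>\<^bsub>W\<^esub>"
proof -
  have "bilinear_relations K A B \<subseteq> eval.ker"
    using AB.relations_carrier tensor_eval_relations by (auto simp: eval.ker_def)
  then have "AB.N \<subseteq> eval.ker"
    unfolding tensor_kernel_def by (intro AB.F.span_is_subset eval.ker_is_submodule)
  then show "r \<in> AB.N \<Longrightarrow> ?thesis"
    by (auto simp: eval.ker_def)
qed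

text \<open>\<open>tensor_lift\<close> applies \<open>the_elem\<close> to the set of values at all
  representatives, so it carries information only once this set is a singleton. Two representatives
  differ by an element of the kernel, where the evaluation vanishes.\<close>

lemma tensor_lift_eq:
  assumes t: "t \<in> carrier AB.T" and f: "f \<in> t"
  shows "tensor_lift K W \<beta> t = tensor_eval K W \<beta> f"
proof -
  have "tensor_eval K W \<beta> g = tensor_eval K W \<beta> f" if "g \<in> t" for g
  proof -
    have "g \<in> AB.N +>\<^bsub>F\<^esub> f"
      using AB.tensor_memD[OF t f] that by simp
    then obtain n where n: "n \<in> AB.N" "g = n \<oplus>\<^bsub>F\<^esub> f"
      by (auto simp: a_r_coset_def')
    moreover have "n \<in> carrier F" "f \<in> carrier F"
      using AB.kernel_subset n(1) AB.tensor_memD(1)[OF t f] by blast+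
    ultimately show ?thesis
      by (simp only: eval.f_add tensor_eval_kernel[OF n(1)] W.l_zero tensor_eval_closed)
  qed
  with f have "(\<lambda>f. tensor_eval K W \<beta> f) ` t = {tensor_eval K W \<beta> f}"
    by blast
  then show ?thesis
    unfolding tensor_lift_def tensor_eval_def[symmetric] by simp
qed

lemma tensor_lift_coset:
  "f \<in> carrier F \<Longrightarrow> tensor_lift K W \<beta> (AB.N +>\<^bsub>F\<^esub> f) = tensor_eval K W \<beta> f"
  by (rule tensor_lift_eq[OF AB.coset_carrier AB.coset_self])

lemma tensor_lift_pure:
  "\<lbrakk>a \<in> carrier A; b \<in> carrier B\<rbrakk> \<Longrightarrow> tensor_lift K W \<beta> (pure_tensor K A B a b) = \<beta> a b"
  by (simp add: pure_tensor_def tensor_lift_coset AB.gen_carrier tensor_eval_gen)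

lemma tensor_lift_hom: "tensor_lift K W \<beta> \<in> module_hom K AB.T W"
proof (rule module_homI)
  fix t assume "t \<in> carrier AB.T"
  then show "tensor_lift K W \<beta> t \<in> carrier W"
    by (elim AB.tensor_memE) (simp add: tensor_lift_coset tensor_eval_closed)
next
  fix s t assume "s \<in> carrier AB.T" "t \<in> carrier AB.T"
  then obtain f g where "f \<in> carrier F" "s = AB.N +>\<^bsub>F\<^esub> f" "g \<in> carrier F" "t = AB.N +>\<^bsub>F\<^esub> g"
    by (elim AB.tensor_memE)
  then show "tensor_lift K W \<beta> (s \<oplus>\<^bsub>AB.T\<^esub> t) = tensor_lift K W \<beta> s \<oplus>\<^bsub>W\<^esub> tensor_lift K W \<beta> t"
    by (simp add: AB.coset_add tensor_lift_coset eval.f_add)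
next
  fix c t assume "c \<in> carrier K" "t \<in> carrier AB.T"
  then show "tensor_lift K W \<beta> (c \<odot>\<^bsub>AB.T\<^esub> t) = c \<odot>\<^bsub>W\<^esub> tensor_lift K W \<beta> t"
    by (elim AB.tensor_memE) (simp add: AB.coset_smult tensor_lift_coset eval.f_smult)
qed

text \<open>A linear map commutes with the finite sum over a representative. This naturality moves
  linear forms inside lifted maps and so turns equations between tensors into equations between
  scalars.\<close>

lemma tensor_lift_comp:
  assumes W': "module K W'" and g: "g \<in> module_hom K W W'" and t: "t \<in> carrier AB.T"
  shows "g (tensor_lift K W \<beta> t) = tensor_lift K W' (\<lambda>a b. g (\<beta> a b)) t"
proof -
  interpret W': module K W' by fact
  interpret g: mod_hom K W W' g
    by unfold_locales (rule g)
  interpret c: bilinear_map K A B W' "\<lambda>a b. g (\<beta> a b)"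
    by unfold_locales (rule bilinear_comp_left[OF bilinear g])
  obtain f where f: "f \<in> carrier F" "t = AB.N +>\<^bsub>F\<^esub> f"
    using t by (elim AB.tensor_memE)
  define P where "P = {p. f p \<noteq> \<zero>}"
  have P: "finite P" "P \<subseteq> carrier A \<times> carrier B"
    using support_subset[OF f(1)] A.free_finite[OF f(1)] by (auto simp: P_def)
  have "g (tensor_eval K W \<beta> f) = (\<Oplus>\<^bsub>W'\<^esub>p\<in>P. g (f p \<odot>\<^bsub>W\<^esub> \<beta> (fst p) (snd p)))"
    unfolding tensor_eval_def P_def[symmetric]
    by (rule module_hom_finsum[OF W.module_axioms W' g]) (use P summand_closed[OF f(1)] in auto)
  also have "\<dots> = (\<Oplus>\<^bsub>W'\<^esub>p\<in>P. f p \<odot>\<^bsub>W'\<^esub> g (\<beta> (fst p) (snd p)))"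
  proof (rule W'.add.finprod_cong'[simplified])
    fix p assume "p \<in> P"
    then have "p \<in> carrier A \<times> carrier B"
      using P by blast
    then show "g (f p \<odot>\<^bsub>W\<^esub> \<beta> (fst p) (snd p)) = f p \<odot>\<^bsub>W'\<^esub> g (\<beta> (fst p) (snd p))"
      by (intro g.f_smult A.free_closed[OF f(1)] \<beta>_closed) auto
  qed (use P c.summand_closed[OF f(1)] in auto)
  also have "\<dots> = tensor_eval K W' (\<lambda>a b. g (\<beta> a b)) f"
    by (simp add: tensor_eval_def P_def)
  finally show ?thesis
    using f by (simp add: tensor_lift_coset c.tensor_lift_coset)
qed

end


section \<open>Sweedler sums of bilinear forms\<close>

abbreviation linear_form :: "('k, 'm) ring_scheme \<Rightarrow> ('k, 'a) module \<Rightarrow> ('a \<Rightarrow> 'k) \<Rightarrow> bool"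
  where "linear_form K A f \<equiv> f \<in> module_hom K A (ground_algebra K)"

abbreviation bilinear_form ::
  "('k, 'm) ring_scheme \<Rightarrow> ('k, 'a) module \<Rightarrow> ('k, 'b) module \<Rightarrow> ('a \<Rightarrow> 'b \<Rightarrow> 'k) \<Rightarrow> bool"
  where "bilinear_form K A B \<beta> \<equiv> bilinear K A B (ground_algebra K) \<beta>"

definition trilinear_form ::
  "('k, 'm) ring_scheme \<Rightarrow> ('k, 'a) module \<Rightarrow> ('k, 'b) module \<Rightarrow> ('k, 'c) module
    \<Rightarrow> ('a \<Rightarrow> 'b \<Rightarrow> 'c \<Rightarrow> 'k) \<Rightarrow> bool"
  where "trilinear_form K A B C \<gamma> \<longleftrightarrow>
    (\<forall>a\<in>carrier A. bilinear_form K B C (\<gamma> a)) \<and>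
    (\<forall>b\<in>carrier B. \<forall>c\<in>carrier C. linear_form K A (\<lambda>a. \<gamma> a b c))"

lemma ground_algebra_simps [simp]:
  "carrier (ground_algebra K) = carrier K" "\<zero>\<^bsub>ground_algebra K\<^esub> = \<zero>\<^bsub>K\<^esub>"
  "\<one>\<^bsub>ground_algebra K\<^esub> = \<one>\<^bsub>K\<^esub>"
  "a \<oplus>\<^bsub>ground_algebra K\<^esub> b = a \<oplus>\<^bsub>K\<^esub> b" "a \<otimes>\<^bsub>ground_algebra K\<^esub> b = a \<otimes>\<^bsub>K\<^esub> b"
  "a \<odot>\<^bsub>ground_algebra K\<^esub> b = a \<otimes>\<^bsub>K\<^esub> b"
  by (simp_all add: ground_algebra_def)

lemma finsum_ground_algebra [simp]: "finsum (ground_algebra K) = finsum K"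
  by (intro ext) (simp add: finsum_def finprod_def ground_algebra_def)

lemma (in cring) ground_module: "module R (ground_algebra R)"
  by (rule moduleI) (auto simp: is_cring l_distr r_distr m_assoc a_ac
      intro!: abelian_groupI bexI[of _ "\<ominus> x" for x] l_neg)

lemma linear_formI:
  assumes "\<And>a. a \<in> carrier A \<Longrightarrow> f a \<in> carrier K"
    and "\<And>a b. \<lbrakk>a \<in> carrier A; b \<in> carrier A\<rbrakk> \<Longrightarrow> f (a \<oplus>\<^bsub>A\<^esub> b) = f a \<oplus>\<^bsub>K\<^esub> f b"
    and "\<And>c a. \<lbrakk>c \<in> carrier K; a \<in> carrier A\<rbrakk> \<Longrightarrow> f (c \<odot>\<^bsub>A\<^esub> a) = c \<otimes>\<^bsub>K\<^esub> f a"
  shows "linear_form K A f"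
  using assms by (intro module_homI) auto

lemma linear_formD:
  assumes "linear_form K A f"
  shows "a \<in> carrier A \<Longrightarrow> f a \<in> carrier K"
    and "\<lbrakk>a \<in> carrier A; b \<in> carrier A\<rbrakk> \<Longrightarrow> f (a \<oplus>\<^bsub>A\<^esub> b) = f a \<oplus>\<^bsub>K\<^esub> f b"
    and "\<lbrakk>c \<in> carrier K; a \<in> carrier A\<rbrakk> \<Longrightarrow> f (c \<odot>\<^bsub>A\<^esub> a) = c \<otimes>\<^bsub>K\<^esub> f a"
  using assms by (auto simp: module_hom_def)

lemma bilinear_formD:
  assumes "bilinear_form K A B \<beta>"
  shows "a \<in> carrier A \<Longrightarrow> linear_form K B (\<beta> a)"
    and "b \<in> carrier B \<Longrightarrow> linear_form K A (\<lambda>a. \<beta> a b)"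
    and "\<lbrakk>a \<in> carrier A; b \<in> carrier B\<rbrakk> \<Longrightarrow> \<beta> a b \<in> carrier K"
  using bilinearD[OF assms] by simp_all

lemma bilinear_form_cong:
  assumes "module K A" "module K B" "bilinear_form K A B \<beta>"
    and "\<And>a b. \<lbrakk>a \<in> carrier A; b \<in> carrier B\<rbrakk> \<Longrightarrow> \<beta> a b = \<beta>' a b"
  shows "bilinear_form K A B \<beta>'"
proof (rule bilinearI)
  fix a assume a: "a \<in> carrier A"
  show "linear_form K B (\<beta>' a)"
    using module_hom_cong[OF assms(2), of "\<beta> a" "\<beta>' a"] assms(4)[OF a] bilinear_formD(1)[OF assms(3) a]
    by blast
next
  fix b assume b: "b \<in> carrier B"
  show "linear_form K A (\<lambda>a. \<beta>' a b)"
    using module_hom_cong[OF assms(1), of "\<lambda>a. \<beta> a b" "\<lambda>a. \<beta>' a b"] assms(4)[OF _ b]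
      bilinear_formD(2)[OF assms(3) b]
    by blast
qed

lemma trilinear_formI:
  assumes "\<And>a b. \<lbrakk>a \<in> carrier A; b \<in> carrier B\<rbrakk> \<Longrightarrow> linear_form K C (\<lambda>c. \<gamma> a b c)"
    and "\<And>a c. \<lbrakk>a \<in> carrier A; c \<in> carrier C\<rbrakk> \<Longrightarrow> linear_form K B (\<lambda>b. \<gamma> a b c)"
    and "\<And>b c. \<lbrakk>b \<in> carrier B; c \<in> carrier C\<rbrakk> \<Longrightarrow> linear_form K A (\<lambda>a. \<gamma> a b c)"
  shows "trilinear_form K A B C \<gamma>"
  using assms by (auto simp: trilinear_form_def intro!: bilinearI)

section \<open>Closure properties of linear forms, and exchange of finite sums\<close>

context cring
begin

lemma linear_form_cmult: "\<lbrakk>c \<in> carrier R; linear_form R A f\<rbrakk> \<Longrightarrow> linear_form R A (\<lambda>a. c \<otimes> f a)"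
  by (rule linear_formI) (auto simp: linear_formD r_distr m_lcomm)

lemma linear_form_multc: "\<lbrakk>linear_form R A f; c \<in> carrier R\<rbrakk> \<Longrightarrow> linear_form R A (\<lambda>a. f a \<otimes> c)"
  by (rule linear_formI) (auto simp: linear_formD l_distr m_assoc)

lemma linear_form_minus:
  assumes "linear_form R A f" "linear_form R A g"
  shows "linear_form R A (\<lambda>a. f a \<ominus> g a)"
proof (rule linear_formI)
  fix a b assume "a \<in> carrier A" "b \<in> carrier A"
  then have "f a \<in> carrier R" "g a \<in> carrier R" "f b \<in> carrier R" "g b \<in> carrier R"
    using assms linear_formD by metis+
  moreover have "f (a \<oplus>\<^bsub>A\<^esub> b) = f a \<oplus> f b" "g (a \<oplus>\<^bsub>A\<^esub> b) = g a \<oplus> g b"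
    using assms \<open>a \<in> carrier A\<close> \<open>b \<in> carrier A\<close> linear_formD by metis+
  ultimately show "f (a \<oplus>\<^bsub>A\<^esub> b) \<ominus> g (a \<oplus>\<^bsub>A\<^esub> b) = f a \<ominus> g a \<oplus> (f b \<ominus> g b)"
    by (simp, algebra)
next
  fix c a assume "c \<in> carrier R" "a \<in> carrier A"
  then have "f a \<in> carrier R" "g a \<in> carrier R"
    using assms linear_formD by metis+
  moreover have "f (c \<odot>\<^bsub>A\<^esub> a) = c \<otimes> f a" "g (c \<odot>\<^bsub>A\<^esub> a) = c \<otimes> g a"
    using assms \<open>c \<in> carrier R\<close> \<open>a \<in> carrier A\<close> linear_formD by metis+
  ultimately show "f (c \<odot>\<^bsub>A\<^esub> a) \<ominus> g (c \<odot>\<^bsub>A\<^esub> a) = c \<otimes> (f a \<ominus> g a)"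
    using \<open>c \<in> carrier R\<close> by (simp, algebra)
qed (use assms in \<open>auto simp: linear_formD\<close>)

lemma linear_form_finsum:
  assumes "\<And>i. i \<in> I \<Longrightarrow> linear_form R A (f i)"
  shows "linear_form R A (\<lambda>a. \<Oplus>i\<in>I. f i a)"
proof (rule linear_formI)
  fix a b assume ab: "a \<in> carrier A" "b \<in> carrier A"
  have "(\<Oplus>i\<in>I. f i (a \<oplus>\<^bsub>A\<^esub> b)) = (\<Oplus>i\<in>I. f i a \<oplus> f i b)"
    by (rule finsum_cong') (use ab linear_formD[OF assms] in auto)
  then show "(\<Oplus>i\<in>I. f i (a \<oplus>\<^bsub>A\<^esub> b)) = (\<Oplus>i\<in>I. f i a) \<oplus> (\<Oplus>i\<in>I. f i b)"
    using ab linear_formD(1)[OF assms] by (simp add: finsum_addf)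
next
  fix c a assume ca: "c \<in> carrier R" "a \<in> carrier A"
  have "(\<Oplus>i\<in>I. f i (c \<odot>\<^bsub>A\<^esub> a)) = (\<Oplus>i\<in>I. c \<otimes> f i a)"
    by (rule finsum_cong') (use ca linear_formD[OF assms] in auto)
  then show "(\<Oplus>i\<in>I. f i (c \<odot>\<^bsub>A\<^esub> a)) = c \<otimes> (\<Oplus>i\<in>I. f i a)"
    using ca linear_formD(1)[OF assms] module.finsum_smult[OF ground_module, of c "\<lambda>i. f i a" I]
    by (auto simp: Pi_iff)
qed (use linear_formD(1)[OF assms] in \<open>auto intro!: finsum_closed\<close>)

lemma finsum_swap:
  assumes "finite I" "finite J" "\<And>i j. \<lbrakk>i \<in> I; j \<in> J\<rbrakk> \<Longrightarrow> f i j \<in> carrier R"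
  shows "(\<Oplus>i\<in>I. \<Oplus>j\<in>J. f i j) = (\<Oplus>j\<in>J. \<Oplus>i\<in>I. f i j)"
  using assms(1,3)
proof (induct I)
  case empty
  then show ?case by simp
next
  case (insert k I)
  then have "(\<Oplus>i\<in>insert k I. \<Oplus>j\<in>J. f i j) = (\<Oplus>j\<in>J. f k j) \<oplus> (\<Oplus>j\<in>J. \<Oplus>i\<in>I. f i j)"
    by (simp add: Pi_iff)
  also have "\<dots> = (\<Oplus>j\<in>J. f k j \<oplus> (\<Oplus>i\<in>I. f i j))"
    using insert by (subst finsum_addf) (auto intro!: finsum_closed)
  also have "\<dots> = (\<Oplus>j\<in>J. \<Oplus>i\<in>insert k I. f i j)"
    using insert by (intro finsum_cong') (auto intro!: finsum_closed)
  finally show ?case .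
qed

end

text \<open>\<open>sw \<beta> c\<close> stands for \<beta> applied to a fixed tensor attached to c.
  In \<open>sw_rep\<close> the formal sum is chosen before \<beta>, so all forms are evaluated on
  one and the same sum; additivity in \<beta>, dependence on parameters and exchange of two such
  sums all rest on this uniformity.\<close>

locale sweedler = K?: field K + C: module K C + A: module K A + B: module K B
  for K :: "('k, 'm) ring_scheme" (structure) and C :: "('k, 'c) module" and A :: "('k, 'a) module" and B :: "('k, 'b) module" +
  fixes sw :: "('a \<Rightarrow> 'b \<Rightarrow> 'k) \<Rightarrow> 'c \<Rightarrow> 'k"
  assumes sw_linear: "bilinear_form K A B \<beta> \<Longrightarrow> linear_form K C (sw \<beta>)"
    and sw_rep: "c \<in> carrier C \<Longrightarrow> \<exists>P k. finite P \<and> P \<subseteq> carrier A \<times> carrier B \<and> k \<in> P \<rightarrow> carrier K \<and>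
      (\<forall>\<beta>. bilinear_form K A B \<beta> \<longrightarrow> sw \<beta> c = (\<Oplus>p\<in>P. k p \<otimes> \<beta> (fst p) (snd p)))"
begin

lemma sw_closed: "\<lbrakk>bilinear_form K A B \<beta>; c \<in> carrier C\<rbrakk> \<Longrightarrow> sw \<beta> c \<in> carrier K"
  using linear_formD(1)[OF sw_linear] .

definition represents :: "'c \<Rightarrow> ('a \<times> 'b) set \<Rightarrow> ('a \<times> 'b \<Rightarrow> 'k) \<Rightarrow> bool"
  where "represents c P k \<longleftrightarrow> finite P \<and> P \<subseteq> carrier A \<times> carrier B \<and> k \<in> P \<rightarrow> carrier K \<and>
    (\<forall>\<beta>. bilinear_form K A B \<beta> \<longrightarrow> sw \<beta> c = (\<Oplus>p\<in>P. k p \<otimes> \<beta> (fst p) (snd p)))"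

lemma representsD:
  assumes "represents c P k"
  shows "finite P" "P \<subseteq> carrier A \<times> carrier B" "p \<in> P \<Longrightarrow> k p \<in> carrier K"
    "p \<in> P \<Longrightarrow> fst p \<in> carrier A" "p \<in> P \<Longrightarrow> snd p \<in> carrier B"
    "bilinear_form K A B \<beta> \<Longrightarrow> sw \<beta> c = (\<Oplus>p\<in>P. k p \<otimes> \<beta> (fst p) (snd p))"
  using assms by (auto simp: represents_def)

lemma ex_represents: "c \<in> carrier C \<Longrightarrow> \<exists>P k. represents c P k"
  unfolding represents_def by (rule sw_rep)

text \<open>A representation evaluates \<beta> only at points of
  \<open>carrier A \<times> carrier B\<close>. Rewriting under the binder therefore may assume that
  the bound variables lie in the carriers, which most identities require.\<close>

lemma sw_cong:
  assumes c: "c \<in> carrier C" and \<beta>: "bilinear_form K A B \<beta>"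
    and eq: "\<And>p q. \<lbrakk>p \<in> carrier A; q \<in> carrier B\<rbrakk> \<Longrightarrow> \<beta> p q = \<beta>' p q"
  shows "sw \<beta> c = sw \<beta>' c"
proof -
  have \<beta>': "bilinear_form K A B \<beta>'"
    using bilinear_form_cong[OF A.module_axioms B.module_axioms \<beta> eq] .
  obtain P k where "represents c P k"
    using ex_represents[OF c] by blast
  note P = representsD(1-5)[OF this] and rep = representsD(6)[OF this]
  show ?thesis
    unfolding rep[OF \<beta>] rep[OF \<beta>']
  proof (rule K.finsum_cong'[OF refl])
    show "(\<lambda>p. k p \<otimes> \<beta>' (fst p) (snd p)) \<in> P \<rightarrow> carrier K"
      using P bilinear_formD(3)[OF \<beta>'] by auto
    show "k p \<otimes> \<beta> (fst p) (snd p) = k p \<otimes> \<beta>' (fst p) (snd p)" if "p \<in> P" for p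
      using P(4,5)[OF that] by (simp add: eq)
  qed
qed

lemma sw_finsum:
  assumes c: "c \<in> carrier C" and I: "finite I" and \<beta>: "\<And>i. i \<in> I \<Longrightarrow> bilinear_form K A B (\<beta> i)"
  shows "sw (\<lambda>p q. \<Oplus>i\<in>I. \<beta> i p q) c = (\<Oplus>i\<in>I. sw (\<beta> i) c)"
proof -
  obtain P k where "represents c P k"
    using ex_represents[OF c] by blast
  note P = representsD(1-5)[OF this] and rep = representsD(6)[OF this]
  have cl: "\<beta> i (fst p) (snd p) \<in> carrier K" if "i \<in> I" "p \<in> P" for i p
    using bilinear_formD(3)[OF \<beta>[OF that(1)]] P(4,5)[OF that(2)] .
  have "bilinear_form K A B (\<lambda>p q. \<Oplus>i\<in>I. \<beta> i p q)"
    by (intro bilinearI K.linear_form_finsum) (auto dest: bilinear_formD[OF \<beta>])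
  then have "sw (\<lambda>p q. \<Oplus>i\<in>I. \<beta> i p q) c = (\<Oplus>p\<in>P. k p \<otimes> (\<Oplus>i\<in>I. \<beta> i (fst p) (snd p)))"
    by (rule rep)
  also have "\<dots> = (\<Oplus>p\<in>P. \<Oplus>i\<in>I. k p \<otimes> \<beta> i (fst p) (snd p))"
    by (rule K.finsum_cong')
      (use P I cl in \<open>auto intro!: K.finsum_closed K.finsum_rdistr simp: Pi_iff\<close>)
  also have "\<dots> = (\<Oplus>i\<in>I. \<Oplus>p\<in>P. k p \<otimes> \<beta> i (fst p) (snd p))"
    by (rule K.finsum_swap) (use P I cl in auto)
  also have "\<dots> = (\<Oplus>i\<in>I. sw (\<beta> i) c)"
    by (rule K.finsum_cong') (use rep[OF \<beta>] sw_closed[OF \<beta> c] in \<open>auto simp: Pi_iff\<close>)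
  finally show ?thesis .
qed

lemma sw_cmult:
  assumes c: "c \<in> carrier C" and d: "d \<in> carrier K" and \<beta>: "bilinear_form K A B \<beta>"
  shows "sw (\<lambda>p q. d \<otimes> \<beta> p q) c = d \<otimes> sw \<beta> c"
proof -
  obtain P k where "represents c P k"
    using ex_represents[OF c] by blast
  note P = representsD(1-5)[OF this] and rep = representsD(6)[OF this]
  have cl: "\<beta> (fst p) (snd p) \<in> carrier K" if "p \<in> P" for p
    using bilinear_formD(3)[OF \<beta>] P(4,5)[OF that] .
  have "bilinear_form K A B (\<lambda>p q. d \<otimes> \<beta> p q)"
    by (intro bilinearI K.linear_form_cmult d) (auto dest: bilinear_formD[OF \<beta>])
  then have "sw (\<lambda>p q. d \<otimes> \<beta> p q) c = (\<Oplus>p\<in>P. k p \<otimes> (d \<otimes> \<beta> (fst p) (snd p)))"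
    by (rule rep)
  also have "\<dots> = (\<Oplus>p\<in>P. d \<otimes> (k p \<otimes> \<beta> (fst p) (snd p)))"
    by (rule K.finsum_cong') (use P cl d in \<open>auto simp: K.m_lcomm\<close>)
  also have "\<dots> = d \<otimes> sw \<beta> c"
    unfolding rep[OF \<beta>] by (rule K.finsum_rdistr[symmetric]) (use P cl d in auto)
  finally show ?thesis .
qed

lemma sw_minus:
  assumes c: "c \<in> carrier C" and \<beta>: "bilinear_form K A B \<beta>" "bilinear_form K A B \<beta>'"
  shows "sw (\<lambda>p q. \<beta> p q \<ominus> \<beta>' p q) c = sw \<beta> c \<ominus> sw \<beta>' c"
proof -
  have mo: "\<ominus> \<one> \<in> carrier K"
    by simp
  \<comment> \<open>A two-member family with the sign absorbed into the second form, so that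
    subtraction becomes an instance of \<open>sw_finsum\<close>.\<close>
  define \<delta> where "\<delta> = (\<lambda>i::nat. if i = 0 then \<beta> else (\<lambda>p q. \<ominus> \<one> \<otimes> \<beta>' p q))"
  have bl: "bilinear_form K A B (\<lambda>p q. \<ominus> \<one> \<otimes> \<beta>' p q)"
    by (intro bilinearI K.linear_form_cmult mo) (auto dest: bilinear_formD[OF \<beta>(2)])
  have \<delta>: "bilinear_form K A B (\<delta> i)" for i
    using \<beta>(1) bl by (simp add: \<delta>_def)
  have "sw (\<lambda>p q. \<beta> p q \<ominus> \<beta>' p q) c = sw (\<lambda>p q. \<Oplus>i\<in>{0,1}. \<delta> i p q) c"
  proof (rule sw_cong[OF c])
    show "bilinear_form K A B (\<lambda>p q. \<beta> p q \<ominus> \<beta>' p q)"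
      by (intro bilinearI K.linear_form_minus) (auto dest: bilinear_formD[OF \<beta>(1)] bilinear_formD[OF \<beta>(2)])
    fix p q assume "p \<in> carrier A" "q \<in> carrier B"
    then have "\<beta> p q \<in> carrier K" "\<beta>' p q \<in> carrier K"
      using bilinear_formD(3)[OF \<beta>(1)] bilinear_formD(3)[OF \<beta>(2)] by auto
    then show "\<beta> p q \<ominus> \<beta>' p q = (\<Oplus>i\<in>{0,1}. \<delta> i p q)"
      by (simp add: \<delta>_def K.minus_eq K.l_minus Pi_iff)
  qed
  also have "\<dots> = (\<Oplus>i\<in>{0,1}. sw (\<delta> i) c)"
    by (rule sw_finsum[OF c _ \<delta>]) simp
  also have "\<dots> = sw \<beta> c \<oplus> sw (\<lambda>p q. \<ominus> \<one> \<otimes> \<beta>' p q) c"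
    using sw_closed[OF \<beta>(1) c] sw_closed[OF bl c] by (simp add: \<delta>_def Pi_iff)
  also have "\<dots> = sw \<beta> c \<ominus> sw \<beta>' c"
    using sw_closed[OF \<beta>(1) c] sw_closed[OF \<beta>(2) c]
    by (simp add: sw_cmult[OF c mo \<beta>(2)] K.l_minus K.minus_eq)
  finally show ?thesis .
qed

text \<open>In nested sums the inner one has to be linear in each outer variable. One representation
  of c serves for all parameters y, so the result is a fixed linear combination of forms in
  y.\<close>

lemma sw_param:
  assumes c: "c \<in> carrier C" and Y: "module K Y" and \<beta>: "\<And>y. y \<in> carrier Y \<Longrightarrow> bilinear_form K A B (\<beta> y)"
    and lin: "\<And>p q. \<lbrakk>p \<in> carrier A; q \<in> carrier B\<rbrakk> \<Longrightarrow> linear_form K Y (\<lambda>y. \<beta> y p q)"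
  shows "linear_form K Y (\<lambda>y. sw (\<beta> y) c)"
proof -
  obtain P k where "represents c P k"
    using ex_represents[OF c] by blast
  note P = representsD(1-5)[OF this] and rep = representsD(6)[OF this]
  have "linear_form K Y (\<lambda>y. \<Oplus>p\<in>P. k p \<otimes> \<beta> y (fst p) (snd p))"
  proof (intro K.linear_form_finsum K.linear_form_cmult)
    fix p assume "p \<in> P"
    then show "k p \<in> carrier K" "linear_form K Y (\<lambda>y. \<beta> y (fst p) (snd p))"
      using P by (auto intro!: lin)
  qed
  then show ?thesis
    using module_hom_cong[OF Y, of "\<lambda>y. sw (\<beta> y) c" "\<lambda>y. \<Oplus>p\<in>P. k p \<otimes> \<beta> y (fst p) (snd p)"] rep[OF \<beta>]
    by blast
qed

lemma sw_arg:
  "\<lbrakk>bilinear_form K A B \<beta>; g \<in> module_hom K Y C\<rbrakk> \<Longrightarrow> linear_form K Y (\<lambda>y. sw \<beta> (g y))"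
  by (rule module_hom_comp[OF _ sw_linear])

lemma sw_mult_left:
  assumes "c \<in> carrier C" "d \<in> carrier K" "bilinear_form K A B \<beta>"
  shows "d \<otimes> sw \<beta> c = sw (\<lambda>p q. d \<otimes> \<beta> p q) c"
  using sw_cmult[OF assms] by simp

text \<open>Fubini for two independent coproducts. Replacing only the tensor of c' by a
  representation leaves a finite sum of \<open>sw\<close> terms, which folds back in the other
  order.\<close>

lemma sw_swap:
  assumes "sweedler K C' A' B' sw'" and c: "c \<in> carrier C" and c': "c' \<in> carrier C'"
    and \<beta>: "\<And>r s. \<lbrakk>r \<in> carrier A'; s \<in> carrier B'\<rbrakk> \<Longrightarrow> bilinear_form K A B (\<lambda>p q. \<beta> p q r s)"
    and \<beta>': "\<And>p q. \<lbrakk>p \<in> carrier A; q \<in> carrier B\<rbrakk> \<Longrightarrow> bilinear_form K A' B' (\<lambda>r s. \<beta> p q r s)"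
  shows "sw (\<lambda>p q. sw' (\<lambda>r s. \<beta> p q r s) c') c = sw' (\<lambda>r s. sw (\<lambda>p q. \<beta> p q r s) c) c'"
proof -
  interpret s': sweedler K C' A' B' sw' by fact
  obtain P k where "s'.represents c' P k"
    using s'.ex_represents[OF c'] by blast
  note P = s'.representsD(1-5)[OF this] and rep = s'.representsD(6)[OF this]
  have bl: "bilinear_form K A B (\<lambda>p q. k u \<otimes> \<beta> p q (fst u) (snd u))" if "u \<in> P" for u
  proof -
    have "bilinear_form K A B (\<lambda>p q. \<beta> p q (fst u) (snd u))"
      using P that by (intro \<beta>) auto
    then show ?thesis
      using P(3)[OF that] by (intro bilinearI K.linear_form_cmult) (auto dest: bilinear_formD)
  qed
  have o: "bilinear_form K A' B' (\<lambda>r s. sw (\<lambda>p q. \<beta> p q r s) c)"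
  proof (rule bilinearI)
    fix r assume "r \<in> carrier A'"
    then show "linear_form K B' (\<lambda>s. sw (\<lambda>p q. \<beta> p q r s) c)"
      by (intro sw_param[OF c s'.B.module_axioms] \<beta>) (auto dest: bilinear_formD[OF \<beta>'])
  next
    fix s assume "s \<in> carrier B'"
    then show "linear_form K A' (\<lambda>r. sw (\<lambda>p q. \<beta> p q r s) c)"
      by (intro sw_param[OF c s'.A.module_axioms] \<beta>) (auto dest: bilinear_formD[OF \<beta>'])
  qed
  have i: "bilinear_form K A B (\<lambda>p q. sw' (\<lambda>r s. \<beta> p q r s) c')"
  proof (rule bilinearI)
    fix p assume "p \<in> carrier A"
    then show "linear_form K B (\<lambda>q. sw' (\<lambda>r s. \<beta> p q r s) c')"
      by (intro s'.sw_param[OF c' B.module_axioms] \<beta>') (auto dest: bilinear_formD[OF \<beta>])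
  next
    fix q assume "q \<in> carrier B"
    then show "linear_form K A (\<lambda>p. sw' (\<lambda>r s. \<beta> p q r s) c')"
      by (intro s'.sw_param[OF c' A.module_axioms] \<beta>') (auto dest: bilinear_formD[OF \<beta>])
  qed
  have "sw (\<lambda>p q. sw' (\<lambda>r s. \<beta> p q r s) c') c = sw (\<lambda>p q. \<Oplus>u\<in>P. k u \<otimes> \<beta> p q (fst u) (snd u)) c"
    by (rule sw_cong[OF c i rep[OF \<beta>']])
  also have "\<dots> = (\<Oplus>u\<in>P. sw (\<lambda>p q. k u \<otimes> \<beta> p q (fst u) (snd u)) c)"
    by (rule sw_finsum[OF c P(1) bl])
  also have "\<dots> = (\<Oplus>u\<in>P. k u \<otimes> sw (\<lambda>p q. \<beta> p q (fst u) (snd u)) c)"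
  proof (rule K.finsum_cong'[OF refl])
    fix u assume u: "u \<in> P"
    then show "sw (\<lambda>p q. k u \<otimes> \<beta> p q (fst u) (snd u)) c = k u \<otimes> sw (\<lambda>p q. \<beta> p q (fst u) (snd u)) c"
      using P by (intro sw_cmult[OF c] \<beta>) auto
  next
    show "(\<lambda>u. k u \<otimes> sw (\<lambda>p q. \<beta> p q (fst u) (snd u)) c) \<in> P \<rightarrow> carrier K"
    proof
      fix u assume u: "u \<in> P"
      then show "k u \<otimes> sw (\<lambda>p q. \<beta> p q (fst u) (snd u)) c \<in> carrier K"
        using P by (intro K.m_closed sw_closed[OF _ c] \<beta>) auto
    qed
  qed
  also have "\<dots> = sw' (\<lambda>r s. sw (\<lambda>p q. \<beta> p q r s) c) c'"
    by (rule rep[OF o, symmetric])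
  finally show ?thesis .
qed

end


section \<open>Integrals on a finite-dimensional Hopf algebra\<close>

text \<open>The basis vectors serve as their own indices, with \<open>v i\<close> the coordinate at
  i. The axiom \<open>form_expand\<close> is the basis expansion of a seen through a linear form,
  which keeps all calculations in K.\<close>

locale hopf = K?: field K + A: assoc_algebra K A + sweedler K A A A sw
  for K :: "('k, 'm) ring_scheme" (structure) and A :: "('k, 'a) module"
    and sw :: "('a \<Rightarrow> 'a \<Rightarrow> 'k) \<Rightarrow> 'a \<Rightarrow> 'k" +
  fixes \<epsilon> :: "'a \<Rightarrow> 'k" and S :: "'a \<Rightarrow> 'a" and I :: "'a set" and v :: "'a \<Rightarrow> 'a \<Rightarrow> 'k"
  assumes sw_mult: "\<lbrakk>bilinear_form K A A \<beta>; a \<in> carrier A; b \<in> carrier A\<rbrakk> \<Longrightarrow>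
      sw \<beta> (a \<otimes>\<^bsub>A\<^esub> b) = sw (\<lambda>p q. sw (\<lambda>r s. \<beta> (p \<otimes>\<^bsub>A\<^esub> r) (q \<otimes>\<^bsub>A\<^esub> s)) b) a"
    and sw_one: "bilinear_form K A A \<beta> \<Longrightarrow> sw \<beta> \<one>\<^bsub>A\<^esub> = \<beta> \<one>\<^bsub>A\<^esub> \<one>\<^bsub>A\<^esub>"
    and sw_assoc: "\<lbrakk>trilinear_form K A A A \<gamma>; a \<in> carrier A\<rbrakk> \<Longrightarrow>
      sw (\<lambda>t r. sw (\<lambda>p q. \<gamma> p q r) t) a = sw (\<lambda>p t. sw (\<gamma> p) t) a"
    and counit_form: "linear_form K A \<epsilon>"
    and counit_one: "\<epsilon> \<one>\<^bsub>A\<^esub> = \<one>"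
    and counit_mult: "\<lbrakk>a \<in> carrier A; b \<in> carrier A\<rbrakk> \<Longrightarrow> \<epsilon> (a \<otimes>\<^bsub>A\<^esub> b) = \<epsilon> a \<otimes> \<epsilon> b"
    and sw_counit_left: "\<lbrakk>linear_form K A f; a \<in> carrier A\<rbrakk> \<Longrightarrow> sw (\<lambda>p q. \<epsilon> p \<otimes> f q) a = f a"
    and sw_counit_right: "\<lbrakk>linear_form K A f; a \<in> carrier A\<rbrakk> \<Longrightarrow> sw (\<lambda>p q. f p \<otimes> \<epsilon> q) a = f a"
    and antipode_linear: "S \<in> module_hom K A A"
    and sw_antipode_left: "\<lbrakk>linear_form K A f; a \<in> carrier A\<rbrakk> \<Longrightarrow>
      sw (\<lambda>p q. f (S p \<otimes>\<^bsub>A\<^esub> q)) a = \<epsilon> a \<otimes> f \<one>\<^bsub>A\<^esub>"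
    and sw_antipode_right: "\<lbrakk>linear_form K A f; a \<in> carrier A\<rbrakk> \<Longrightarrow>
      sw (\<lambda>p q. f (p \<otimes>\<^bsub>A\<^esub> S q)) a = \<epsilon> a \<otimes> f \<one>\<^bsub>A\<^esub>"
    and basis_finite: "finite I" and basis_carrier: "I \<subseteq> carrier A"
    and coord_form: "i \<in> I \<Longrightarrow> linear_form K A (v i)"
    and coord_basis: "\<lbrakk>i \<in> I; j \<in> I\<rbrakk> \<Longrightarrow> v i j = (if i = j then \<one> else \<zero>)"
    and form_expand: "\<lbrakk>linear_form K A f; a \<in> carrier A\<rbrakk> \<Longrightarrow> (\<Oplus>i\<in>I. v i a \<otimes> f i) = f a"
begin

abbreviation mul (infixl \<open>\<star>\<close> 75) where "a \<star> b \<equiv> a \<otimes>\<^bsub>A\<^esub> b"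
abbreviation form where "form f \<equiv> linear_form K A f"
abbreviation bform where "bform \<beta> \<equiv> bilinear_form K A A \<beta>"
abbreviation "lin f \<equiv> f \<in> module_hom K A A"

sublocale ring: ring A
  by (rule A.ring)

lemma basis_in: "i \<in> I \<Longrightarrow> i \<in> carrier A"
  using basis_carrier by blast

lemma lin_id: "lin (\<lambda>x. x)"
  by (rule module_homI) auto

lemma lin_mult_left: "\<lbrakk>a \<in> carrier A; lin g\<rbrakk> \<Longrightarrow> lin (\<lambda>x. a \<star> g x)"
  by (rule module_homI) (auto simp: module_hom_add module_hom_smult module_hom_carrier ring.r_distr A.smult_mult_right)

lemma lin_mult_right: "\<lbrakk>a \<in> carrier A; lin g\<rbrakk> \<Longrightarrow> lin (\<lambda>x. g x \<star> a)"
  by (rule module_homI) (auto simp: module_hom_add module_hom_smult module_hom_carrier ring.l_distr A.smult_mult_left)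

lemma lin_S: "lin g \<Longrightarrow> lin (\<lambda>x. S (g x))"
  by (rule module_hom_comp[OF _ antipode_linear])

lemma S_closed [simp]: "a \<in> carrier A \<Longrightarrow> S a \<in> carrier A"
  by (rule module_hom_carrier[OF antipode_linear])

lemma form_closed: "\<lbrakk>form f; a \<in> carrier A\<rbrakk> \<Longrightarrow> f a \<in> carrier K"
  by (rule linear_formD(1))

lemma form_comp: "\<lbrakk>form f; lin g\<rbrakk> \<Longrightarrow> form (\<lambda>x. f (g x))"
  by (rule module_hom_comp)

lemma form_sw_param:
  assumes "a \<in> carrier A" "\<And>y. y \<in> carrier A \<Longrightarrow> bform (\<beta> y)"
    "\<And>p q. \<lbrakk>p \<in> carrier A; q \<in> carrier A\<rbrakk> \<Longrightarrow> form (\<lambda>y. \<beta> y p q)"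
  shows "form (\<lambda>y. sw (\<beta> y) a)"
  by (rule sw_param[OF assms(1) A.module_axioms assms(2,3)])

lemma form_sw_arg: "\<lbrakk>bform \<beta>; lin g\<rbrakk> \<Longrightarrow> form (\<lambda>y. sw \<beta> (g y))"
  by (rule sw_arg)

lemma form_sw: "bform \<beta> \<Longrightarrow> form (sw \<beta>)"
  by (rule sw_linear)

text \<open>Every rewriting under \<open>sw\<close> creates the obligation that the integrand is
  multilinear and that its constituents lie in the carriers; these collections close such
  obligations structurally.\<close>

lemmas form_intros = K.linear_form_cmult K.linear_form_multc K.linear_form_minus K.linear_form_finsum
  form_sw_arg form_sw_param form_sw
lemmas lin_intros = lin_id lin_mult_left lin_mult_right lin_S
lemmas multilinear_intros = bilinearI trilinear_formI form_intros lin_intros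
lemmas closed_intros = K.m_closed K.minus_closed ring.m_closed S_closed sw_closed ring.one_closed K.one_closed










section \<open>Calculus of coproduct sums and basis sums\<close>

lemma sw_zero_fun:
  assumes "c \<in> carrier A" "\<And>p q. \<lbrakk>p \<in> carrier A; q \<in> carrier A\<rbrakk> \<Longrightarrow> \<beta> p q = \<zero>"
  shows "sw \<beta> c = \<zero>"
proof -
  have z: "form (\<lambda>x. \<zero>)"
    by (rule linear_formI) auto
  have b: "bform (\<lambda>p q. \<zero>)"
    by (rule bilinearI) (rule z)+
  have "sw \<beta> c = sw (\<lambda>p q. \<zero> \<otimes> \<zero>) c"
    by (rule sw_cong[OF assms(1), symmetric]) (use b assms in simp_all)
  also have "\<dots> = \<zero> \<otimes> sw (\<lambda>p q. \<zero>) c"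
    by (rule sw_cmult[OF assms(1) _ b]) simp
  also have "\<dots> = \<zero>"
    using sw_closed[OF b assms(1)] by simp
  finally show ?thesis .
qed

lemma sw_multc:
  assumes "c \<in> carrier A" "d \<in> carrier K" "bform \<beta>"
  shows "sw \<beta> c \<otimes> d = sw (\<lambda>p q. \<beta> p q \<otimes> d) c"
proof -
  have "sw (\<lambda>p q. \<beta> p q \<otimes> d) c = sw (\<lambda>p q. d \<otimes> \<beta> p q) c"
  proof (rule sw_cong[OF assms(1)])
    show "bform (\<lambda>p q. \<beta> p q \<otimes> d)"
      by (intro bilinearI K.linear_form_multc assms) (auto dest: bilinear_formD[OF assms(3)])
  qed (auto simp: K.m_comm assms bilinear_formD(3)[OF assms(3)])
  then show ?thesis
    using sw_cmult[OF assms] sw_closed[OF assms(3,1)] assms(2) by (simp add: K.m_comm)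
qed

lemma swap: "\<lbrakk>c \<in> carrier A; c' \<in> carrier A;
    \<And>r s. \<lbrakk>r \<in> carrier A; s \<in> carrier A\<rbrakk> \<Longrightarrow> bform (\<lambda>p q. \<beta> p q r s);
    \<And>p q. \<lbrakk>p \<in> carrier A; q \<in> carrier A\<rbrakk> \<Longrightarrow> bform (\<lambda>r s. \<beta> p q r s)\<rbrakk> \<Longrightarrow>
  sw (\<lambda>p q. sw (\<lambda>r s. \<beta> p q r s) c') c = sw (\<lambda>r s. sw (\<lambda>p q. \<beta> p q r s) c) c'"
  by (rule sw_swap[OF sweedler_axioms])

lemma finsum_mult_left:
  "\<lbrakk>d \<in> carrier K; \<And>i. i \<in> I \<Longrightarrow> f i \<in> carrier K\<rbrakk> \<Longrightarrow> d \<otimes> (\<Oplus>i\<in>I. f i) = (\<Oplus>i\<in>I. d \<otimes> f i)"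
  by (rule K.finsum_rdistr[OF basis_finite]) auto

lemma sum_cong:
  "\<lbrakk>\<And>i. i \<in> I \<Longrightarrow> f i = g i; \<And>i. i \<in> I \<Longrightarrow> g i \<in> carrier K\<rbrakk> \<Longrightarrow> (\<Oplus>i\<in>I. f i) = (\<Oplus>i\<in>I. g i)"
  by (rule K.finsum_cong') auto

lemma form_expand':
  assumes f: "form f" and a: "a \<in> carrier A"
  shows "(\<Oplus>i\<in>I. f i \<otimes> v i a) = f a"
proof -
  have "(\<Oplus>i\<in>I. f i \<otimes> v i a) = (\<Oplus>i\<in>I. v i a \<otimes> f i)"
    by (rule sum_cong) (use linear_formD(1)[OF f] linear_formD(1)[OF coord_form] a basis_in in \<open>auto intro: K.m_comm\<close>)
  then show ?thesis
    using form_expand[OF f a] by simp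
qed

text \<open>Contraction of a dual pair of indices: read from right to left, it expands the left leg
  of the coproduct in the basis and makes it available as a separate basis vector i.\<close>

lemma sw_expand:
  assumes c: "c \<in> carrier A" and g: "\<And>y. y \<in> carrier A \<Longrightarrow> form (g y)"
    and g': "\<And>w. w \<in> carrier A \<Longrightarrow> form (\<lambda>y. g y w)"
  shows "(\<Oplus>i\<in>I. sw (\<lambda>x y. v i x \<otimes> g y i) c) = sw (\<lambda>x y. g y x) c"
proof -
  note intros = multilinear_intros g g' coord_form
  note closed = closed_intros form_closed[OF coord_form] form_closed[OF g]
  have "(\<Oplus>i\<in>I. sw (\<lambda>x y. v i x \<otimes> g y i) c) = sw (\<lambda>x y. \<Oplus>i\<in>I. v i x \<otimes> g y i) c"
  proof (rule sw_finsum[OF c basis_finite, symmetric])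
    show "bform (\<lambda>x y. v i x \<otimes> g y i)" if "i \<in> I" for i
      using that by (intro intros closed) ((assumption | erule basis_in)+)?
  qed
  also have "\<dots> = sw (\<lambda>x y. g y x) c"
  proof (rule sw_cong[OF c])
    show "bform (\<lambda>x y. \<Oplus>i\<in>I. v i x \<otimes> g y i)"
      by (intro intros closed) ((assumption | erule basis_in)+)?
    show "(\<Oplus>i\<in>I. v i x \<otimes> g y i) = g y x" if "x \<in> carrier A" "y \<in> carrier A" for x y
      using that by (intro form_expand g)
  qed
  finally show ?thesis .
qed

text \<open>The contraction for a basis vector that is itself comultiplied. Exchanging the two
  coproduct sums isolates i, and substituting x' for it produces an iterated coproduct, the form to
  which coassociativity applies.\<close>

lemma sum_sw_sw:
  assumes c: "c \<in> carrier A"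
    and G1: "\<And>y z. \<lbrakk>y \<in> carrier A; z \<in> carrier A\<rbrakk> \<Longrightarrow> form (\<lambda>x. G x y z)"
    and G2: "\<And>x z. \<lbrakk>x \<in> carrier A; z \<in> carrier A\<rbrakk> \<Longrightarrow> form (\<lambda>y. G x y z)"
    and G3: "\<And>x y. \<lbrakk>x \<in> carrier A; y \<in> carrier A\<rbrakk> \<Longrightarrow> form (\<lambda>z. G x y z)"
  shows "(\<Oplus>i\<in>I. sw (\<lambda>x y. sw (\<lambda>x' y'. v i x' \<otimes> G x y y') c) i) = sw (\<lambda>x' y'. sw (\<lambda>x y. G x y y') x') c"
proof -
  note intros = multilinear_intros G1 G2 G3 coord_form
  note closed = closed_intros form_closed[OF coord_form] form_closed[OF G1] c
  have "(\<Oplus>i\<in>I. sw (\<lambda>x y. sw (\<lambda>x' y'. v i x' \<otimes> G x y y') c) i) =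
      (\<Oplus>i\<in>I. sw (\<lambda>x' y'. v i x' \<otimes> sw (\<lambda>x y. G x y y') i) c)"
  proof (rule sum_cong)
    fix i assume i: "i \<in> I"
    have "sw (\<lambda>x y. sw (\<lambda>x' y'. v i x' \<otimes> G x y y') c) i = sw (\<lambda>x' y'. sw (\<lambda>x y. v i x' \<otimes> G x y y') i) c"
      using i by (intro swap[OF basis_in[OF i] c] intros closed) ((assumption | erule basis_in)+)?
    also have "\<dots> = sw (\<lambda>x' y'. v i x' \<otimes> sw (\<lambda>x y. G x y y') i) c"
    proof (rule sw_cong[OF c])
      show "bform (\<lambda>x' y'. sw (\<lambda>x y. v i x' \<otimes> G x y y') i)"
        using i by (intro intros closed) ((assumption | erule basis_in)+)?
      fix x' y' assume "x' \<in> carrier A" "y' \<in> carrier A"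
      then show "sw (\<lambda>x y. v i x' \<otimes> G x y y') i = v i x' \<otimes> sw (\<lambda>x y. G x y y') i"
        using i by (intro sw_cmult intros closed) ((assumption | erule basis_in)+)?
    qed
    finally show "sw (\<lambda>x y. sw (\<lambda>x' y'. v i x' \<otimes> G x y y') c) i = sw (\<lambda>x' y'. v i x' \<otimes> sw (\<lambda>x y. G x y y') i) c" .
    show "sw (\<lambda>x' y'. v i x' \<otimes> sw (\<lambda>x y. G x y y') i) c \<in> carrier K"
      using i by (intro intros closed) ((assumption | erule basis_in)+)?
  qed
  also have "\<dots> = sw (\<lambda>x' y'. sw (\<lambda>x y. G x y y') x') c"
    by (intro sw_expand[OF c] intros closed) ((assumption | erule basis_in)+)?
  finally show ?thesis .
qed

text \<open>
  For the linear map \<open>T(a) = \<Sum>\<^sub>j W\<^sub>j(a) u\<^sub>j\<close> this is \<open>p\<close> applied to \<open>(R\<^sub>X T)(a) = \<Sum>\<^sub>j W\<^sub>j(a X(u\<^sub>j\<^sub>2)) u\<^sub>j\<^sub>1\<close>. The operators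
  \<open>R\<^sub>X\<close> for \<open>X = id\<close> and \<open>X = S\<close> are mutually inverse, which \<open>contract_contract\<close> expresses.
\<close>

definition contract :: "('a \<Rightarrow> 'a) \<Rightarrow> ('a \<Rightarrow> 'a \<Rightarrow> 'k) \<Rightarrow> ('a \<Rightarrow> 'k) \<Rightarrow> 'a \<Rightarrow> 'k"
  where "contract X W p a = (\<Oplus>j\<in>I. sw (\<lambda>x y. p x \<otimes> W j (a \<star> X y)) j)"

lemma contract_form:
  assumes X: "lin X" and p: "form p" and W: "\<And>j. j \<in> I \<Longrightarrow> form (W j)"
  shows "form (contract X W p)"
proof -
  note intros = multilinear_intros p coord_form form_comp[OF W] X
  note closed = closed_intros form_closed[OF p] form_closed[OF W] module_hom_carrier[OF X]
  show ?thesis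
    unfolding contract_def[abs_def] by (intro intros closed) ((assumption | erule basis_in)+)?
qed

text \<open>The two contractions merge into the legs j_1, j_2, j_3 of one basis vector: p(j_1) W_j(a
  X(j_2) Y(j_3)). Then \<open>cancel\<close> removes the product of the last two and the counit
  restores j. The antipode axioms supply \<open>cancel\<close> both for X = S, Y = id and for X =
  id, Y = S, and both cases are used.\<close>

lemma contract_contract:
  assumes X: "lin X" and Y: "lin Y" and p: "form p" and W: "\<And>j. j \<in> I \<Longrightarrow> form (W j)" and a: "a \<in> carrier A"
    and cancel: "\<And>f b. \<lbrakk>form f; b \<in> carrier A\<rbrakk> \<Longrightarrow> sw (\<lambda>x y. f (X x \<star> Y y)) b = \<epsilon> b \<otimes> f \<one>\<^bsub>A\<^esub>"
  shows "contract X (\<lambda>i. contract Y W (v i)) p a = (\<Oplus>j\<in>I. p j \<otimes> W j a)"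
proof -
  note X' = module_hom_comp[OF _ X] and Y' = module_hom_comp[OF _ Y]
  note intros = multilinear_intros form_comp[OF W] p coord_form W X' Y' X Y counit_form
  note closed = closed_intros form_closed[OF p] form_closed[OF coord_form] form_closed[OF W]
    module_hom_carrier[OF X] module_hom_carrier[OF Y] a form_closed[OF counit_form]
  let ?G = "\<lambda>j x y y'. p x \<otimes> W j (a \<star> X y \<star> Y y')"
  have "contract X (\<lambda>i. contract Y W (v i)) p a =
      (\<Oplus>i\<in>I. \<Oplus>j\<in>I. sw (\<lambda>x y. sw (\<lambda>x' y'. v i x' \<otimes> ?G j x y y') j) i)"
    unfolding contract_def
  proof (rule sum_cong)
    fix i assume i: "i \<in> I"
    note i' = basis_in[OF i]
    have "sw (\<lambda>x y. p x \<otimes> (\<Oplus>j\<in>I. sw (\<lambda>x' y'. v i x' \<otimes> W j (a \<star> X y \<star> Y y')) j)) i =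
      sw (\<lambda>x y. \<Oplus>j\<in>I. sw (\<lambda>x' y'. v i x' \<otimes> ?G j x y y') j) i"
    proof (rule sw_cong[OF i'])
      show "bform (\<lambda>x y. p x \<otimes> (\<Oplus>j\<in>I. sw (\<lambda>x' y'. v i x' \<otimes> W j (a \<star> X y \<star> Y y')) j))"
        using i by (intro intros closed K.finsum_closed Pi_I) ((assumption | erule basis_in)+)?
      fix x y assume x: "x \<in> carrier A" and y: "y \<in> carrier A"
      have "p x \<otimes> (\<Oplus>j\<in>I. sw (\<lambda>x' y'. v i x' \<otimes> W j (a \<star> X y \<star> Y y')) j) =
          (\<Oplus>j\<in>I. p x \<otimes> sw (\<lambda>x' y'. v i x' \<otimes> W j (a \<star> X y \<star> Y y')) j)"
        using i x y by (intro finsum_mult_left intros closed) ((assumption | erule basis_in)+)?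
      also have "\<dots> = (\<Oplus>j\<in>I. sw (\<lambda>x' y'. v i x' \<otimes> ?G j x y y') j)"
      proof (rule sum_cong)
        fix j assume j: "j \<in> I"
        have "p x \<otimes> sw (\<lambda>x' y'. v i x' \<otimes> W j (a \<star> X y \<star> Y y')) j =
            sw (\<lambda>x' y'. p x \<otimes> (v i x' \<otimes> W j (a \<star> X y \<star> Y y'))) j"
          using i j x y by (intro sw_mult_left intros closed) ((assumption | erule basis_in)+)?
        also have "\<dots> = sw (\<lambda>x' y'. v i x' \<otimes> ?G j x y y') j"
        proof (rule sw_cong[OF basis_in[OF j]])
          show "bform (\<lambda>x' y'. p x \<otimes> (v i x' \<otimes> W j (a \<star> X y \<star> Y y')))"
            using i j x y by (intro intros closed) ((assumption | erule basis_in)+)?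
          fix x' y' assume "x' \<in> carrier A" "y' \<in> carrier A"
          then show "p x \<otimes> (v i x' \<otimes> W j (a \<star> X y \<star> Y y')) = v i x' \<otimes> ?G j x y y'"
            using i j x y by (intro K.m_lcomm closed) ((assumption | erule basis_in)+)?
        qed
        finally show "p x \<otimes> sw (\<lambda>x' y'. v i x' \<otimes> W j (a \<star> X y \<star> Y y')) j = sw (\<lambda>x' y'. v i x' \<otimes> ?G j x y y') j" .
        show "sw (\<lambda>x' y'. v i x' \<otimes> ?G j x y y') j \<in> carrier K"
          using i j x y by (intro intros closed) ((assumption | erule basis_in)+)?
      qed
      finally show "p x \<otimes> (\<Oplus>j\<in>I. sw (\<lambda>x' y'. v i x' \<otimes> W j (a \<star> X y \<star> Y y')) j) =
        (\<Oplus>j\<in>I. sw (\<lambda>x' y'. v i x' \<otimes> ?G j x y y') j)" .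
    qed
    also have "\<dots> = (\<Oplus>j\<in>I. sw (\<lambda>x y. sw (\<lambda>x' y'. v i x' \<otimes> ?G j x y y') j) i)"
      using i by (intro sw_finsum basis_finite intros closed) ((assumption | erule basis_in)+)?
    finally show "sw (\<lambda>x y. p x \<otimes> (\<Oplus>j\<in>I. sw (\<lambda>x' y'. v i x' \<otimes> W j (a \<star> X y \<star> Y y')) j)) i =
      (\<Oplus>j\<in>I. sw (\<lambda>x y. sw (\<lambda>x' y'. v i x' \<otimes> ?G j x y y') j) i)" .
    show "(\<Oplus>j\<in>I. sw (\<lambda>x y. sw (\<lambda>x' y'. v i x' \<otimes> ?G j x y y') j) i) \<in> carrier K"
      using i by (intro intros closed K.finsum_closed Pi_I) ((assumption | erule basis_in)+)?
  qed
  also have "\<dots> = (\<Oplus>j\<in>I. \<Oplus>i\<in>I. sw (\<lambda>x y. sw (\<lambda>x' y'. v i x' \<otimes> ?G j x y y') j) i)"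
    by (intro K.finsum_swap basis_finite intros closed) ((assumption | erule basis_in)+)?
  also have "\<dots> = (\<Oplus>j\<in>I. p j \<otimes> W j a)"
  proof (rule sum_cong)
    fix j assume j: "j \<in> I"
    note j' = basis_in[OF j]
    have "(\<Oplus>i\<in>I. sw (\<lambda>x y. sw (\<lambda>x' y'. v i x' \<otimes> ?G j x y y') j) i) = sw (\<lambda>x' y'. sw (\<lambda>x y. ?G j x y y') x') j"
      using j by (intro sum_sw_sw[OF j'] intros closed) ((assumption | erule basis_in)+)?
    also have "\<dots> = sw (\<lambda>x t. sw (\<lambda>y y'. ?G j x y y') t) j"
      using j by (intro sw_assoc[OF _ j'] intros closed) ((assumption | erule basis_in)+)?
    also have "\<dots> = sw (\<lambda>x t. (p x \<otimes> W j a) \<otimes> \<epsilon> t) j"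
    proof (rule sw_cong[OF j'])
      show "bform (\<lambda>x t. sw (\<lambda>y y'. ?G j x y y') t)"
        using j by (intro intros closed) ((assumption | erule basis_in)+)?
      fix x t assume x: "x \<in> carrier A" and t: "t \<in> carrier A"
      have f: "form (\<lambda>w. p x \<otimes> W j (a \<star> w))"
        using j x by (intro intros closed) ((assumption | erule basis_in)+)?
      have "sw (\<lambda>y y'. ?G j x y y') t = sw (\<lambda>y y'. p x \<otimes> W j (a \<star> (X y \<star> Y y'))) t"
      proof (rule sw_cong[OF t])
        show "bform (\<lambda>y y'. ?G j x y y')"
          using j x by (intro intros closed) ((assumption | erule basis_in)+)?
      qed (simp add: ring.m_assoc a module_hom_carrier[OF X] module_hom_carrier[OF Y])
      also have "\<dots> = \<epsilon> t \<otimes> (p x \<otimes> W j a)"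
        using cancel[OF f t] a by simp
      also have "\<dots> = (p x \<otimes> W j a) \<otimes> \<epsilon> t"
        using j x t by (intro K.m_comm closed) ((assumption | erule basis_in)+)?
      finally show "sw (\<lambda>y y'. ?G j x y y') t = (p x \<otimes> W j a) \<otimes> \<epsilon> t" .
    qed
    also have "\<dots> = p j \<otimes> W j a"
      using j by (intro sw_counit_right j' intros closed) ((assumption | erule basis_in)+)?
    finally show "(\<Oplus>i\<in>I. sw (\<lambda>x y. sw (\<lambda>x' y'. v i x' \<otimes> ?G j x y y') j) i) = p j \<otimes> W j a" .
    show "p j \<otimes> W j a \<in> carrier K"
      using j by (intro closed) ((assumption | erule basis_in)+)?
  qed
  finally show ?thesis .
qed


text \<open>
  The identity \<open>S(a\<^sub>2)\<^sub>1 \<otimes> a\<^sub>1 S(a\<^sub>2)\<^sub>2 = S(a) \<otimes> 1\<close>, which replaces the anti-comultiplicativity of \<open>S\<close>.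
\<close>

lemma sw_antipode_comult:
  assumes p: "form p" and q: "form q" and a: "a \<in> carrier A"
  shows "sw (\<lambda>x y. sw (\<lambda>z w. p z \<otimes> q (x \<star> w)) (S y)) a = p (S a) \<otimes> q \<one>\<^bsub>A\<^esub>"
proof -
  note intros = multilinear_intros form_comp[OF p] form_comp[OF q] p q counit_form
  note closed = closed_intros form_closed[OF p] form_closed[OF q] form_closed[OF counit_form]
  \<comment> \<open>The goal is the value at c = 1. The extra left factor c is there to be filled
    with S(r_1) r_2 = \<epsilon>(r) 1: the factor r_2 then stands next to z, which is what is
    required to form a product of two coproducts.\<close>
  let ?\<Phi> = "\<lambda>c t. sw (\<lambda>x y. sw (\<lambda>z w. p (c \<star> z) \<otimes> q (x \<star> w)) (S y)) t"
  \<comment> \<open>As \<Delta> is multiplicative, \<Delta>(b_1) \<Delta>(S(b_2)) = \<Delta>(b_1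
    S(b_2)), which sums to \<epsilon>(b) 1 \<otimes> 1.\<close>
  have inner: "sw (\<lambda>x t. ?\<Phi> (u \<star> x) t) b = \<epsilon> b \<otimes> (p u \<otimes> q \<one>\<^bsub>A\<^esub>)"
    if u: "u \<in> carrier A" and b: "b \<in> carrier A" for u b
  proof -
    let ?\<beta> = "\<lambda>z w. p (u \<star> z) \<otimes> q w"
    have bf: "bform ?\<beta>"
      using u by (intro intros closed) ((assumption | erule basis_in)+)?
    have "sw (\<lambda>x t. ?\<Phi> (u \<star> x) t) b =
        sw (\<lambda>t y. sw (\<lambda>x1 x2. sw (\<lambda>z w. p (u \<star> x1 \<star> z) \<otimes> q (x2 \<star> w)) (S y)) t) b"
      using u b by (intro sw_assoc[symmetric] intros closed) ((assumption | erule basis_in)+)?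
    also have "\<dots> = sw (\<lambda>t y. sw ?\<beta> (t \<star> S y)) b"
    proof (rule sw_cong[OF b])
      show "bform (\<lambda>t y. sw (\<lambda>x1 x2. sw (\<lambda>z w. p (u \<star> x1 \<star> z) \<otimes> q (x2 \<star> w)) (S y)) t)"
        using u by (intro intros closed) ((assumption | erule basis_in)+)?
      fix t y assume t: "t \<in> carrier A" and y: "y \<in> carrier A"
      have "sw ?\<beta> (t \<star> S y) = sw (\<lambda>x1 x2. sw (\<lambda>z w. p (u \<star> (x1 \<star> z)) \<otimes> q (x2 \<star> w)) (S y)) t"
        by (rule sw_mult[OF bf t S_closed[OF y]])
      also have "\<dots> = sw (\<lambda>x1 x2. sw (\<lambda>z w. p (u \<star> x1 \<star> z) \<otimes> q (x2 \<star> w)) (S y)) t"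
      proof (rule sw_cong[OF t])
        show "bform (\<lambda>x1 x2. sw (\<lambda>z w. p (u \<star> (x1 \<star> z)) \<otimes> q (x2 \<star> w)) (S y))"
          using u y by (intro intros closed) ((assumption | erule basis_in)+)?
        fix x1 x2 assume x: "x1 \<in> carrier A" "x2 \<in> carrier A"
        show "sw (\<lambda>z w. p (u \<star> (x1 \<star> z)) \<otimes> q (x2 \<star> w)) (S y) = sw (\<lambda>z w. p (u \<star> x1 \<star> z) \<otimes> q (x2 \<star> w)) (S y)"
        proof (rule sw_cong[OF S_closed[OF y]])
          show "bform (\<lambda>z w. p (u \<star> (x1 \<star> z)) \<otimes> q (x2 \<star> w))"
            using u x by (intro intros closed) ((assumption | erule basis_in)+)?
        qed (use u x in \<open>simp add: ring.m_assoc\<close>)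
      qed
      finally show "sw (\<lambda>x1 x2. sw (\<lambda>z w. p (u \<star> x1 \<star> z) \<otimes> q (x2 \<star> w)) (S y)) t = sw ?\<beta> (t \<star> S y)"
        by simp
    qed
    also have "\<dots> = \<epsilon> b \<otimes> sw ?\<beta> \<one>\<^bsub>A\<^esub>"
      by (rule sw_antipode_right[OF form_sw[OF bf] b])
    also have "\<dots> = \<epsilon> b \<otimes> (p u \<otimes> q \<one>\<^bsub>A\<^esub>)"
      using u by (simp add: sw_one[OF bf])
    finally show ?thesis .
  qed
  have \<Phi>1: "form (\<lambda>c. ?\<Phi> c t)" if "t \<in> carrier A" for t
    using that by (intro intros closed) ((assumption | erule basis_in)+)?
  have \<Phi>2: "form (\<lambda>t. ?\<Phi> c t)" if "c \<in> carrier A" for c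
    using that by (intro intros closed) ((assumption | erule basis_in)+)?
  have "?\<Phi> \<one>\<^bsub>A\<^esub> a = sw (\<lambda>r t. \<epsilon> r \<otimes> ?\<Phi> \<one>\<^bsub>A\<^esub> t) a"
    by (rule sw_counit_left[OF \<Phi>2 a, symmetric]) simp_all
  also have "\<dots> = sw (\<lambda>r t. sw (\<lambda>s x. ?\<Phi> (S s \<star> x) t) r) a"
  proof (rule sw_cong[OF a])
    show "bform (\<lambda>r t. \<epsilon> r \<otimes> ?\<Phi> \<one>\<^bsub>A\<^esub> t)"
      by (intro intros closed) ((assumption | erule basis_in)+)?
    show "\<epsilon> r \<otimes> ?\<Phi> \<one>\<^bsub>A\<^esub> t = sw (\<lambda>s x. ?\<Phi> (S s \<star> x) t) r" if "r \<in> carrier A" "t \<in> carrier A" for r t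
      by (rule sw_antipode_left[OF \<Phi>1, symmetric]) (use that in simp_all)
  qed
  also have "\<dots> = sw (\<lambda>s b. sw (\<lambda>x t. ?\<Phi> (S s \<star> x) t) b) a"
    using a by (intro sw_assoc intros closed) ((assumption | erule basis_in)+)?
  also have "\<dots> = sw (\<lambda>s b. p (S s) \<otimes> q \<one>\<^bsub>A\<^esub> \<otimes> \<epsilon> b) a"
  proof (rule sw_cong[OF a])
    show "bform (\<lambda>s b. sw (\<lambda>x t. ?\<Phi> (S s \<star> x) t) b)"
      by (intro intros closed) ((assumption | erule basis_in)+)?
    show "sw (\<lambda>x t. ?\<Phi> (S s \<star> x) t) b = p (S s) \<otimes> q \<one>\<^bsub>A\<^esub> \<otimes> \<epsilon> b" if "s \<in> carrier A" "b \<in> carrier A" for s b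
      using that inner[of "S s" b] by (simp add: K.m_comm form_closed[OF p] form_closed[OF q] form_closed[OF counit_form])
  qed
  also have "\<dots> = p (S a) \<otimes> q \<one>\<^bsub>A\<^esub>"
    using a by (intro sw_counit_right intros closed) ((assumption | erule basis_in)+)?
  finally have "?\<Phi> \<one>\<^bsub>A\<^esub> a = p (S a) \<otimes> q \<one>\<^bsub>A\<^esub>" .
  moreover have "?\<Phi> \<one>\<^bsub>A\<^esub> a = sw (\<lambda>x y. sw (\<lambda>z w. p z \<otimes> q (x \<star> w)) (S y)) a"
  proof (rule sw_cong[OF a])
    show "bform (\<lambda>x y. sw (\<lambda>z w. p (\<one>\<^bsub>A\<^esub> \<star> z) \<otimes> q (x \<star> w)) (S y))"
      by (intro intros closed) ((assumption | erule basis_in)+)?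
    fix x y assume x: "x \<in> carrier A" and y: "y \<in> carrier A"
    show "sw (\<lambda>z w. p (\<one>\<^bsub>A\<^esub> \<star> z) \<otimes> q (x \<star> w)) (S y) = sw (\<lambda>z w. p z \<otimes> q (x \<star> w)) (S y)"
    proof (rule sw_cong[OF S_closed[OF y]])
      show "bform (\<lambda>z w. p (\<one>\<^bsub>A\<^esub> \<star> z) \<otimes> q (x \<star> w))"
        using x by (intro intros closed) ((assumption | erule basis_in)+)?
    qed simp
  qed
  ultimately show ?thesis
    by simp
qed

text \<open>Multiplicativity of \<epsilon> turns \<epsilon>(S(a_1)) \<epsilon>(a_2) into
  \<epsilon>(S(a_1) a_2), where the antipode axiom applies.\<close>

lemma counit_antipode: "a \<in> carrier A \<Longrightarrow> \<epsilon> (S a) = \<epsilon> a"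
proof -
  assume a: "a \<in> carrier A"
  note intros = multilinear_intros form_comp[OF counit_form] counit_form
  note closed = closed_intros form_closed[OF counit_form]
  have "\<epsilon> (S a) = sw (\<lambda>x y. \<epsilon> (S x) \<otimes> \<epsilon> y) a"
    using a by (intro sw_counit_right[symmetric] intros closed) ((assumption | erule basis_in)+)?
  also have "\<dots> = sw (\<lambda>x y. \<epsilon> (S x \<star> y)) a"
    by (rule sw_cong[OF a]) (simp_all add: counit_mult, intro intros closed, assumption+)
  also have "\<dots> = \<epsilon> a"
    using a by (simp add: sw_antipode_left[OF counit_form] counit_one form_closed[OF counit_form])
  finally show ?thesis .
qed

text \<open>The equation a_1 V(a_2) = V(a) 1 in A, tested against every linear form q.\<close>

definition left_integral :: "('a \<Rightarrow> 'k) \<Rightarrow> bool"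
  where "left_integral V \<longleftrightarrow> form V \<and>
    (\<forall>q a. form q \<longrightarrow> a \<in> carrier A \<longrightarrow> sw (\<lambda>x y. q x \<otimes> V y) a = q \<one>\<^bsub>A\<^esub> \<otimes> V a)"

lemma left_integralD:
  assumes "left_integral V"
  shows "form V" "\<lbrakk>form q; a \<in> carrier A\<rbrakk> \<Longrightarrow> sw (\<lambda>x y. q x \<otimes> V y) a = q \<one>\<^bsub>A\<^esub> \<otimes> V a"
  using assms by (auto simp: left_integral_def)

text \<open>In S(a_1) V(a_2 h) the integral property replaces V(y h) by (y h)_1 V((y h)_2) for y =
  a_2. Since \<Delta> is multiplicative this is S(a_1) a_2 h_1 V(a_3 h_2), and the antipode axiom
  leaves h_1 V(a h_2).\<close>

lemma left_integral_shift:
  assumes V: "left_integral V" and p: "form p" and a: "a \<in> carrier A" and h: "h \<in> carrier A"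
  shows "sw (\<lambda>x y. p x \<otimes> V (a \<star> y)) h = sw (\<lambda>x y. p (S x) \<otimes> V (y \<star> h)) a"
proof -
  note V' = left_integralD(1)[OF V]
  note intros = multilinear_intros form_comp[OF p] form_comp[OF V'] p V' counit_form
  note closed = closed_intros form_closed[OF p] form_closed[OF V'] form_closed[OF counit_form] h
  let ?\<Theta> = "\<lambda>c y. sw (\<lambda>z w. p (c \<star> z) \<otimes> V (y \<star> w)) h"
  have \<Theta>1: "form (\<lambda>c. ?\<Theta> c y)" if "y \<in> carrier A" for y
    using that by (intro intros closed) ((assumption | erule basis_in)+)?
  have \<Theta>2: "form (\<lambda>y. ?\<Theta> c y)" if "c \<in> carrier A" for c
    using that by (intro intros closed) ((assumption | erule basis_in)+)?
  have "sw (\<lambda>x y. p (S x) \<otimes> V (y \<star> h)) a = sw (\<lambda>x y. sw (\<lambda>s t. ?\<Theta> (S x \<star> s) t) y) a"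
  proof (rule sw_cong[OF a])
    show "bform (\<lambda>x y. p (S x) \<otimes> V (y \<star> h))"
      by (intro intros closed) ((assumption | erule basis_in)+)?
    fix x y assume x: "x \<in> carrier A" and y: "y \<in> carrier A"
    let ?\<beta> = "\<lambda>s t. p (S x \<star> s) \<otimes> V t"
    have bf: "bform ?\<beta>"
      using x by (intro intros closed) ((assumption | erule basis_in)+)?
    have f: "form (\<lambda>s. p (S x \<star> s))"
      using x by (intro intros closed) ((assumption | erule basis_in)+)?
    have "p (S x) \<otimes> V (y \<star> h) = sw ?\<beta> (y \<star> h)"
      using left_integralD(2)[OF V f, of "y \<star> h"] x y h by simp
    also have "\<dots> = sw (\<lambda>s t. sw (\<lambda>z w. p (S x \<star> (s \<star> z)) \<otimes> V (t \<star> w)) h) y"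
      by (rule sw_mult[OF bf y h])
    also have "\<dots> = sw (\<lambda>s t. ?\<Theta> (S x \<star> s) t) y"
    proof (rule sw_cong[OF y])
      show "bform (\<lambda>s t. sw (\<lambda>z w. p (S x \<star> (s \<star> z)) \<otimes> V (t \<star> w)) h)"
        using x by (intro intros closed) ((assumption | erule basis_in)+)?
      fix s t assume s: "s \<in> carrier A" "t \<in> carrier A"
      show "sw (\<lambda>z w. p (S x \<star> (s \<star> z)) \<otimes> V (t \<star> w)) h = ?\<Theta> (S x \<star> s) t"
      proof (rule sw_cong[OF h])
        show "bform (\<lambda>z w. p (S x \<star> (s \<star> z)) \<otimes> V (t \<star> w))"
          using x s by (intro intros closed) ((assumption | erule basis_in)+)?
      qed (use x s in \<open>simp add: ring.m_assoc\<close>)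
    qed
    finally show "p (S x) \<otimes> V (y \<star> h) = sw (\<lambda>s t. ?\<Theta> (S x \<star> s) t) y" .
  qed
  also have "\<dots> = sw (\<lambda>r t. sw (\<lambda>x s. ?\<Theta> (S x \<star> s) t) r) a"
    using a by (intro sw_assoc[symmetric] intros closed) ((assumption | erule basis_in)+)?
  also have "\<dots> = sw (\<lambda>r t. \<epsilon> r \<otimes> ?\<Theta> \<one>\<^bsub>A\<^esub> t) a"
  proof (rule sw_cong[OF a])
    show "bform (\<lambda>r t. sw (\<lambda>x s. ?\<Theta> (S x \<star> s) t) r)"
      by (intro intros closed) ((assumption | erule basis_in)+)?
    show "sw (\<lambda>x s. ?\<Theta> (S x \<star> s) t) r = \<epsilon> r \<otimes> ?\<Theta> \<one>\<^bsub>A\<^esub> t" if "r \<in> carrier A" "t \<in> carrier A" for r t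
      by (rule sw_antipode_left[OF \<Theta>1]) (use that in simp_all)
  qed
  also have "\<dots> = ?\<Theta> \<one>\<^bsub>A\<^esub> a"
    by (rule sw_counit_left[OF \<Theta>2 a]) (use a in simp_all)
  also have "\<dots> = sw (\<lambda>x y. p x \<otimes> V (a \<star> y)) h"
  proof (rule sw_cong[OF h])
    show "bform (\<lambda>z w. p (\<one>\<^bsub>A\<^esub> \<star> z) \<otimes> V (a \<star> w))"
      using a by (intro intros closed) ((assumption | erule basis_in)+)?
  qed simp
  finally show ?thesis
    by simp
qed


text \<open>The coordinates of R_S applied to the antipode. As R_S and R_id are mutually inverse,
  this is the family that R_id turns into S; its properties are derived from that fact rather than
  from the formula.\<close>

definition tau :: "'a \<Rightarrow> 'a \<Rightarrow> 'k"
  where "tau i = contract S (\<lambda>j x. v j (S x)) (v i)"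

text \<open>R_id undoes the R_S in the definition of \<open>tau\<close>. Without the form p this
  reads: the sum over j of j_1 \<open>tau j\<close> (a j_2) is S(a).\<close>

lemma contract_tau:
  assumes p: "form p" and a: "a \<in> carrier A"
  shows "contract (\<lambda>x. x) tau p a = p (S a)"
proof -
  have "contract (\<lambda>x. x) tau p a = (\<Oplus>j\<in>I. p j \<otimes> v j (S a))"
    unfolding tau_def[abs_def]
    by (rule contract_contract[OF lin_id antipode_linear p form_comp[OF coord_form antipode_linear] a])
      (simp_all add: sw_antipode_right)
  then show ?thesis
    using form_expand'[OF p S_closed[OF a]] by simp
qed

lemma tau_form: "i \<in> I \<Longrightarrow> form (tau i)"
  unfolding tau_def
  by (rule contract_form[OF antipode_linear coord_form form_comp[OF coord_form antipode_linear]])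

text \<open>Injectivity of R_id, since R_S recovers the family from its image. Identities between
  families of forms are proved by comparing their images under R_id.\<close>

lemma contract_eq_zeroD:
  assumes W: "\<And>j. j \<in> I \<Longrightarrow> form (W j)"
    and zero: "\<And>p a. \<lbrakk>form p; a \<in> carrier A\<rbrakk> \<Longrightarrow> contract (\<lambda>x. x) W p a = \<zero>"
    and k: "k \<in> I" and a: "a \<in> carrier A"
  shows "W k a = \<zero>"
proof -
  \<comment> \<open>The coordinate form \<open>v k\<close> picks the member at k out of the
    family.\<close>
  have "(\<Oplus>j\<in>I. v k j \<otimes> W j a) = W k a"
  proof -
    have "(\<Oplus>j\<in>I. v k j \<otimes> W j a) = (\<Oplus>j\<in>I. if k = j then W j a else \<zero>)"
      by (rule sum_cong) (use k a linear_formD(1)[OF W] in \<open>auto simp: coord_basis\<close>)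
    also have "\<dots> = W k a"
      by (rule K.add.finprod_singleton[OF k basis_finite]) (use a linear_formD(1)[OF W] in auto)
    finally show ?thesis .
  qed
  moreover have "(\<Oplus>j\<in>I. v k j \<otimes> W j a) = contract S (\<lambda>i. contract (\<lambda>x. x) W (v i)) (v k) a"
    by (rule contract_contract[OF antipode_linear lin_id coord_form[OF k] W a, symmetric])
      (simp_all add: sw_antipode_left)
  moreover have "contract S (\<lambda>i. contract (\<lambda>x. x) W (v i)) (v k) a = (\<Oplus>j\<in>I. \<zero>)"
    unfolding contract_def[of S]
  proof (rule sum_cong)
    fix j assume j: "j \<in> I"
    show "sw (\<lambda>x y. v k x \<otimes> contract (\<lambda>x. x) W (v j) (a \<star> S y)) j = \<zero>"
      by (rule sw_zero_fun[OF basis_in[OF j]])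
        (simp add: zero[OF coord_form[OF j]] a form_closed[OF coord_form[OF k]])
  qed simp
  ultimately show ?thesis
    by simp
qed

lemma contract_minus:
  assumes p: "form p" and U: "\<And>j. j \<in> I \<Longrightarrow> form (U j)" and T: "\<And>j. j \<in> I \<Longrightarrow> form (T j)"
    and d: "d \<in> carrier K" and a: "a \<in> carrier A"
  shows "contract (\<lambda>x. x) (\<lambda>j b. U j b \<ominus> d \<otimes> T j b) p a =
    contract (\<lambda>x. x) U p a \<ominus> d \<otimes> contract (\<lambda>x. x) T p a"
proof -
  note intros = multilinear_intros form_comp[OF U] form_comp[OF T] p U T
  note closed = closed_intros form_closed[OF p] form_closed[OF U] form_closed[OF T] a d
  let ?u = "\<lambda>j. sw (\<lambda>x y. p x \<otimes> U j (a \<star> y)) j" and ?t = "\<lambda>j. sw (\<lambda>x y. p x \<otimes> T j (a \<star> y)) j"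
  have cu: "?u j \<in> carrier K" if "j \<in> I" for j
    using that by (intro intros closed) ((assumption | erule basis_in)+)?
  have ct: "?t j \<in> carrier K" if "j \<in> I" for j
    using that by (intro intros closed) ((assumption | erule basis_in)+)?
  have "contract (\<lambda>x. x) (\<lambda>j b. U j b \<ominus> d \<otimes> T j b) p a = (\<Oplus>j\<in>I. ?u j \<oplus> \<ominus> d \<otimes> ?t j)"
    unfolding contract_def
  proof (rule sum_cong)
    fix j assume j: "j \<in> I"
    note j' = basis_in[OF j]
    have "sw (\<lambda>x y. p x \<otimes> (U j (a \<star> y) \<ominus> d \<otimes> T j (a \<star> y))) j =
        sw (\<lambda>x y. p x \<otimes> U j (a \<star> y) \<ominus> d \<otimes> (p x \<otimes> T j (a \<star> y))) j"
    proof (rule sw_cong[OF j'])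
      show "bform (\<lambda>x y. p x \<otimes> (U j (a \<star> y) \<ominus> d \<otimes> T j (a \<star> y)))"
        using j by (intro intros closed) ((assumption | erule basis_in)+)?
      fix x y assume "x \<in> carrier A" "y \<in> carrier A"
      then have "p x \<in> carrier K" "U j (a \<star> y) \<in> carrier K" "T j (a \<star> y) \<in> carrier K"
        using j by (auto intro: closed)
      then show "p x \<otimes> (U j (a \<star> y) \<ominus> d \<otimes> T j (a \<star> y)) =
          p x \<otimes> U j (a \<star> y) \<ominus> d \<otimes> (p x \<otimes> T j (a \<star> y))"
        using d by algebra
    qed
    also have "\<dots> = ?u j \<ominus> sw (\<lambda>x y. d \<otimes> (p x \<otimes> T j (a \<star> y))) j"
      using j by (intro sw_minus intros closed) ((assumption | erule basis_in)+)?
    also have "sw (\<lambda>x y. d \<otimes> (p x \<otimes> T j (a \<star> y))) j = d \<otimes> ?t j"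
      using j by (intro sw_cmult intros closed) ((assumption | erule basis_in)+)?
    also have "?u j \<ominus> d \<otimes> ?t j = ?u j \<oplus> \<ominus> d \<otimes> ?t j"
      using cu[OF j] ct[OF j] d by (simp add: K.minus_eq K.l_minus)
    finally show "sw (\<lambda>x y. p x \<otimes> (U j (a \<star> y) \<ominus> d \<otimes> T j (a \<star> y))) j = ?u j \<oplus> \<ominus> d \<otimes> ?t j" .
    show "?u j \<oplus> \<ominus> d \<otimes> ?t j \<in> carrier K"
      using cu[OF j] ct[OF j] d by simp
  qed
  also have "\<dots> = (\<Oplus>j\<in>I. ?u j) \<oplus> (\<Oplus>j\<in>I. \<ominus> d \<otimes> ?t j)"
    by (rule K.finsum_addf) (use cu ct d in auto)
  also have "(\<Oplus>j\<in>I. \<ominus> d \<otimes> ?t j) = \<ominus> d \<otimes> (\<Oplus>j\<in>I. ?t j)"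
    by (rule finsum_mult_left[symmetric]) (use ct d in auto)
  finally show ?thesis
    unfolding contract_def using ct d by (simp add: K.minus_eq K.l_minus K.finsum_closed)
qed

text \<open>Expanding \<Delta>(a j_2) gives p(j_1) q(a_1 j_2) \<open>tau j\<close> (a_2 j_3).
  Summation over j is an instance of \<open>contract_tau\<close> for the form taking w to p(w_1)
  q(a_1 w_2), whose value at S(a_2) is evaluated by \<open>sw_antipode_comult\<close>.\<close>

lemma contract_sw_tau:
  assumes p: "form p" and q: "form q" and a: "a \<in> carrier A"
  shows "contract (\<lambda>x. x) (\<lambda>j. sw (\<lambda>x y. q x \<otimes> tau j y)) p a = p (S a) \<otimes> q \<one>\<^bsub>A\<^esub>"
proof -
  note intros = multilinear_intros form_comp[OF p] form_comp[OF q] form_comp[OF tau_form] p q tau_form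
  note closed = closed_intros form_closed[OF p] form_closed[OF q] form_closed[OF tau_form] a
  let ?P = "\<lambda>b w. sw (\<lambda>x y. p x \<otimes> q (b \<star> y)) w"
  let ?g = "\<lambda>j b c. sw (\<lambda>w z. ?P b w \<otimes> tau j (c \<star> z)) j"
  have P: "form (?P b)" if "b \<in> carrier A" for b
    using that by (intro intros closed) ((assumption | erule basis_in)+)?
  have g: "bform (?g j)" if "j \<in> I" for j
    using that by (intro intros closed) ((assumption | erule basis_in)+)?
  have "contract (\<lambda>x. x) (\<lambda>j. sw (\<lambda>x y. q x \<otimes> tau j y)) p a = (\<Oplus>j\<in>I. sw (?g j) a)"
    unfolding contract_def
  proof (rule sum_cong)
    fix j assume j: "j \<in> I"
    note j' = basis_in[OF j]
    show "sw (?g j) a \<in> carrier K"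
      using sw_closed[OF g[OF j] a] .
    have "sw (\<lambda>x y. p x \<otimes> sw (\<lambda>x y. q x \<otimes> tau j y) (a \<star> y)) j =
        sw (\<lambda>x y. sw (\<lambda>b c. sw (\<lambda>y z. p x \<otimes> (q (b \<star> y) \<otimes> tau j (c \<star> z))) y) a) j"
    proof (rule sw_cong[OF j'])
      show "bform (\<lambda>x y. p x \<otimes> sw (\<lambda>x y. q x \<otimes> tau j y) (a \<star> y))"
        using j by (intro intros closed) ((assumption | erule basis_in)+)?
      fix x y assume x: "x \<in> carrier A" and y: "y \<in> carrier A"
      have "sw (\<lambda>x y. q x \<otimes> tau j y) (a \<star> y) = sw (\<lambda>b c. sw (\<lambda>y z. q (b \<star> y) \<otimes> tau j (c \<star> z)) y) a"
        using j y a by (intro sw_mult intros closed) ((assumption | erule basis_in)+)?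
      then have "p x \<otimes> sw (\<lambda>x y. q x \<otimes> tau j y) (a \<star> y) =
          p x \<otimes> sw (\<lambda>b c. sw (\<lambda>y z. q (b \<star> y) \<otimes> tau j (c \<star> z)) y) a"
        by simp
      also have "\<dots> = sw (\<lambda>b c. p x \<otimes> sw (\<lambda>y z. q (b \<star> y) \<otimes> tau j (c \<star> z)) y) a"
        using j x y by (intro sw_mult_left intros closed) ((assumption | erule basis_in)+)?
      also have "\<dots> = sw (\<lambda>b c. sw (\<lambda>y z. p x \<otimes> (q (b \<star> y) \<otimes> tau j (c \<star> z))) y) a"
      proof (rule sw_cong[OF a])
        show "bform (\<lambda>b c. p x \<otimes> sw (\<lambda>y z. q (b \<star> y) \<otimes> tau j (c \<star> z)) y)"
          using j x y by (intro intros closed) ((assumption | erule basis_in)+)?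
        show "p x \<otimes> sw (\<lambda>y z. q (b \<star> y) \<otimes> tau j (c \<star> z)) y =
          sw (\<lambda>y z. p x \<otimes> (q (b \<star> y) \<otimes> tau j (c \<star> z))) y" if "b \<in> carrier A" "c \<in> carrier A" for b c
          using j x y that by (intro sw_mult_left intros closed) ((assumption | erule basis_in)+)?
      qed
      finally show "p x \<otimes> sw (\<lambda>x y. q x \<otimes> tau j y) (a \<star> y) =
        sw (\<lambda>b c. sw (\<lambda>y z. p x \<otimes> (q (b \<star> y) \<otimes> tau j (c \<star> z))) y) a" .
    qed
    also have "\<dots> = sw (\<lambda>b c. sw (\<lambda>x y. sw (\<lambda>y z. p x \<otimes> (q (b \<star> y) \<otimes> tau j (c \<star> z))) y) j) a"
      using j by (intro swap[OF j' a] intros closed) ((assumption | erule basis_in)+)?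
    also have "\<dots> = sw (?g j) a"
    proof (rule sw_cong[OF a])
      show "bform (\<lambda>b c. sw (\<lambda>x y. sw (\<lambda>y z. p x \<otimes> (q (b \<star> y) \<otimes> tau j (c \<star> z))) y) j)"
        using j by (intro intros closed) ((assumption | erule basis_in)+)?
      fix b c assume b: "b \<in> carrier A" and c: "c \<in> carrier A"
      have "sw (\<lambda>x y. sw (\<lambda>y z. p x \<otimes> (q (b \<star> y) \<otimes> tau j (c \<star> z))) y) j =
          sw (\<lambda>w z. sw (\<lambda>x y. p x \<otimes> (q (b \<star> y) \<otimes> tau j (c \<star> z))) w) j"
        using j b c by (intro sw_assoc[symmetric] intros closed) ((assumption | erule basis_in)+)?
      also have "\<dots> = ?g j b c"
      proof (rule sw_cong[OF j'])
        show "bform (\<lambda>w z. sw (\<lambda>x y. p x \<otimes> (q (b \<star> y) \<otimes> tau j (c \<star> z))) w)"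
          using j b c by (intro intros closed) ((assumption | erule basis_in)+)?
        fix w z assume w: "w \<in> carrier A" and z: "z \<in> carrier A"
        have "sw (\<lambda>x y. p x \<otimes> (q (b \<star> y) \<otimes> tau j (c \<star> z))) w = sw (\<lambda>x y. p x \<otimes> q (b \<star> y) \<otimes> tau j (c \<star> z)) w"
        proof (rule sw_cong[OF w])
          show "bform (\<lambda>x y. p x \<otimes> (q (b \<star> y) \<otimes> tau j (c \<star> z)))"
            using j b c z by (intro intros closed) ((assumption | erule basis_in)+)?
          show "p x \<otimes> (q (b \<star> y) \<otimes> tau j (c \<star> z)) = p x \<otimes> q (b \<star> y) \<otimes> tau j (c \<star> z)"
            if "x \<in> carrier A" "y \<in> carrier A" for x y
            using j b c z that by (intro K.m_assoc[symmetric] intros closed) ((assumption | erule basis_in)+)?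
        qed
        also have "\<dots> = ?P b w \<otimes> tau j (c \<star> z)"
          using j b c z w by (intro sw_multc[symmetric] intros closed) ((assumption | erule basis_in)+)?
        finally show "sw (\<lambda>x y. p x \<otimes> (q (b \<star> y) \<otimes> tau j (c \<star> z))) w = ?P b w \<otimes> tau j (c \<star> z)" .
      qed
      finally show "sw (\<lambda>x y. sw (\<lambda>y z. p x \<otimes> (q (b \<star> y) \<otimes> tau j (c \<star> z))) y) j = ?g j b c" .
    qed
    finally show "sw (\<lambda>x y. p x \<otimes> sw (\<lambda>x y. q x \<otimes> tau j y) (a \<star> y)) j = sw (?g j) a" .
  qed
  also have "\<dots> = sw (\<lambda>b c. \<Oplus>j\<in>I. ?g j b c) a"
    by (rule sw_finsum[OF a basis_finite g, symmetric])
  also have "\<dots> = sw (\<lambda>b c. ?P b (S c)) a"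
  proof (rule sw_cong[OF a])
    show "bform (\<lambda>b c. \<Oplus>j\<in>I. ?g j b c)"
      by (intro intros closed) ((assumption | erule basis_in)+)?
    show "(\<Oplus>j\<in>I. ?g j b c) = ?P b (S c)" if "b \<in> carrier A" "c \<in> carrier A" for b c
      using contract_tau[OF P[OF that(1)] that(2)] by (simp add: contract_def)
  qed
  also have "\<dots> = p (S a) \<otimes> q \<one>\<^bsub>A\<^esub>"
    by (rule sw_antipode_comult[OF p q a])
  finally show ?thesis .
qed

text \<open>Both sides of the integral equation, taken as families in k, have the same image p(S a)
  q(1) under R_id, by \<open>contract_sw_tau\<close> and \<open>contract_tau\<close>. Injectivity of
  R_id does the rest.\<close>

lemma tau_left_integral:
  assumes k: "k \<in> I"
  shows "left_integral (tau k)"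
  unfolding left_integral_def
proof (intro conjI allI impI)
  show "form (tau k)"
    by (rule tau_form[OF k])
  fix q b assume q: "form q" and b: "b \<in> carrier A"
  note intros = multilinear_intros form_comp[OF q] form_comp[OF tau_form] q tau_form
  note closed = closed_intros form_closed[OF q] form_closed[OF tau_form]
  let ?U = "\<lambda>j. sw (\<lambda>x y. q x \<otimes> tau j y)"
  have U: "form (?U j)" if "j \<in> I" for j
    using that by (intro intros closed) ((assumption | erule basis_in)+)?
  have q1: "q \<one>\<^bsub>A\<^esub> \<in> carrier K"
    using form_closed[OF q] by simp
  have "?U k b \<ominus> q \<one>\<^bsub>A\<^esub> \<otimes> tau k b = \<zero>"
  proof (rule contract_eq_zeroD[where W = "\<lambda>j b. ?U j b \<ominus> q \<one>\<^bsub>A\<^esub> \<otimes> tau j b", OF _ _ k b])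
    show "form (\<lambda>b. ?U j b \<ominus> q \<one>\<^bsub>A\<^esub> \<otimes> tau j b)" if "j \<in> I" for j
      using that by (intro K.linear_form_minus K.linear_form_cmult q1 U tau_form)
    fix p a assume p: "form p" and a: "a \<in> carrier A"
    have "contract (\<lambda>x. x) (\<lambda>j b. ?U j b \<ominus> q \<one>\<^bsub>A\<^esub> \<otimes> tau j b) p a =
        p (S a) \<otimes> q \<one>\<^bsub>A\<^esub> \<ominus> q \<one>\<^bsub>A\<^esub> \<otimes> p (S a)"
      by (simp add: contract_minus[OF p U tau_form q1 a] contract_sw_tau[OF p q a] contract_tau[OF p a])
    then show "contract (\<lambda>x. x) (\<lambda>j b. ?U j b \<ominus> q \<one>\<^bsub>A\<^esub> \<otimes> tau j b) p a = \<zero>"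
      using q1 form_closed[OF p] a by (simp add: K.m_comm K.r_neg K.minus_eq)
  qed
  then show "?U k b = q \<one>\<^bsub>A\<^esub> \<otimes> tau k b"
    using q1 form_closed[OF tau_form[OF k] b] form_closed[OF U[OF k] b] by simp
qed


section \<open>Left integrals form a linear space\<close>

lemma left_integral_minus:
  assumes V: "left_integral V" and U: "left_integral U" and d: "d \<in> carrier K"
  shows "left_integral (\<lambda>b. V b \<ominus> d \<otimes> U b)"
  unfolding left_integral_def
proof (intro conjI allI impI)
  note V' = left_integralD(1)[OF V] and U' = left_integralD(1)[OF U]
  show "form (\<lambda>b. V b \<ominus> d \<otimes> U b)"
    by (intro K.linear_form_minus K.linear_form_cmult V' U' d)
  fix q a assume q: "form q" and a: "a \<in> carrier A"
  note intros = multilinear_intros form_comp[OF V'] form_comp[OF U'] q V' U'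
  note closed = closed_intros form_closed[OF q] form_closed[OF V'] form_closed[OF U'] d a
  have c: "q \<one>\<^bsub>A\<^esub> \<in> carrier K" "V a \<in> carrier K" "U a \<in> carrier K"
    by (intro closed)+
  have "sw (\<lambda>x y. q x \<otimes> (V y \<ominus> d \<otimes> U y)) a = sw (\<lambda>x y. q x \<otimes> V y \<ominus> d \<otimes> (q x \<otimes> U y)) a"
  proof (rule sw_cong[OF a])
    show "bform (\<lambda>x y. q x \<otimes> (V y \<ominus> d \<otimes> U y))"
      by (intro intros closed) ((assumption | erule basis_in)+)?
    fix x y assume "x \<in> carrier A" "y \<in> carrier A"
    then have "q x \<in> carrier K" "V y \<in> carrier K" "U y \<in> carrier K"
      by (auto intro: closed)
    then show "q x \<otimes> (V y \<ominus> d \<otimes> U y) = q x \<otimes> V y \<ominus> d \<otimes> (q x \<otimes> U y)"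
      using d by algebra
  qed
  also have "\<dots> = sw (\<lambda>x y. q x \<otimes> V y) a \<ominus> sw (\<lambda>x y. d \<otimes> (q x \<otimes> U y)) a"
    by (intro sw_minus intros closed) ((assumption | erule basis_in)+)?
  also have "sw (\<lambda>x y. d \<otimes> (q x \<otimes> U y)) a = d \<otimes> sw (\<lambda>x y. q x \<otimes> U y) a"
    by (intro sw_cmult intros closed) ((assumption | erule basis_in)+)?
  also have "sw (\<lambda>x y. q x \<otimes> V y) a \<ominus> d \<otimes> sw (\<lambda>x y. q x \<otimes> U y) a = q \<one>\<^bsub>A\<^esub> \<otimes> (V a \<ominus> d \<otimes> U a)"
    unfolding left_integralD(2)[OF V q a] left_integralD(2)[OF U q a]
    using c d by algebra
  finally show "sw (\<lambda>x y. q x \<otimes> (V y \<ominus> d \<otimes> U y)) a = q \<one>\<^bsub>A\<^esub> \<otimes> (V a \<ominus> d \<otimes> U a)" .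
qed

lemma left_integral_sum:
  assumes V: "\<And>i. i \<in> I \<Longrightarrow> left_integral (V i)" and k: "\<And>i. i \<in> I \<Longrightarrow> k i \<in> carrier K"
  shows "left_integral (\<lambda>b. \<Oplus>i\<in>I. k i \<otimes> V i b)"
  unfolding left_integral_def
proof (intro conjI allI impI)
  note V' = left_integralD(1)[OF V]
  show "form (\<lambda>b. \<Oplus>i\<in>I. k i \<otimes> V i b)"
    by (intro K.linear_form_finsum K.linear_form_cmult V' k)
  fix q a assume q: "form q" and a: "a \<in> carrier A"
  note intros = multilinear_intros form_comp[OF V'] q V'
  note closed = closed_intros form_closed[OF q] form_closed[OF V'] k a
  have q1: "q \<one>\<^bsub>A\<^esub> \<in> carrier K"
    by (intro closed)
  have "sw (\<lambda>x y. q x \<otimes> (\<Oplus>i\<in>I. k i \<otimes> V i y)) a = sw (\<lambda>x y. \<Oplus>i\<in>I. k i \<otimes> (q x \<otimes> V i y)) a"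
  proof (rule sw_cong[OF a])
    show "bform (\<lambda>x y. q x \<otimes> (\<Oplus>i\<in>I. k i \<otimes> V i y))"
      by (intro K.finsum_closed Pi_I intros closed) ((assumption | erule basis_in)+)?
    fix x y assume x: "x \<in> carrier A" and y: "y \<in> carrier A"
    then have c: "q x \<in> carrier K" "i \<in> I \<Longrightarrow> V i y \<in> carrier K" for i
      by (auto intro: closed)
    have "q x \<otimes> (\<Oplus>i\<in>I. k i \<otimes> V i y) = (\<Oplus>i\<in>I. q x \<otimes> (k i \<otimes> V i y))"
      by (rule finsum_mult_left) (use c k in auto)
    also have "\<dots> = (\<Oplus>i\<in>I. k i \<otimes> (q x \<otimes> V i y))"
      by (rule sum_cong) (use c k in \<open>auto intro: K.m_lcomm\<close>)
    finally show "q x \<otimes> (\<Oplus>i\<in>I. k i \<otimes> V i y) = (\<Oplus>i\<in>I. k i \<otimes> (q x \<otimes> V i y))" .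
  qed
  also have "\<dots> = (\<Oplus>i\<in>I. sw (\<lambda>x y. k i \<otimes> (q x \<otimes> V i y)) a)"
    by (intro sw_finsum[OF a basis_finite] intros closed) ((assumption | erule basis_in)+)?
  also have "\<dots> = (\<Oplus>i\<in>I. q \<one>\<^bsub>A\<^esub> \<otimes> (k i \<otimes> V i a))"
  proof (rule sum_cong)
    fix i assume i: "i \<in> I"
    have c: "V i a \<in> carrier K"
      using i by (intro closed)
    have "sw (\<lambda>x y. k i \<otimes> (q x \<otimes> V i y)) a = k i \<otimes> sw (\<lambda>x y. q x \<otimes> V i y) a"
      using i by (intro sw_cmult intros closed) ((assumption | erule basis_in)+)?
    then show "sw (\<lambda>x y. k i \<otimes> (q x \<otimes> V i y)) a = q \<one>\<^bsub>A\<^esub> \<otimes> (k i \<otimes> V i a)"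
      using c q1 k[OF i] by (simp add: left_integralD(2)[OF V[OF i] q a] K.m_lcomm)
    show "q \<one>\<^bsub>A\<^esub> \<otimes> (k i \<otimes> V i a) \<in> carrier K"
      using c q1 k[OF i] by simp
  qed
  also have "\<dots> = q \<one>\<^bsub>A\<^esub> \<otimes> (\<Oplus>i\<in>I. k i \<otimes> V i a)"
    by (rule finsum_mult_left[symmetric]) (auto intro: closed)
  finally show "sw (\<lambda>x y. q x \<otimes> (\<Oplus>i\<in>I. k i \<otimes> V i y)) a = q \<one>\<^bsub>A\<^esub> \<otimes> (\<Oplus>i\<in>I. k i \<otimes> V i a)" .
qed

text \<open>For integrals, \<open>left_integral_shift\<close> moves the coproduct from the basis
  vector j to a. Hence the image of a family of integrals under R_id depends only on its trace form,
  the sum of \<open>V j (y \<star> j)\<close> over j as a function of y.\<close>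

lemma contract_left_integral:
  assumes V: "\<And>j. j \<in> I \<Longrightarrow> left_integral (V j)" and p: "form p" and a: "a \<in> carrier A"
  shows "contract (\<lambda>x. x) V p a = sw (\<lambda>x y. p (S x) \<otimes> (\<Oplus>j\<in>I. V j (y \<star> j))) a"
proof -
  note V' = left_integralD(1)[OF V]
  note intros = multilinear_intros form_comp[OF V'] form_comp[OF p] p V'
  note closed = closed_intros form_closed[OF p] form_closed[OF V'] a
  have "contract (\<lambda>x. x) V p a = (\<Oplus>j\<in>I. sw (\<lambda>x y. p (S x) \<otimes> V j (y \<star> j)) a)"
    unfolding contract_def
  proof (rule sum_cong)
    fix j assume j: "j \<in> I"
    show "sw (\<lambda>x y. p x \<otimes> V j (a \<star> y)) j = sw (\<lambda>x y. p (S x) \<otimes> V j (y \<star> j)) a"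
      by (rule left_integral_shift[OF V[OF j] p a basis_in[OF j]])
    show "sw (\<lambda>x y. p (S x) \<otimes> V j (y \<star> j)) a \<in> carrier K"
      using j by (intro intros closed) ((assumption | erule basis_in)+)?
  qed
  also have "\<dots> = sw (\<lambda>x y. \<Oplus>j\<in>I. p (S x) \<otimes> V j (y \<star> j)) a"
    by (intro sw_finsum[OF a basis_finite, symmetric] intros closed) ((assumption | erule basis_in)+)?
  also have "\<dots> = sw (\<lambda>x y. p (S x) \<otimes> (\<Oplus>j\<in>I. V j (y \<star> j))) a"
  proof (rule sw_cong[OF a])
    show "bform (\<lambda>x y. \<Oplus>j\<in>I. p (S x) \<otimes> V j (y \<star> j))"
      by (intro intros closed) ((assumption | erule basis_in)+)?
    show "(\<Oplus>j\<in>I. p (S x) \<otimes> V j (y \<star> j)) = p (S x) \<otimes> (\<Oplus>j\<in>I. V j (y \<star> j))"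
      if "x \<in> carrier A" "y \<in> carrier A" for x y
      by (rule finsum_mult_left[symmetric]) (use that basis_in in \<open>auto intro: closed\<close>)
  qed
  finally show ?thesis .
qed

text \<open>Apply \<epsilon> to the identity of \<open>contract_tau\<close> and use that \<epsilon>
  is invariant under S. So the trace form of \<open>tau\<close> is \<epsilon>, which is the
  normalization behind the existence of a nonzero integral.\<close>

lemma sum_tau:
  assumes a: "a \<in> carrier A"
  shows "(\<Oplus>j\<in>I. tau j (a \<star> j)) = \<epsilon> a"
proof -
  have "(\<Oplus>j\<in>I. tau j (a \<star> j)) = contract (\<lambda>x. x) tau \<epsilon> a"
    unfolding contract_def
  proof (rule sum_cong)
    fix j assume j: "j \<in> I"
    have "form (\<lambda>y. tau j (a \<star> y))"
      by (rule form_comp[OF tau_form[OF j] lin_mult_left[OF a lin_id]])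
    then show "tau j (a \<star> j) = sw (\<lambda>x y. \<epsilon> x \<otimes> tau j (a \<star> y)) j"
      using sw_counit_left[of "\<lambda>y. tau j (a \<star> y)" j] basis_in[OF j] by simp
    then show "sw (\<lambda>x y. \<epsilon> x \<otimes> tau j (a \<star> y)) j \<in> carrier K"
      using form_closed[OF tau_form[OF j], of "a \<star> j"] a basis_in[OF j] by simp
  qed
  then show ?thesis
    using a by (simp add: contract_tau[OF counit_form] counit_antipode)
qed

text \<open>For fixed c, the differences of the two sides form a family of left integrals whose
  trace form is \<epsilon>(y c) - \<epsilon>(c) \<epsilon>(y) = 0. By
  \<open>contract_left_integral\<close> its image under R_id vanishes, hence so does the family. The
  result is the j-th coordinate of c \<Lambda> = \<epsilon>(c) \<Lambda>.\<close>

lemma tau_left_integral_element: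
  assumes c: "c \<in> carrier A" and j: "j \<in> I" and b: "b \<in> carrier A"
  shows "(\<Oplus>k\<in>I. v j (c \<star> k) \<otimes> tau k b) = \<epsilon> c \<otimes> tau j b"
proof -
  have vk: "v i (c \<star> k) \<in> carrier K" if "i \<in> I" "k \<in> I" for i k
    using that c basis_in by (intro form_closed[OF coord_form]) auto
  have tk: "tau i x \<in> carrier K" if "i \<in> I" "x \<in> carrier A" for i x
    using that by (intro form_closed[OF tau_form])
  have ec: "\<epsilon> c \<in> carrier K"
    using c by (rule form_closed[OF counit_form])
  let ?V = "\<lambda>j b. (\<Oplus>k\<in>I. v j (c \<star> k) \<otimes> tau k b) \<ominus> \<epsilon> c \<otimes> tau j b"
  have V: "left_integral (?V i)" if i: "i \<in> I" for i
    using i vk ec by (intro left_integral_minus left_integral_sum tau_left_integral)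
  have zero: "(\<Oplus>i\<in>I. ?V i (y \<star> i)) = \<zero>" if y: "y \<in> carrier A" for y
  proof -
    have yi: "y \<star> i \<in> carrier A" if "i \<in> I" for i
      using y that basis_in by simp
    have s1: "(\<Oplus>k\<in>I. v i (c \<star> k) \<otimes> tau k (y \<star> i)) \<in> carrier K" if "i \<in> I" for i
      using that vk tk yi by (intro K.finsum_closed) auto
    have "(\<Oplus>i\<in>I. ?V i (y \<star> i)) =
        (\<Oplus>i\<in>I. (\<Oplus>k\<in>I. v i (c \<star> k) \<otimes> tau k (y \<star> i)) \<oplus> \<ominus> \<epsilon> c \<otimes> tau i (y \<star> i))"
      by (rule sum_cong) (use s1 tk yi ec in \<open>auto simp: K.minus_eq K.l_minus\<close>)
    also have "\<dots> = (\<Oplus>i\<in>I. \<Oplus>k\<in>I. v i (c \<star> k) \<otimes> tau k (y \<star> i)) \<oplus> (\<Oplus>i\<in>I. \<ominus> \<epsilon> c \<otimes> tau i (y \<star> i))"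
      by (rule K.finsum_addf) (use s1 tk yi ec in auto)
    also have "(\<Oplus>i\<in>I. \<ominus> \<epsilon> c \<otimes> tau i (y \<star> i)) = \<ominus> \<epsilon> c \<otimes> \<epsilon> y"
      using finsum_mult_left[of "\<ominus> \<epsilon> c" "\<lambda>i. tau i (y \<star> i)"] ec tk yi by (simp add: sum_tau[OF y])
    also have "(\<Oplus>i\<in>I. \<Oplus>k\<in>I. v i (c \<star> k) \<otimes> tau k (y \<star> i)) = (\<Oplus>k\<in>I. \<Oplus>i\<in>I. v i (c \<star> k) \<otimes> tau k (y \<star> i))"
      by (rule K.finsum_swap[OF basis_finite basis_finite]) (use vk tk yi in auto)
    \<comment> \<open>The sum over i is the basis expansion of c k; undoing it leaves the trace form
      of \<open>tau\<close> at y c.\<close>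
    also have "\<dots> = (\<Oplus>k\<in>I. tau k (y \<star> c \<star> k))"
    proof (rule sum_cong)
      fix k assume k: "k \<in> I"
      have "(\<Oplus>i\<in>I. v i (c \<star> k) \<otimes> tau k (y \<star> i)) = tau k (y \<star> (c \<star> k))"
        using form_expand[OF form_comp[OF tau_form[OF k] lin_mult_left[OF y lin_id]], of "c \<star> k"] c basis_in[OF k]
        by simp
      then show "(\<Oplus>i\<in>I. v i (c \<star> k) \<otimes> tau k (y \<star> i)) = tau k (y \<star> c \<star> k)"
        using c y basis_in[OF k] by (simp add: ring.m_assoc)
      show "tau k (y \<star> c \<star> k) \<in> carrier K"
        using c y k basis_in[OF k] by (intro tk) simp_all
    qed
    also have "\<dots> = \<epsilon> y \<otimes> \<epsilon> c"
      using c y by (simp add: sum_tau counit_mult)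
    finally show ?thesis
      using ec form_closed[OF counit_form y] by (simp add: K.l_minus K.m_comm[of "\<epsilon> y" "\<epsilon> c"] K.r_neg)
  qed
  have "?V j b = \<zero>"
  proof (rule contract_eq_zeroD[where W = ?V, OF left_integralD(1)[OF V] _ j b])
    fix p a assume p: "form p" and a: "a \<in> carrier A"
    have "contract (\<lambda>x. x) ?V p a = sw (\<lambda>x y. p (S x) \<otimes> (\<Oplus>i\<in>I. ?V i (y \<star> i))) a"
      by (rule contract_left_integral[where V = ?V, OF V p a])
    also have "\<dots> = \<zero>"
      by (rule sw_zero_fun[OF a]) (simp add: zero form_closed[OF p])
    finally show "contract (\<lambda>x. x) ?V p a = \<zero>" .
  qed
  moreover have "(\<Oplus>k\<in>I. v j (c \<star> k) \<otimes> tau k b) \<in> carrier K"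
    using vk tk j b by (intro K.finsum_closed) auto
  ultimately show ?thesis
    using ec tk[OF j b] by simp
qed

text \<open>Write p(h) V(a) as p(h_1) V(a S(h_2) h_3). Once the first two legs are separated by a
  basis expansion, what remains is v_i(h_1) V(b h_2), which the shift turns into v_i(S(b_1)) V(b_2
  h) = 0.\<close>

lemma left_integral_nondegenerate:
  assumes V: "left_integral V" and h: "h \<in> carrier A" and zero: "\<And>a. a \<in> carrier A \<Longrightarrow> V (a \<star> h) = \<zero>"
    and p: "form p" and a: "a \<in> carrier A"
  shows "p h \<otimes> V a = \<zero>"
proof -
  note V' = left_integralD(1)[OF V]
  note intros = multilinear_intros form_comp[OF V'] p V' counit_form coord_form
  note closed = closed_intros form_closed[OF p] form_closed[OF V'] form_closed[OF counit_form]
    form_closed[OF coord_form] a h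
  let ?g = "\<lambda>z w. sw (\<lambda>x y. p x \<otimes> V (a \<star> (S y \<star> z))) w"
  have "p h \<otimes> V a = sw (\<lambda>x t. p x \<otimes> V a \<otimes> \<epsilon> t) h"
    by (intro sw_counit_right[symmetric] intros closed) ((assumption | erule basis_in)+)?
  also have "\<dots> = sw (\<lambda>x t. sw (\<lambda>y z. p x \<otimes> V (a \<star> (S y \<star> z))) t) h"
  proof (rule sw_cong[OF h])
    show "bform (\<lambda>x t. p x \<otimes> V a \<otimes> \<epsilon> t)"
      by (intro intros closed) ((assumption | erule basis_in)+)?
    fix x t assume x: "x \<in> carrier A" and t: "t \<in> carrier A"
    have f: "form (\<lambda>w. p x \<otimes> V (a \<star> w))"
      using x by (intro intros closed) ((assumption | erule basis_in)+)?
    have "p x \<in> carrier K" "V a \<in> carrier K" "\<epsilon> t \<in> carrier K"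
      using x t by (auto intro!: closed)
    then show "p x \<otimes> V a \<otimes> \<epsilon> t = sw (\<lambda>y z. p x \<otimes> V (a \<star> (S y \<star> z))) t"
      using sw_antipode_left[OF f t] a by (simp add: K.m_comm)
  qed
  also have "\<dots> = sw (\<lambda>w z. ?g z w) h"
    by (intro sw_assoc[symmetric] intros closed) ((assumption | erule basis_in)+)?
  \<comment> \<open>Expanding the left leg w in the basis lets i carry the inner coproduct, so that
    the two legs of h occur in the shape required by \<open>left_integral_shift\<close>.\<close>
  also have "\<dots> = (\<Oplus>i\<in>I. sw (\<lambda>w z. v i w \<otimes> ?g z i) h)"
    by (intro sw_expand[OF h, symmetric] intros closed) ((assumption | erule basis_in)+)?
  also have "\<dots> = (\<Oplus>i\<in>I. \<zero>)"
  proof (rule sum_cong)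
    fix i assume i: "i \<in> I"
    note i' = basis_in[OF i]
    have "sw (\<lambda>w z. v i w \<otimes> ?g z i) h = sw (\<lambda>w z. sw (\<lambda>x y. v i w \<otimes> (p x \<otimes> V (a \<star> (S y \<star> z)))) i) h"
    proof (rule sw_cong[OF h])
      show "bform (\<lambda>w z. v i w \<otimes> ?g z i)"
        using i by (intro intros closed) ((assumption | erule basis_in)+)?
      show "v i w \<otimes> ?g z i = sw (\<lambda>x y. v i w \<otimes> (p x \<otimes> V (a \<star> (S y \<star> z)))) i"
        if "w \<in> carrier A" "z \<in> carrier A" for w z
        using i that by (intro sw_mult_left intros closed) ((assumption | erule basis_in)+)?
    qed
    also have "\<dots> = sw (\<lambda>x y. sw (\<lambda>w z. v i w \<otimes> (p x \<otimes> V (a \<star> (S y \<star> z)))) h) i"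
      using i by (intro swap[OF h i'] intros closed) ((assumption | erule basis_in)+)?
    also have "\<dots> = \<zero>"
    proof (rule sw_zero_fun[OF i'])
      fix x y assume x: "x \<in> carrier A" and y: "y \<in> carrier A"
      have "sw (\<lambda>w z. v i w \<otimes> (p x \<otimes> V (a \<star> (S y \<star> z)))) h = sw (\<lambda>w z. p x \<otimes> (v i w \<otimes> V (a \<star> S y \<star> z))) h"
      proof (rule sw_cong[OF h])
        show "bform (\<lambda>w z. v i w \<otimes> (p x \<otimes> V (a \<star> (S y \<star> z))))"
          using i x y by (intro intros closed) ((assumption | erule basis_in)+)?
        fix w z assume w: "w \<in> carrier A" and z: "z \<in> carrier A"
        have "v i w \<in> carrier K" "p x \<in> carrier K" "V (a \<star> S y \<star> z) \<in> carrier K"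
          using i x y w z by (auto intro!: closed)
        then show "v i w \<otimes> (p x \<otimes> V (a \<star> (S y \<star> z))) = p x \<otimes> (v i w \<otimes> V (a \<star> S y \<star> z))"
          using y z a by (simp add: ring.m_assoc K.m_lcomm)
      qed
      also have "\<dots> = p x \<otimes> sw (\<lambda>w z. v i w \<otimes> V (a \<star> S y \<star> z)) h"
        using i x y by (intro sw_cmult intros closed) ((assumption | erule basis_in)+)?
      also have "sw (\<lambda>w z. v i w \<otimes> V (a \<star> S y \<star> z)) h = sw (\<lambda>w z. v i (S w) \<otimes> V (z \<star> h)) (a \<star> S y)"
        by (rule left_integral_shift[OF V coord_form[OF i] _ h]) (use a y in simp)
      also have "\<dots> = \<zero>"
        by (rule sw_zero_fun) (use a y in \<open>simp_all add: zero form_closed[OF coord_form[OF i]]\<close>)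
      finally show "sw (\<lambda>w z. v i w \<otimes> (p x \<otimes> V (a \<star> (S y \<star> z)))) h = \<zero>"
        using form_closed[OF p x] by simp
    qed
    finally show "sw (\<lambda>w z. v i w \<otimes> ?g z i) h = \<zero>" .
  qed simp
  finally show ?thesis
    by simp
qed

theorem left_integral_unique:
  "\<exists>V. left_integral V \<and> (\<exists>a\<in>carrier A. V a \<noteq> \<zero>) \<and>
    (\<forall>U. left_integral U \<longrightarrow> (\<exists>c\<in>carrier K. \<forall>a\<in>carrier A. U a = c \<otimes> V a))"
proof -
  \<comment> \<open>If all forms \<open>tau k\<close> vanished, their trace form would give
    \<epsilon>(1) = 0.\<close>
  have "\<exists>k\<in>I. tau k \<one>\<^bsub>A\<^esub> \<noteq> \<zero> \<or> (\<exists>b\<in>carrier A. tau k b \<noteq> \<zero>)"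
  proof (rule ccontr)
    assume "\<not> ?thesis"
    then have z: "tau k b = \<zero>" if "k \<in> I" "b \<in> carrier A" for k b
      using that by blast
    have "(\<Oplus>j\<in>I. tau j (\<one>\<^bsub>A\<^esub> \<star> j)) = (\<Oplus>j\<in>I. \<zero>)"
      by (rule sum_cong) (simp_all add: z basis_in)
    then show False
      using sum_tau[of "\<one>\<^bsub>A\<^esub>"] by (simp add: counit_one)
  qed
  then obtain k b where k: "k \<in> I" and b: "b \<in> carrier A" and kb: "tau k b \<noteq> \<zero>"
    by auto
  \<comment> \<open>The choice of k and b makes the coordinate of \<Lambda> at k equal to
    \<open>tau k b\<close>, hence nonzero.\<close>
  define \<Lambda> where "\<Lambda> = (\<Oplus>\<^bsub>A\<^esub>i\<in>I. tau i b \<odot>\<^bsub>A\<^esub> i)"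
  have t: "tau i x \<in> carrier K" if "i \<in> I" "x \<in> carrier A" for i x
    using that by (intro form_closed[OF tau_form])
  have \<Lambda>: "\<Lambda> \<in> carrier A"
    unfolding \<Lambda>_def by (rule A.finsum_closed) (use t b basis_in in auto)
  have f\<Lambda>: "f \<Lambda> = (\<Oplus>i\<in>I. f i \<otimes> tau i b)" if f: "form f" for f
  proof -
    have "f \<Lambda> = (\<Oplus>\<^bsub>ground_algebra K\<^esub>i\<in>I. f (tau i b \<odot>\<^bsub>A\<^esub> i))"
      unfolding \<Lambda>_def
      by (rule module_hom_finsum[OF A.module_axioms K.ground_module f]) (use t b basis_in in auto)
    also have "\<dots> = (\<Oplus>i\<in>I. f i \<otimes> tau i b)"
      unfolding finsum_ground_algebra
      by (rule sum_cong) (use t b basis_in linear_formD[OF f] in \<open>auto simp: K.m_comm\<close>)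
    finally show ?thesis .
  qed
  have v\<Lambda>: "v j \<Lambda> = tau j b" if j: "j \<in> I" for j
  proof -
    have "v j \<Lambda> = (\<Oplus>i\<in>I. if j = i then tau i b else \<zero>)"
      unfolding f\<Lambda>[OF coord_form[OF j]]
      by (rule sum_cong) (use j t b in \<open>auto simp: coord_basis\<close>)
    also have "\<dots> = tau j b"
      by (rule K.add.finprod_singleton[OF j basis_finite]) (use t b in auto)
    finally show ?thesis .
  qed
  have integral_element: "f (c \<star> \<Lambda>) = \<epsilon> c \<otimes> f \<Lambda>" if f: "form f" and c: "c \<in> carrier A" for f c
  proof -
    have fc: "form (\<lambda>x. v j (c \<star> x))" if "j \<in> I" for j
      by (rule form_comp[OF coord_form[OF that] lin_mult_left[OF c lin_id]])
    have "f (c \<star> \<Lambda>) = (\<Oplus>j\<in>I. v j (c \<star> \<Lambda>) \<otimes> f j)"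
      using form_expand[OF f, of "c \<star> \<Lambda>"] c \<Lambda> by simp
    also have "\<dots> = (\<Oplus>j\<in>I. \<epsilon> c \<otimes> (v j \<Lambda> \<otimes> f j))"
    proof (rule sum_cong)
      fix j assume j: "j \<in> I"
      have "v j (c \<star> \<Lambda>) = \<epsilon> c \<otimes> tau j b"
        using f\<Lambda>[OF fc[OF j]] tau_left_integral_element[OF c j b] by simp
      then show "v j (c \<star> \<Lambda>) \<otimes> f j = \<epsilon> c \<otimes> (v j \<Lambda> \<otimes> f j)"
        using j b c basis_in[OF j] form_closed[OF counit_form c] t linear_formD(1)[OF f]
        by (simp add: v\<Lambda> K.m_assoc)
      show "\<epsilon> c \<otimes> (v j \<Lambda> \<otimes> f j) \<in> carrier K"
        using j b c basis_in[OF j] form_closed[OF counit_form c] t linear_formD(1)[OF f]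
        by (simp add: v\<Lambda>)
    qed
    also have "\<dots> = \<epsilon> c \<otimes> f \<Lambda>"
      using finsum_mult_left[of "\<epsilon> c" "\<lambda>j. v j \<Lambda> \<otimes> f j"] form_expand[OF f \<Lambda>]
        form_closed[OF counit_form c] t b basis_in linear_formD(1)[OF f] by (simp add: v\<Lambda>)
    finally show ?thesis .
  qed
  \<comment> \<open>From c \<Lambda> = \<epsilon>(c) \<Lambda> it follows that U(c \<Lambda>) =
    \<epsilon>(c) U(\<Lambda>) = 0 for all c, which is the hypothesis of
    \<open>left_integral_nondegenerate\<close>; there p = \<open>v k\<close> does not vanish at
    \<Lambda>.\<close>
  have eq_zero: "U a = \<zero>" if U: "left_integral U" and U\<Lambda>: "U \<Lambda> = \<zero>" and a: "a \<in> carrier A" for U a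
  proof -
    have "v k \<Lambda> \<otimes> U a = \<zero>"
      by (rule left_integral_nondegenerate[OF U \<Lambda> _ coord_form[OF k] a])
        (simp add: integral_element[OF left_integralD(1)[OF U]] U\<Lambda> form_closed[OF counit_form])
    then show ?thesis
      using kb t[OF k b] form_closed[OF left_integralD(1)[OF U] a] by (simp add: v\<Lambda>[OF k] K.integral_iff)
  qed
  let ?V = "tau k"
  note V = tau_left_integral[OF k]
  have V\<Lambda>: "?V \<Lambda> \<noteq> \<zero>" "?V \<Lambda> \<in> carrier K"
    using eq_zero[OF V _ b] kb t[OF k \<Lambda>] by auto
  have "\<exists>c\<in>carrier K. \<forall>a\<in>carrier A. U a = c \<otimes> ?V a" if U: "left_integral U" for U
  proof (intro bexI ballI)
    \<comment> \<open>The ratio for which U - c V vanishes at \<Lambda>.\<close>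
    let ?c = "U \<Lambda> \<otimes> inv (?V \<Lambda>)"
    have inv: "inv (?V \<Lambda>) \<in> carrier K" "inv (?V \<Lambda>) \<otimes> ?V \<Lambda> = \<one>"
      using V\<Lambda> by (auto simp: K.field_Units)
    have U\<Lambda>: "U \<Lambda> \<in> carrier K"
      by (rule form_closed[OF left_integralD(1)[OF U] \<Lambda>])
    show c: "?c \<in> carrier K"
      using inv U\<Lambda> by simp
    fix a assume a: "a \<in> carrier A"
    have "U a \<ominus> ?c \<otimes> ?V a = \<zero>"
    proof (rule eq_zero[OF left_integral_minus[OF U V c] _ a])
      show "U \<Lambda> \<ominus> ?c \<otimes> ?V \<Lambda> = \<zero>"
        using inv U\<Lambda> V\<Lambda> by (simp add: K.m_assoc)
    qed
    then show "U a = ?c \<otimes> ?V a"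
      using c t[OF k a] form_closed[OF left_integralD(1)[OF U] a] by simp
  qed
  then show ?thesis
    using V kb b by blast
qed

end


section \<open>Integrals on a graded family\<close>

definition dual_basis ::
  "('k, 'm) ring_scheme \<Rightarrow> ('k, 'a) module \<Rightarrow> 'a set \<Rightarrow> ('a \<Rightarrow> 'a \<Rightarrow> 'k) \<Rightarrow> bool"
  where "dual_basis K A I v \<longleftrightarrow> finite I \<and> I \<subseteq> carrier A \<and> (\<forall>i\<in>I. linear_form K A (v i)) \<and>
    (\<forall>i\<in>I. \<forall>j\<in>I. v i j = (if i = j then \<one>\<^bsub>K\<^esub> else \<zero>\<^bsub>K\<^esub>)) \<and>
    (\<forall>f a. linear_form K A f \<longrightarrow> a \<in> carrier A \<longrightarrow> (\<Oplus>\<^bsub>K\<^esub>i\<in>I. v i a \<otimes>\<^bsub>K\<^esub> f i) = f a)"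

lemma dual_basisD:
  assumes "dual_basis K A I v"
  shows "finite I" "I \<subseteq> carrier A" "i \<in> I \<Longrightarrow> linear_form K A (v i)"
    "\<lbrakk>i \<in> I; j \<in> I\<rbrakk> \<Longrightarrow> v i j = (if i = j then \<one>\<^bsub>K\<^esub> else \<zero>\<^bsub>K\<^esub>)"
    "\<lbrakk>linear_form K A f; a \<in> carrier A\<rbrakk> \<Longrightarrow> (\<Oplus>\<^bsub>K\<^esub>i\<in>I. v i a \<otimes>\<^bsub>K\<^esub> f i) = f a"
  using assms by (simp_all add: dual_basis_def)

text \<open>A graded Hopf structure with all tensors replaced by pairings; the action of E is added
  later by \<open>left_integral_family_invariant\<close>. Finite dimension enters here as a dual
  basis of the member at the unit of H and as a form with value one at the unit of each nonzero
  member.\<close>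

locale hopf_family = K?: field K + H: group H
  for K :: "('k, 'm) ring_scheme" (structure) and H :: "('h, 'q) monoid_scheme" +
  fixes A :: "'h \<Rightarrow> ('k, 'a) module" and sw :: "'h \<Rightarrow> 'h \<Rightarrow> ('a \<Rightarrow> 'a \<Rightarrow> 'k) \<Rightarrow> 'a \<Rightarrow> 'k"
    and \<epsilon> :: "'a \<Rightarrow> 'k" and S :: "'h \<Rightarrow> 'a \<Rightarrow> 'a"
  assumes algebra: "x \<in> carrier H \<Longrightarrow> assoc_algebra K (A x)"
    and sweedler: "\<lbrakk>x \<in> carrier H; y \<in> carrier H\<rbrakk> \<Longrightarrow>
      sweedler K (A (x \<otimes>\<^bsub>H\<^esub> y)) (A x) (A y) (sw x y)"
    and sw_mult: "\<lbrakk>x \<in> carrier H; y \<in> carrier H; bilinear_form K (A x) (A y) \<beta>;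
        a \<in> carrier (A (x \<otimes>\<^bsub>H\<^esub> y)); b \<in> carrier (A (x \<otimes>\<^bsub>H\<^esub> y))\<rbrakk> \<Longrightarrow>
      sw x y \<beta> (a \<otimes>\<^bsub>A (x \<otimes>\<^bsub>H\<^esub> y)\<^esub> b) =
      sw x y (\<lambda>p q. sw x y (\<lambda>r s. \<beta> (p \<otimes>\<^bsub>A x\<^esub> r) (q \<otimes>\<^bsub>A y\<^esub> s)) b) a"
    and sw_one: "\<lbrakk>x \<in> carrier H; y \<in> carrier H; bilinear_form K (A x) (A y) \<beta>\<rbrakk> \<Longrightarrow>
      sw x y \<beta> \<one>\<^bsub>A (x \<otimes>\<^bsub>H\<^esub> y)\<^esub> = \<beta> \<one>\<^bsub>A x\<^esub> \<one>\<^bsub>A y\<^esub>"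
    and sw_assoc: "\<lbrakk>x \<in> carrier H; y \<in> carrier H; z \<in> carrier H;
        trilinear_form K (A x) (A y) (A z) \<gamma>; a \<in> carrier (A (x \<otimes>\<^bsub>H\<^esub> y \<otimes>\<^bsub>H\<^esub> z))\<rbrakk> \<Longrightarrow>
      sw (x \<otimes>\<^bsub>H\<^esub> y) z (\<lambda>t r. sw x y (\<lambda>p q. \<gamma> p q r) t) a =
      sw x (y \<otimes>\<^bsub>H\<^esub> z) (\<lambda>p t. sw y z (\<gamma> p) t) a"
    and counit_form: "linear_form K (A \<one>\<^bsub>H\<^esub>) \<epsilon>"
    and counit_one: "\<epsilon> \<one>\<^bsub>A \<one>\<^bsub>H\<^esub>\<^esub> = \<one>"
    and counit_mult: "\<lbrakk>a \<in> carrier (A \<one>\<^bsub>H\<^esub>); b \<in> carrier (A \<one>\<^bsub>H\<^esub>)\<rbrakk> \<Longrightarrow>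
      \<epsilon> (a \<otimes>\<^bsub>A \<one>\<^bsub>H\<^esub>\<^esub> b) = \<epsilon> a \<otimes> \<epsilon> b"
    and sw_counit_left: "\<lbrakk>x \<in> carrier H; linear_form K (A x) f; a \<in> carrier (A x)\<rbrakk> \<Longrightarrow>
      sw \<one>\<^bsub>H\<^esub> x (\<lambda>p q. \<epsilon> p \<otimes> f q) a = f a"
    and sw_counit_right: "\<lbrakk>x \<in> carrier H; linear_form K (A x) f; a \<in> carrier (A x)\<rbrakk> \<Longrightarrow>
      sw x \<one>\<^bsub>H\<^esub> (\<lambda>p q. f p \<otimes> \<epsilon> q) a = f a"
    and antipode_linear: "x \<in> carrier H \<Longrightarrow> S x \<in> module_hom K (A (inv\<^bsub>H\<^esub> x)) (A x)"
    and sw_antipode_left: "\<lbrakk>x \<in> carrier H; linear_form K (A x) f; a \<in> carrier (A \<one>\<^bsub>H\<^esub>)\<rbrakk> \<Longrightarrow>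
      sw (inv\<^bsub>H\<^esub> x) x (\<lambda>p q. f (S x p \<otimes>\<^bsub>A x\<^esub> q)) a = \<epsilon> a \<otimes> f \<one>\<^bsub>A x\<^esub>"
    and sw_antipode_right: "\<lbrakk>x \<in> carrier H; linear_form K (A x) f; a \<in> carrier (A \<one>\<^bsub>H\<^esub>)\<rbrakk> \<Longrightarrow>
      sw x (inv\<^bsub>H\<^esub> x) (\<lambda>p q. f (p \<otimes>\<^bsub>A x\<^esub> S x q)) a = \<epsilon> a \<otimes> f \<one>\<^bsub>A x\<^esub>"
    and ex_dual_basis: "\<exists>I v. dual_basis K (A \<one>\<^bsub>H\<^esub>) I v"
    and ex_normalized: "\<lbrakk>x \<in> carrier H; \<one>\<^bsub>A x\<^esub> \<noteq> \<zero>\<^bsub>A x\<^esub>\<rbrakk> \<Longrightarrow> \<exists>f. linear_form K (A x) f \<and> f \<one>\<^bsub>A x\<^esub> = \<one>"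
begin

abbreviation mulH (infixl \<open>\<cdot>\<close> 70) where "x \<cdot> y \<equiv> x \<otimes>\<^bsub>H\<^esub> y"
abbreviation "e \<equiv> \<one>\<^bsub>H\<^esub>"
abbreviation form where "form x f \<equiv> linear_form K (A x) f"
abbreviation bform where "bform x y \<beta> \<equiv> bilinear_form K (A x) (A y) \<beta>"

lemma module: "x \<in> carrier H \<Longrightarrow> module K (A x)"
  using algebra by (simp add: assoc_algebra_def vectorspace_def)

lemma algebra_ring: "x \<in> carrier H \<Longrightarrow> ring (A x)"
  using algebra by (simp add: assoc_algebra_def assoc_algebra_axioms_def)

lemma one_closed [simp]: "x \<in> carrier H \<Longrightarrow> \<one>\<^bsub>A x\<^esub> \<in> carrier (A x)"
  using algebra_ring by (simp add: ring.ring_simprules)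

lemma mult_closed [simp]:
  "\<lbrakk>x \<in> carrier H; a \<in> carrier (A x); b \<in> carrier (A x)\<rbrakk> \<Longrightarrow> a \<otimes>\<^bsub>A x\<^esub> b \<in> carrier (A x)"
  using algebra_ring by (simp add: ring.ring_simprules)

lemma S_closed: "\<lbrakk>x \<in> carrier H; a \<in> carrier (A (inv\<^bsub>H\<^esub> x))\<rbrakk> \<Longrightarrow> S x a \<in> carrier (A x)"
  using module_hom_carrier[OF antipode_linear] .

lemma form_closed: "\<lbrakk>form x f; a \<in> carrier (A x)\<rbrakk> \<Longrightarrow> f a \<in> carrier K"
  by (rule linear_formD(1))

lemma form_zero:
  assumes "x \<in> carrier H" "form x f"
  shows "f \<zero>\<^bsub>A x\<^esub> = \<zero>"
proof -
  interpret module K "A x" by (rule module[OF assms(1)])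
  have "f (\<zero> \<odot>\<^bsub>A x\<^esub> \<zero>\<^bsub>A x\<^esub>) = \<zero> \<otimes> f \<zero>\<^bsub>A x\<^esub>"
    by (rule linear_formD(3)[OF assms(2)]) simp_all
  then show ?thesis
    using form_closed[OF assms(2)] by simp
qed

lemma trivial_algebra:
  assumes "x \<in> carrier H" "\<one>\<^bsub>A x\<^esub> = \<zero>\<^bsub>A x\<^esub>" "a \<in> carrier (A x)"
  shows "a = \<zero>\<^bsub>A x\<^esub>"
proof -
  interpret ring "A x" by (rule algebra_ring[OF assms(1)])
  have "\<one>\<^bsub>A x\<^esub> \<otimes>\<^bsub>A x\<^esub> a = \<zero>\<^bsub>A x\<^esub>"
    using assms(2,3) by simp
  then show ?thesis
    using assms(3) by simp
qed

lemma lin_mult_left: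
  assumes "x \<in> carrier H" "a \<in> carrier (A x)" "g \<in> module_hom K M (A x)"
  shows "(\<lambda>w. a \<otimes>\<^bsub>A x\<^esub> g w) \<in> module_hom K M (A x)"
proof -
  interpret assoc_algebra K "A x" by (rule algebra[OF assms(1)])
  interpret r: ring "A x" by (rule ring)
  show ?thesis
    by (rule module_homI)
      (use assms in \<open>auto simp: module_hom_add module_hom_smult module_hom_carrier r.r_distr smult_mult_right\<close>)
qed

lemma lin_mult_right:
  assumes "x \<in> carrier H" "a \<in> carrier (A x)" "g \<in> module_hom K M (A x)"
  shows "(\<lambda>w. g w \<otimes>\<^bsub>A x\<^esub> a) \<in> module_hom K M (A x)"
proof -
  interpret assoc_algebra K "A x" by (rule algebra[OF assms(1)])
  interpret r: ring "A x" by (rule ring)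
  show ?thesis
    by (rule module_homI)
      (use assms in \<open>auto simp: module_hom_add module_hom_smult module_hom_carrier r.l_distr smult_mult_left\<close>)
qed

lemma lin_id: "(\<lambda>x. x) \<in> module_hom K M M"
  by (rule module_homI) auto

lemma form_sw_param:
  assumes "x \<in> carrier H" "y \<in> carrier H" "z \<in> carrier H" "a \<in> carrier (A (x \<cdot> y))"
    "\<And>w. w \<in> carrier (A z) \<Longrightarrow> bform x y (\<beta> w)"
    "\<And>p q. \<lbrakk>p \<in> carrier (A x); q \<in> carrier (A y)\<rbrakk> \<Longrightarrow> form z (\<lambda>w. \<beta> w p q)"
  shows "form z (\<lambda>w. sw x y (\<beta> w) a)"
  by (rule sweedler.sw_param[OF sweedler[OF assms(1,2)] assms(4) module[OF assms(3)] assms(5,6)])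

lemma form_sw: "\<lbrakk>x \<in> carrier H; y \<in> carrier H; bform x y \<beta>\<rbrakk> \<Longrightarrow> form (x \<cdot> y) (sw x y \<beta>)"
  by (rule sweedler.sw_linear[OF sweedler])

lemma form_sw_right: "\<lbrakk>x \<in> carrier H; bform x e \<beta>\<rbrakk> \<Longrightarrow> form x (sw x e \<beta>)"
  using form_sw[of x e \<beta>] by simp

lemma sw_closed:
  "\<lbrakk>x \<in> carrier H; y \<in> carrier H; bform x y \<beta>; a \<in> carrier (A (x \<cdot> y))\<rbrakk> \<Longrightarrow> sw x y \<beta> a \<in> carrier K"
  by (rule sweedler.sw_closed[OF sweedler])

lemmas sw_cong = sweedler.sw_cong[OF sweedler]
lemmas sw_cmult = sweedler.sw_cmult[OF sweedler]

lemma sw_cmult_right: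
  assumes xy: "x \<in> carrier H" "y \<in> carrier H" and a: "a \<in> carrier (A (x \<cdot> y))" and d: "d \<in> carrier K"
    and \<beta>: "bform x y \<beta>"
  shows "sw x y (\<lambda>p q. \<beta> p q \<otimes> d) a = sw x y \<beta> a \<otimes> d"
proof -
  have "sw x y (\<lambda>p q. \<beta> p q \<otimes> d) a = sw x y (\<lambda>p q. d \<otimes> \<beta> p q) a"
  proof (rule sw_cong[OF xy a])
    show "bform x y (\<lambda>p q. \<beta> p q \<otimes> d)"
      by (intro bilinearI K.linear_form_multc d) (auto dest: bilinear_formD[OF \<beta>])
  qed (use d bilinear_formD(3)[OF \<beta>] in \<open>auto simp: K.m_comm\<close>)
  then show ?thesis
    using sw_cmult[OF xy a d \<beta>] sw_closed[OF xy \<beta> a] d by (simp add: K.m_comm)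
qed

lemma form_tensor: "\<lbrakk>form x f; form y g\<rbrakk> \<Longrightarrow> bform x y (\<lambda>p q. f p \<otimes> g q)"
  by (intro bilinearI K.linear_form_cmult K.linear_form_multc) (auto dest: form_closed)

text \<open>The integral equation in \<open>A x\<close>, tested against every form on
  \<open>A x\<close>. Invariance under the action of E is deduced from it.\<close>

definition left_integral_family :: "('h \<Rightarrow> 'a \<Rightarrow> 'k) \<Rightarrow> bool"
  where "left_integral_family l \<longleftrightarrow> (\<forall>x\<in>carrier H. form x (l x)) \<and>
    (\<forall>x\<in>carrier H. \<forall>y\<in>carrier H. \<forall>a\<in>carrier (A (x \<cdot> y)). \<forall>f. form x f \<longrightarrow>
      sw x y (\<lambda>p q. f p \<otimes> l y q) a = f \<one>\<^bsub>A x\<^esub> \<otimes> l (x \<cdot> y) a)"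

lemma left_integral_familyD:
  assumes "left_integral_family l" "x \<in> carrier H"
  shows "form x (l x)" "\<lbrakk>y \<in> carrier H; a \<in> carrier (A (x \<cdot> y)); form x f\<rbrakk> \<Longrightarrow>
    sw x y (\<lambda>p q. f p \<otimes> l y q) a = f \<one>\<^bsub>A x\<^esub> \<otimes> l (x \<cdot> y) a"
  using assms by (auto simp: left_integral_family_def)

text \<open>The antipode axiom at the unit of \<open>A e\<close>, whose coproduct is 1 \<otimes> 1,
  reads S(1) 1 = 1.\<close>

lemma antipode_one:
  assumes x: "x \<in> carrier H"
    and f: "form x f"
  shows "f (S x \<one>\<^bsub>A (inv\<^bsub>H\<^esub> x)\<^esub>) = f \<one>\<^bsub>A x\<^esub>"
proof -
  note intros = bilinearI module_hom_comp[OF _ f] lin_mult_left lin_mult_right lin_id antipode_linear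
  note closed = S_closed
  have b: "bform (inv\<^bsub>H\<^esub> x) x (\<lambda>p q. f (S x p \<otimes>\<^bsub>A x\<^esub> q))"
    using x by (intro intros closed) ((assumption | simp)+)?
  have "sw (inv\<^bsub>H\<^esub> x) x (\<lambda>p q. f (S x p \<otimes>\<^bsub>A x\<^esub> q)) \<one>\<^bsub>A e\<^esub> = f (S x \<one>\<^bsub>A (inv\<^bsub>H\<^esub> x)\<^esub> \<otimes>\<^bsub>A x\<^esub> \<one>\<^bsub>A x\<^esub>)"
    using sw_one[OF _ x b] x by simp
  moreover have "S x \<one>\<^bsub>A (inv\<^bsub>H\<^esub> x)\<^esub> \<otimes>\<^bsub>A x\<^esub> \<one>\<^bsub>A x\<^esub> = S x \<one>\<^bsub>A (inv\<^bsub>H\<^esub> x)\<^esub>"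
    using x by (intro monoid.r_one ring.is_monoid algebra_ring S_closed) simp_all
  ultimately show ?thesis
    using sw_antipode_left[OF x f, of "\<one>\<^bsub>A e\<^esub>"] form_closed[OF f, of "\<one>\<^bsub>A x\<^esub>"] x by (simp add: counit_one)
qed

text \<open>A normalized form takes the value one at the image of the unit under S, while linearity
  of S would force zero if that unit were zero.\<close>

lemma nontrivial_inv:
  assumes x: "x \<in> carrier H" and n: "\<one>\<^bsub>A x\<^esub> \<noteq> \<zero>\<^bsub>A x\<^esub>"
  shows "\<one>\<^bsub>A (inv\<^bsub>H\<^esub> x)\<^esub> \<noteq> \<zero>\<^bsub>A (inv\<^bsub>H\<^esub> x)\<^esub>"
proof
  assume z: "\<one>\<^bsub>A (inv\<^bsub>H\<^esub> x)\<^esub> = \<zero>\<^bsub>A (inv\<^bsub>H\<^esub> x)\<^esub>"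
  obtain f where f: "form x f" "f \<one>\<^bsub>A x\<^esub> = \<one>"
    using ex_normalized[OF x n] by blast
  have "form (inv\<^bsub>H\<^esub> x) (\<lambda>a. f (S x a))"
    by (rule module_hom_comp[OF antipode_linear[OF x] f(1)])
  then have "f (S x \<zero>\<^bsub>A (inv\<^bsub>H\<^esub> x)\<^esub>) = \<zero>"
    using form_zero[of "inv\<^bsub>H\<^esub> x" "\<lambda>a. f (S x a)"] x by simp
  then show False
    using antipode_one[OF x f(1)] z f(2) by simp
qed

text \<open>The coproduct of the unit is 1 \<otimes> 1, where f \<otimes> g has value one; at the
  coproduct of zero it vanishes.\<close>

lemma nontrivial_mult:
  assumes x: "x \<in> carrier H" "\<one>\<^bsub>A x\<^esub> \<noteq> \<zero>\<^bsub>A x\<^esub>" and y: "y \<in> carrier H" "\<one>\<^bsub>A y\<^esub> \<noteq> \<zero>\<^bsub>A y\<^esub>"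
  shows "\<one>\<^bsub>A (x \<cdot> y)\<^esub> \<noteq> \<zero>\<^bsub>A (x \<cdot> y)\<^esub>"
proof
  assume z: "\<one>\<^bsub>A (x \<cdot> y)\<^esub> = \<zero>\<^bsub>A (x \<cdot> y)\<^esub>"
  obtain f g where f: "form x f" "f \<one>\<^bsub>A x\<^esub> = \<one>" and g: "form y g" "g \<one>\<^bsub>A y\<^esub> = \<one>"
    using ex_normalized[OF x] ex_normalized[OF y] by blast
  have "sw x y (\<lambda>p q. f p \<otimes> g q) \<one>\<^bsub>A (x \<cdot> y)\<^esub> = \<one>"
    using sw_one[OF x(1) y(1) form_tensor[OF f(1) g(1)]] f g by simp
  moreover have "sw x y (\<lambda>p q. f p \<otimes> g q) \<zero>\<^bsub>A (x \<cdot> y)\<^esub> = \<zero>"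
    using x y by (intro form_zero form_sw form_tensor f g) auto
  ultimately show False
    using z by simp
qed

text \<open>The member at e determines the family: the integral equation for (x, e), paired with a
  form of value one at the unit, expresses the member at x through that at e. For existence the same
  expression serves as the definition.\<close>

theorem left_integral_family_unique:
  "\<exists>l. left_integral_family l \<and> (\<exists>a\<in>carrier (A e). l e a \<noteq> \<zero>) \<and>
    (\<forall>l'. left_integral_family l' \<longrightarrow>
      (\<exists>c\<in>carrier K. \<forall>x\<in>carrier H. \<forall>a\<in>carrier (A x). l' x a = c \<otimes> l x a))"
proof -
  obtain I v where "dual_basis K (A e) I v"
    using ex_dual_basis by blast
  note I = dual_basisD[OF this]
  \<comment> \<open>At the unit of H the grading collapses, since e e = e and the inverse of e is
    e.\<close>
  interpret A1: hopf K "A e" "sw e e" \<epsilon> "S e" I v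
  proof (intro hopf.intro hopf_axioms.intro)
    show "field K" ..
    show "assoc_algebra K (A e)"
      by (rule algebra) simp
    show "sweedler K (A e) (A e) (A e) (sw e e)"
      using sweedler[of e e] by simp
    show "S e \<in> module_hom K (A e) (A e)"
      using antipode_linear[of e] by simp
    fix f a assume "form e f" "a \<in> carrier (A e)"
    then show "sw e e (\<lambda>p q. f (S e p \<otimes>\<^bsub>A e\<^esub> q)) a = \<epsilon> a \<otimes> f \<one>\<^bsub>A e\<^esub>"
      and "sw e e (\<lambda>p q. f (p \<otimes>\<^bsub>A e\<^esub> S e q)) a = \<epsilon> a \<otimes> f \<one>\<^bsub>A e\<^esub>"
      using sw_antipode_left[of e f a] sw_antipode_right[of e f a] by simp_all
  next
    show "sw e e \<beta> (a \<otimes>\<^bsub>A e\<^esub> b) = sw e e (\<lambda>p q. sw e e (\<lambda>r s. \<beta> (p \<otimes>\<^bsub>A e\<^esub> r) (q \<otimes>\<^bsub>A e\<^esub> s)) b) a"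
      if "bform e e \<beta>" "a \<in> carrier (A e)" "b \<in> carrier (A e)" for \<beta> a b
      using sw_mult[of e e \<beta> a b] that by simp
    show "sw e e \<beta> \<one>\<^bsub>A e\<^esub> = \<beta> \<one>\<^bsub>A e\<^esub> \<one>\<^bsub>A e\<^esub>" if "bform e e \<beta>" for \<beta>
      using sw_one[of e e \<beta>] that by simp
    show "sw e e (\<lambda>t r. sw e e (\<lambda>p q. \<gamma> p q r) t) a = sw e e (\<lambda>p t. sw e e (\<gamma> p) t) a"
      if "trilinear_form K (A e) (A e) (A e) \<gamma>" "a \<in> carrier (A e)" for \<gamma> a
      using sw_assoc[of e e e \<gamma> a] that by simp
    show "(\<Oplus>i\<in>I. v i a \<otimes> f i) = f a" if "form e f" "a \<in> carrier (A e)" for f a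
      by (rule I(5)[OF that])
  qed (simp_all add: I(1-4) counit_form counit_one counit_mult sw_counit_left sw_counit_right)
  obtain V where V: "A1.left_integral V" and V0: "\<exists>a\<in>carrier (A e). V a \<noteq> \<zero>"
    and V1: "\<And>U. A1.left_integral U \<Longrightarrow> \<exists>c\<in>carrier K. \<forall>a\<in>carrier (A e). U a = c \<otimes> V a"
    using A1.left_integral_unique by blast
  note V' = A1.left_integralD(1)[OF V]
  \<comment> \<open>On a zero algebra no form takes the value one at the unit, so the zero form is
    the default; it keeps \<open>f x\<close> linear for every x.\<close>
  define f where "f x = (if \<one>\<^bsub>A x\<^esub> = \<zero>\<^bsub>A x\<^esub> then (\<lambda>a. \<zero>)
    else (SOME f. form x f \<and> f \<one>\<^bsub>A x\<^esub> = \<one>))" for x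
  have f: "form x (f x)" if "x \<in> carrier H" for x
  proof (cases "\<one>\<^bsub>A x\<^esub> = \<zero>\<^bsub>A x\<^esub>")
    case True
    then show ?thesis
      by (auto simp: f_def intro!: linear_formI)
  next
    case False
    then show ?thesis
      using someI_ex[OF ex_normalized[OF that False]] by (simp add: f_def)
  qed
  have f1: "f x \<one>\<^bsub>A x\<^esub> = \<one>" if "x \<in> carrier H" "\<one>\<^bsub>A x\<^esub> \<noteq> \<zero>\<^bsub>A x\<^esub>" for x
    using someI_ex[OF ex_normalized[OF that]] that by (simp add: f_def)
  define l where "l x = sw x e (\<lambda>p q. f x p \<otimes> V q)" for x
  have l: "form x (l x)" if "x \<in> carrier H" for x
    unfolding l_def using that by (intro form_sw_right form_tensor f V')
  \<comment> \<open>The element a_1 V(a_2) of \<open>A x\<close> is the scalar \<open>l x a\<close>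
    times the unit, tested against g. In particular \<open>l x\<close> does not depend on the
    normalized form chosen in its definition.\<close>
  have key: "sw x e (\<lambda>p q. g p \<otimes> V q) a = g \<one>\<^bsub>A x\<^esub> \<otimes> l x a"
    if x: "x \<in> carrier H" and g: "form x g" and a: "a \<in> carrier (A x)" for x g a
  proof (cases "\<one>\<^bsub>A x\<^esub> = \<zero>\<^bsub>A x\<^esub>")
    case True
    have "form x (sw x e (\<lambda>p q. g p \<otimes> V q))"
      by (intro form_sw_right x form_tensor g V')
    then have "sw x e (\<lambda>p q. g p \<otimes> V q) \<zero>\<^bsub>A x\<^esub> = \<zero>"
      by (rule form_zero[OF x])
    then show ?thesis
      using trivial_algebra[OF x True a] form_zero[OF x l[OF x]] form_closed[OF g, of "\<one>\<^bsub>A x\<^esub>"] x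
      by simp
  next
    case False
    let ?i = "inv\<^bsub>H\<^esub> x"
    have i: "?i \<in> carrier H"
      using x by simp
    have a': "a \<in> carrier (A (x \<cdot> e))"
      using a x by simp
    have eH: "e \<in> carrier H"
      by simp
    note intros = bilinearI trilinear_formI K.linear_form_cmult K.linear_form_multc form_sw_param
      module_hom_comp[OF _ f[OF x]] module_hom_comp[OF _ g] f[OF x] V'
      lin_mult_left lin_mult_right lin_id antipode_linear
    note closed = K.m_closed S_closed mult_closed form_closed[OF g] form_closed[OF f[OF x]] form_closed[OF V']
    \<comment> \<open>The form g \<otimes> f evaluated at p S(t_1) \<otimes> t_2. It has two
      readings: on the coproduct of b it gives g(1) f(b), on b \<otimes> 1 it gives g(b). Comparing
      them yields the claim.\<close>
    let ?\<beta> = "\<lambda>p t. sw ?i x (\<lambda>q r. g (p \<otimes>\<^bsub>A x\<^esub> S x q) \<otimes> f x r) t"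
    have \<beta>i: "bform ?i x (\<lambda>q r. g (p \<otimes>\<^bsub>A x\<^esub> S x q) \<otimes> f x r)" if "p \<in> carrier (A x)" for p
      using x i that by (intro intros closed) ((assumption | simp)+)?
    have \<beta>t: "form e (?\<beta> p)" if "p \<in> carrier (A x)" for p
      using form_sw[OF i x \<beta>i[OF that]] x by simp
    have \<beta>p: "form x (\<lambda>p. ?\<beta> p t)" if "t \<in> carrier (A e)" for t
    proof (rule form_sw_param[OF i x x _ \<beta>i])
      show "t \<in> carrier (A (?i \<cdot> x))"
        using that x by simp
      show "form x (\<lambda>w. g (w \<otimes>\<^bsub>A x\<^esub> S x p) \<otimes> f x q)" if "p \<in> carrier (A ?i)" "q \<in> carrier (A x)" for p q
        using x i that by (intro intros closed) ((assumption | simp)+)?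
    qed
    have \<beta>: "bform x e ?\<beta>"
      by (intro bilinearI \<beta>t \<beta>p)
    have G: "sw x e ?\<beta> b = g \<one>\<^bsub>A x\<^esub> \<otimes> f x b" if b: "b \<in> carrier (A x)" for b
    proof -
      have b': "b \<in> carrier (A (x \<cdot> ?i \<cdot> x))" "b \<in> carrier (A (e \<cdot> x))"
        using b x by simp_all
      have t: "trilinear_form K (A x) (A ?i) (A x) (\<lambda>p q r. g (p \<otimes>\<^bsub>A x\<^esub> S x q) \<otimes> f x r)"
        using x i by (intro intros closed) ((assumption | simp)+)?
      have "sw x e ?\<beta> b = sw e x (\<lambda>t r. sw x ?i (\<lambda>p q. g (p \<otimes>\<^bsub>A x\<^esub> S x q) \<otimes> f x r) t) b"
        using sw_assoc[OF x i x t b'(1)] x by simp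
      also have "\<dots> = sw e x (\<lambda>t r. \<epsilon> t \<otimes> (g \<one>\<^bsub>A x\<^esub> \<otimes> f x r)) b"
      proof (rule sw_cong[OF _ x b'(2), symmetric])
        show "bform e x (\<lambda>t r. \<epsilon> t \<otimes> (g \<one>\<^bsub>A x\<^esub> \<otimes> f x r))"
          using x by (intro form_tensor counit_form K.linear_form_cmult f form_closed[OF g]) simp_all
        fix t r assume t: "t \<in> carrier (A e)" and r: "r \<in> carrier (A x)"
        have "form x (\<lambda>w. g w \<otimes> f x r)"
          using r by (intro K.linear_form_multc g form_closed[OF f[OF x]])
        then show "\<epsilon> t \<otimes> (g \<one>\<^bsub>A x\<^esub> \<otimes> f x r) = sw x ?i (\<lambda>p q. g (p \<otimes>\<^bsub>A x\<^esub> S x q) \<otimes> f x r) t"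
          by (rule sw_antipode_right[OF x _ t, symmetric])
      qed simp
      also have "\<dots> = g \<one>\<^bsub>A x\<^esub> \<otimes> f x b"
        using x by (intro sw_counit_left x b K.linear_form_cmult f form_closed[OF g]) simp_all
      finally show ?thesis .
    qed
    have tri: "trilinear_form K (A x) (A e) (A e) (\<lambda>p t s. ?\<beta> p t \<otimes> V s)"
      by (intro trilinear_formI K.linear_form_cmult K.linear_form_multc V' \<beta>t \<beta>p form_closed[OF V'] form_closed[OF \<beta>t])
        assumption+
    have "g \<one>\<^bsub>A x\<^esub> \<otimes> l x a = sw x e (\<lambda>b s. g \<one>\<^bsub>A x\<^esub> \<otimes> (f x b \<otimes> V s)) a"
      unfolding l_def
      by (rule sw_cmult[OF x eH a' _ form_tensor[OF f[OF x] V'], symmetric]) (use form_closed[OF g] x in simp)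
    also have "\<dots> = sw x e (\<lambda>b s. sw x e (\<lambda>p t. ?\<beta> p t \<otimes> V s) b) a"
    proof (rule sw_cong[OF x eH a'])
      show "bform x e (\<lambda>b s. g \<one>\<^bsub>A x\<^esub> \<otimes> (f x b \<otimes> V s))"
        using x eH by (intro intros closed) ((assumption | simp)+)?
      fix b s assume b: "b \<in> carrier (A x)" and s: "s \<in> carrier (A e)"
      have "sw x e (\<lambda>p t. ?\<beta> p t \<otimes> V s) b = sw x e ?\<beta> b \<otimes> V s"
        using b x form_closed[OF V' s] by (intro sw_cmult_right x eH \<beta>) simp_all
      then show "g \<one>\<^bsub>A x\<^esub> \<otimes> (f x b \<otimes> V s) = sw x e (\<lambda>p t. ?\<beta> p t \<otimes> V s) b"
        using b s x form_closed[OF V'] form_closed[OF f[OF x]] form_closed[OF g] by (simp add: G K.m_assoc)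
    qed
    also have "\<dots> = sw x e (\<lambda>p u. sw e e (\<lambda>t s. ?\<beta> p t \<otimes> V s) u) a"
      using sw_assoc[OF x eH eH tri] a x by simp
    \<comment> \<open>V is an integral on \<open>A e\<close>, so the sum over u contributes V(u)
      times the value of \<open>?\<beta> p\<close> at the unit, and that value is g(p) because f is
      normalized.\<close>
    also have "\<dots> = sw x e (\<lambda>p u. g p \<otimes> V u) a"
    proof (rule sw_cong[OF x eH a', symmetric])
      show "bform x e (\<lambda>p u. g p \<otimes> V u)"
        by (rule form_tensor[OF g V'])
      fix p u assume p: "p \<in> carrier (A x)" and u: "u \<in> carrier (A e)"
      have "form x (\<lambda>w. g (p \<otimes>\<^bsub>A x\<^esub> w))"
        by (rule module_hom_comp[OF lin_mult_left[OF x p lin_id] g])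
      then have "g (p \<otimes>\<^bsub>A x\<^esub> S x \<one>\<^bsub>A ?i\<^esub>) = g (p \<otimes>\<^bsub>A x\<^esub> \<one>\<^bsub>A x\<^esub>)"
        using antipode_one[OF x, of "\<lambda>w. g (p \<otimes>\<^bsub>A x\<^esub> w)"] by simp
      also have "p \<otimes>\<^bsub>A x\<^esub> \<one>\<^bsub>A x\<^esub> = p"
        using p algebra_ring[OF x] by (simp add: monoid.r_one ring.is_monoid)
      finally have "?\<beta> p \<one>\<^bsub>A e\<^esub> = g p"
        using sw_one[OF i x \<beta>i[OF p]] f1[OF x False] x form_closed[OF g p] by simp
      then show "g p \<otimes> V u = sw e e (\<lambda>t s. ?\<beta> p t \<otimes> V s) u"
        using A1.left_integralD(2)[OF V \<beta>t[OF p] u] by simp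
    qed
    finally show ?thesis
      by simp
  qed
  have l_trivial: "l x a = \<zero>" if "x \<in> carrier H" "\<one>\<^bsub>A x\<^esub> = \<zero>\<^bsub>A x\<^esub>" "a \<in> carrier (A x)" for x a
    using trivial_algebra[OF that] form_zero[OF that(1) l[OF that(1)]] by simp
  have "left_integral_family l"
    unfolding left_integral_family_def
  proof (intro conjI ballI allI impI)
    show "form x (l x)" if "x \<in> carrier H" for x
      by (rule l[OF that])
    fix x y a g
    assume x: "x \<in> carrier H" and y: "y \<in> carrier H" and a: "a \<in> carrier (A (x \<cdot> y))" and g: "form x g"
    have xy: "x \<cdot> y \<in> carrier H" and eH: "e \<in> carrier H"
      using x y by simp_all
    have bl: "bform x y (\<lambda>p q. g p \<otimes> l y q)"
      by (rule form_tensor[OF g l[OF y]])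
    show "sw x y (\<lambda>p q. g p \<otimes> l y q) a = g \<one>\<^bsub>A x\<^esub> \<otimes> l (x \<cdot> y) a"
    \<comment> \<open>If \<open>A y\<close> is zero, then so is \<open>l y\<close>, and the right
      side has to vanish as well. Either \<open>A x\<close> is zero and g(1) = 0, or x lies in the
      subgroup of indices with nonzero algebra; since y = \<open>inv x (x y)\<close> does not,
      neither does x y.\<close>
    proof (cases "\<one>\<^bsub>A y\<^esub> = \<zero>\<^bsub>A y\<^esub>")
      case True
      have "sw x y (\<lambda>p q. g p \<otimes> l y q) a = sw x y (\<lambda>p q. \<zero> \<otimes> (g p \<otimes> l y q)) a"
        by (rule sw_cong[OF x y a bl]) (simp add: l_trivial[OF y True] form_closed[OF g])
      also have "\<dots> = \<zero>"
        using sw_cmult[OF x y a _ bl, of \<zero>] sw_closed[OF x y bl a] by simp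
      also have "\<zero> = g \<one>\<^bsub>A x\<^esub> \<otimes> l (x \<cdot> y) a"
      proof (cases "\<one>\<^bsub>A x\<^esub> = \<zero>\<^bsub>A x\<^esub>")
        case True
        then show ?thesis
          using form_zero[OF x g] form_closed[OF l[OF xy] a] by simp
      next
        case False
        have "inv\<^bsub>H\<^esub> x \<cdot> (x \<cdot> y) = y"
          using x y by (simp add: H.m_assoc[symmetric])
        then have "\<one>\<^bsub>A (x \<cdot> y)\<^esub> = \<zero>\<^bsub>A (x \<cdot> y)\<^esub>"
          using nontrivial_mult[of "inv\<^bsub>H\<^esub> x" "x \<cdot> y"] nontrivial_inv[OF x False] \<open>\<one>\<^bsub>A y\<^esub> = \<zero>\<^bsub>A y\<^esub>\<close> x xy by auto
        then show ?thesis
          using l_trivial[OF xy _ a] form_closed[OF g, of "\<one>\<^bsub>A x\<^esub>"] x by simp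
      qed
      finally show ?thesis .
    next
      case False
      have q': "q \<in> carrier (A (y \<cdot> e))" if "q \<in> carrier (A y)" for q
        using that y by simp
      have a': "a \<in> carrier (A (x \<cdot> y \<cdot> e))"
        using a xy by simp
      have tri: "trilinear_form K (A x) (A y) (A e) (\<lambda>p r s. g p \<otimes> f y r \<otimes> V s)"
        by (intro trilinear_formI K.linear_form_cmult K.linear_form_multc V' f y g K.m_closed
            form_closed[OF V'] form_closed[OF g] form_closed[OF f[OF y]]) assumption+
      have "sw x y (\<lambda>p q. g p \<otimes> l y q) a = sw x y (\<lambda>p q. sw y e (\<lambda>r s. g p \<otimes> f y r \<otimes> V s) q) a"
      proof (rule sw_cong[OF x y a bl])
        fix p q assume p: "p \<in> carrier (A x)" and q: "q \<in> carrier (A y)"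
        have "g p \<otimes> l y q = sw y e (\<lambda>r s. g p \<otimes> (f y r \<otimes> V s)) q"
          unfolding l_def
          by (rule sw_cmult[OF y eH q'[OF q] form_closed[OF g p] form_tensor[OF f[OF y] V'], symmetric])
        also have "\<dots> = sw y e (\<lambda>r s. g p \<otimes> f y r \<otimes> V s) q"
        proof (rule sw_cong[OF y eH q'[OF q]])
          show "bform y e (\<lambda>r s. g p \<otimes> (f y r \<otimes> V s))"
            using p by (intro bilinearI K.linear_form_cmult K.linear_form_multc V' f y K.m_closed
                form_closed[OF V'] form_closed[OF g] form_closed[OF f[OF y]])
        qed (use p form_closed[OF V'] form_closed[OF g] form_closed[OF f[OF y]] in \<open>simp add: K.m_assoc\<close>)
        finally show "g p \<otimes> l y q = sw y e (\<lambda>r s. g p \<otimes> f y r \<otimes> V s) q" .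
      qed
      also have "\<dots> = sw (x \<cdot> y) e (\<lambda>t s. sw x y (\<lambda>p r. g p \<otimes> f y r \<otimes> V s) t) a"
        using sw_assoc[OF x y eH tri a'] y by simp
      also have "\<dots> = sw (x \<cdot> y) e (\<lambda>t s. sw x y (\<lambda>p r. g p \<otimes> f y r) t \<otimes> V s) a"
      proof (rule sw_cong[OF xy eH, symmetric])
        show "a \<in> carrier (A (x \<cdot> y \<cdot> e))"
          by (rule a')
        show "bform (x \<cdot> y) e (\<lambda>t s. sw x y (\<lambda>p r. g p \<otimes> f y r) t \<otimes> V s)"
          by (intro form_tensor form_sw x y V' g f)
        fix t s assume t: "t \<in> carrier (A (x \<cdot> y))" and s: "s \<in> carrier (A e)"
        show "sw x y (\<lambda>p r. g p \<otimes> f y r) t \<otimes> V s = sw x y (\<lambda>p r. g p \<otimes> f y r \<otimes> V s) t"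
          by (rule sw_cmult_right[OF x y t form_closed[OF V' s] form_tensor[OF g f[OF y]], symmetric])
      qed
      \<comment> \<open>\<open>key\<close> applied to the form (g \<otimes> f_y)\<Delta> on
        \<open>A (x \<cdot> y)\<close>; its value at the unit is g(1), as f_y is normalized.\<close>
      also have "\<dots> = sw x y (\<lambda>p r. g p \<otimes> f y r) \<one>\<^bsub>A (x \<cdot> y)\<^esub> \<otimes> l (x \<cdot> y) a"
        by (rule key[OF xy form_sw[OF x y form_tensor[OF g f[OF y]]] a])
      also have "sw x y (\<lambda>p r. g p \<otimes> f y r) \<one>\<^bsub>A (x \<cdot> y)\<^esub> = g \<one>\<^bsub>A x\<^esub>"
        using sw_one[OF x y form_tensor[OF g f[OF y]]] f1[OF y False] form_closed[OF g, of "\<one>\<^bsub>A x\<^esub>"] x by simp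
      finally show ?thesis .
    qed
  qed
  \<comment> \<open>Take g = \<epsilon> in \<open>key\<close>: it has value one at the unit, and the
    counit axiom removes it from the left side.\<close>
  moreover have "l e a = V a" if a: "a \<in> carrier (A e)" for a
    using key[OF _ counit_form a] sw_counit_left[OF _ V' a] form_closed[OF l a] by (simp add: counit_one)
  then have "\<exists>a\<in>carrier (A e). l e a \<noteq> \<zero>"
    using V0 by auto
  moreover have "\<exists>c\<in>carrier K. \<forall>x\<in>carrier H. \<forall>a\<in>carrier (A x). l' x a = c \<otimes> l x a"
    if l': "left_integral_family l'" for l'
  proof -
    have "A1.left_integral (l' e)"
      unfolding A1.left_integral_def
      using left_integral_familyD(1)[OF l', of e] left_integral_familyD(2)[OF l', of e e] by simp
    then obtain c where c: "c \<in> carrier K" "\<And>a. a \<in> carrier (A e) \<Longrightarrow> l' e a = c \<otimes> V a"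
      using V1 by blast
    have "l' x a = c \<otimes> l x a" if x: "x \<in> carrier H" and a: "a \<in> carrier (A x)" for x a
    proof (cases "\<one>\<^bsub>A x\<^esub> = \<zero>\<^bsub>A x\<^esub>")
      case True
      then show ?thesis
        using trivial_algebra[OF x True a] form_zero[OF x left_integral_familyD(1)[OF l' x]] l_trivial[OF x True a] c by simp
    next
      case False
      have eH: "e \<in> carrier H" and a': "a \<in> carrier (A (x \<cdot> e))"
        using x a by simp_all
      have "l' x a = sw x e (\<lambda>p q. f x p \<otimes> l' e q) a"
        using left_integral_familyD(2)[OF l' x eH a' f[OF x]] f1[OF x False] x
          form_closed[OF left_integral_familyD(1)[OF l' x] a] by simp
      also have "\<dots> = sw x e (\<lambda>p q. c \<otimes> (f x p \<otimes> V q)) a"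
      proof (rule sw_cong[OF x eH a'])
        show "bform x e (\<lambda>p q. f x p \<otimes> l' e q)"
          by (rule form_tensor[OF f[OF x] left_integral_familyD(1)[OF l' eH]])
      qed (simp add: c form_closed[OF f[OF x]] form_closed[OF V'] K.m_lcomm)
      also have "\<dots> = c \<otimes> l x a"
        unfolding l_def by (rule sw_cmult[OF x eH a' c(1) form_tensor[OF f[OF x] V']])
      finally show ?thesis .
    qed
    then show ?thesis
      using c(1) by blast
  qed
  ultimately show ?thesis
    by blast
qed

text \<open>Pair the integral equation for (z, e) at \<phi>(a) with a normalized form f. By
  \<open>compat\<close> it becomes the equation for (x, e) at a with the form f after \<phi>, which
  is again normalized as \<phi> preserves the unit. In the degenerate case both algebras are
  zero.\<close>

lemma left_integral_family_invariant:
  assumes l: "left_integral_family l" and x: "x \<in> carrier H" and z: "z \<in> carrier H"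
    and \<phi>: "\<phi> \<in> module_hom K (A x) (A z)" and \<phi>1: "\<phi> \<one>\<^bsub>A x\<^esub> = \<one>\<^bsub>A z\<^esub>"
    and compat: "\<And>\<beta> a. \<lbrakk>bform z e \<beta>; a \<in> carrier (A x)\<rbrakk> \<Longrightarrow> sw z e \<beta> (\<phi> a) = sw x e (\<lambda>p q. \<beta> (\<phi> p) q) a"
    and trivial: "\<one>\<^bsub>A z\<^esub> = \<zero>\<^bsub>A z\<^esub> \<Longrightarrow> \<one>\<^bsub>A x\<^esub> = \<zero>\<^bsub>A x\<^esub>"
    and a: "a \<in> carrier (A x)"
  shows "l z (\<phi> a) = l x a"
proof (cases "\<one>\<^bsub>A z\<^esub> = \<zero>\<^bsub>A z\<^esub>")
  case True
  have "\<phi> a = \<zero>\<^bsub>A z\<^esub>" "a = \<zero>\<^bsub>A x\<^esub>"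
    using trivial_algebra[OF z True module_hom_carrier[OF \<phi> a]] trivial_algebra[OF x trivial[OF True] a] .
  then show ?thesis
    using form_zero[OF z left_integral_familyD(1)[OF l z]] form_zero[OF x left_integral_familyD(1)[OF l x]] by simp
next
  case False
  obtain f where f: "form z f" "f \<one>\<^bsub>A z\<^esub> = \<one>"
    using ex_normalized[OF z False] by blast
  have eH: "e \<in> carrier H"
    by simp
  note l' = left_integral_familyD[OF l]
  have fa: "\<phi> a \<in> carrier (A (z \<cdot> e))" "a \<in> carrier (A (x \<cdot> e))"
    using module_hom_carrier[OF \<phi> a] a x z by simp_all
  have "l z (\<phi> a) = sw z e (\<lambda>p q. f p \<otimes> l e q) (\<phi> a)"
    using l'(2)[OF z eH fa(1) f(1)] f(2) z form_closed[OF l'(1)[OF z] module_hom_carrier[OF \<phi> a]] by simp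
  also have "\<dots> = sw x e (\<lambda>p q. f (\<phi> p) \<otimes> l e q) a"
    by (rule compat[OF form_tensor[OF f(1) l'(1)[OF eH]] a])
  also have "\<dots> = l x a"
    using l'(2)[OF x eH fa(2) module_hom_comp[OF \<phi> f(1)]] \<phi>1 f(2) x form_closed[OF l'(1)[OF x] a] by simp
  finally show ?thesis .
qed

end


section \<open>Opposites and dual bases\<close>

lemma bilinear_flip: "bilinear K A B W \<beta> \<Longrightarrow> bilinear K B A W (\<lambda>b a. \<beta> a b)"
  by (auto simp: bilinear_def)

text \<open>Linear notions do not read the field \<open>mult\<close>, so these rules strip opposite
  products from every statement about forms.\<close>

lemma module_hom_flip_mult [simp]:
  "module_hom K (A\<lparr>mult := m\<rparr>) W = module_hom K A W" "module_hom K W (A\<lparr>mult := m\<rparr>) = module_hom K W A"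
  by (simp_all add: module_hom_def)

lemma bilinear_flip_mult [simp]:
  "bilinear K (A\<lparr>mult := m\<rparr>) B W \<beta> = bilinear K A B W \<beta>"
  "bilinear K A (B\<lparr>mult := n\<rparr>) W \<beta> = bilinear K A B W \<beta>"
  by (simp_all add: bilinear_def)

lemma trilinear_flip_mult [simp]:
  "trilinear_form K (A\<lparr>mult := m\<rparr>) (B\<lparr>mult := n\<rparr>) (C\<lparr>mult := k\<rparr>) \<gamma> = trilinear_form K A B C \<gamma>"
  by (simp add: trilinear_form_def)

lemma trilinear_flip:
  assumes "trilinear_form K A B C \<gamma>"
  shows "trilinear_form K C B A (\<lambda>c b a. \<gamma> a b c)"
proof (rule trilinear_formI)
  fix c b assume "c \<in> carrier C" "b \<in> carrier B"
  then show "linear_form K A (\<lambda>a. \<gamma> a b c)"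
    using assms by (simp add: trilinear_form_def)
next
  fix c a assume "c \<in> carrier C" "a \<in> carrier A"
  then show "linear_form K B (\<lambda>b. \<gamma> a b c)"
    using assms bilinear_formD(2) by (force simp: trilinear_form_def)
next
  fix b a assume "b \<in> carrier B" "a \<in> carrier A"
  then show "linear_form K C (\<lambda>c. \<gamma> a b c)"
    using assms bilinear_formD(1) by (force simp: trilinear_form_def)
qed

lemma dual_basis_flip_mult [simp]: "dual_basis K (A\<lparr>mult := m\<rparr>) I v = dual_basis K A I v"
  by (simp add: dual_basis_def)

lemma module_flip_mult:
  assumes "module K A"
  shows "module K (A\<lparr>mult := m\<rparr>)"
proof -
  interpret module K A by fact
  show ?thesis
  proof (rule moduleI)
    show "abelian_group (A\<lparr>mult := m\<rparr>)"
      by (rule abelian_groupI) (auto simp: M.a_ac intro: bexI[of _ "\<ominus>\<^bsub>A\<^esub> x" for x] M.l_neg)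
  qed (auto simp: R.is_cring smult_l_distr smult_r_distr smult_assoc1)
qed

lemma assoc_algebra_opposite:
  assumes "assoc_algebra K A"
  shows "assoc_algebra K (A\<lparr>mult := \<lambda>a b. b \<otimes>\<^bsub>A\<^esub> a\<rparr>)"
proof -
  interpret assoc_algebra K A by fact
  interpret r: ring A by (rule ring)
  have m: "module K (A\<lparr>mult := \<lambda>a b. b \<otimes>\<^bsub>A\<^esub> a\<rparr>)"
    by (rule module_flip_mult) (rule module_axioms)
  show ?thesis
  proof (intro assoc_algebra.intro vectorspace.intro m assoc_algebra_axioms.intro)
    show "field K" ..
    show "ring (A\<lparr>mult := \<lambda>a b. b \<otimes>\<^bsub>A\<^esub> a\<rparr>)"
    proof (rule ringI)
      show "abelian_group (A\<lparr>mult := \<lambda>a b. b \<otimes>\<^bsub>A\<^esub> a\<rparr>)"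
        using m by (rule module.axioms)
      show "Group.monoid (A\<lparr>mult := \<lambda>a b. b \<otimes>\<^bsub>A\<^esub> a\<rparr>)"
        by (rule monoidI) (auto simp: r.m_assoc)
    qed (auto simp: r.l_distr r.r_distr)
  qed (auto simp: smult_mult_left smult_mult_right)
qed

lemma (in group) opposite_group: "group (G\<lparr>mult := \<lambda>x y. y \<otimes> x\<rparr>)"
  by (rule groupI) (auto simp: m_assoc intro: bexI[of _ "inv x" for x])

lemma (in group) inv_opposite:
  assumes "x \<in> carrier G"
  shows "inv\<^bsub>G\<lparr>mult := \<lambda>x y. y \<otimes> x\<rparr>\<^esub> x = inv x"
  using group.inv_equality[OF opposite_group, of "inv x" x] assms by simp

lemma (in sweedler) flip: "sweedler K C B A (\<lambda>\<beta>. sw (\<lambda>p q. \<beta> q p))"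
proof
  show "linear_form K C (sw (\<lambda>p q. \<beta> q p))" if "bilinear_form K B A \<beta>" for \<beta>
    by (rule sw_linear[OF bilinear_flip[OF that]])
  fix c assume "c \<in> carrier C"
  then obtain P k where P: "represents c P k"
    using ex_represents by blast
  show "\<exists>P k. finite P \<and> P \<subseteq> carrier B \<times> carrier A \<and> k \<in> P \<rightarrow> carrier K \<and>
    (\<forall>\<beta>. bilinear_form K B A \<beta> \<longrightarrow> sw (\<lambda>p q. \<beta> q p) c = (\<Oplus>p\<in>P. k p \<otimes> \<beta> (fst p) (snd p)))"
  proof (intro exI conjI allI impI)
    show "finite (prod.swap ` P)"
      using representsD(1)[OF P] by simp
    show "prod.swap ` P \<subseteq> carrier B \<times> carrier A"
      using representsD(2)[OF P] by auto
    show "k \<circ> prod.swap \<in> prod.swap ` P \<rightarrow> carrier K"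
      using representsD(3)[OF P] by auto
    fix \<beta> assume \<beta>: "bilinear_form K B A \<beta>"
    have "sw (\<lambda>p q. \<beta> q p) c = (\<Oplus>p\<in>P. k p \<otimes> \<beta> (snd p) (fst p))"
      by (rule representsD(6)[OF P bilinear_flip[OF \<beta>]])
    also have "\<dots> = (\<Oplus>p\<in>prod.swap ` P. (k \<circ> prod.swap) p \<otimes> \<beta> (fst p) (snd p))"
      by (subst K.finsum_reindex)
        (use representsD(3-5)[OF P] bilinear_formD(3)[OF \<beta>] in \<open>auto simp: inj_on_def\<close>)
    finally show "sw (\<lambda>p q. \<beta> q p) c = (\<Oplus>p\<in>prod.swap ` P. (k \<circ> prod.swap) p \<otimes> \<beta> (fst p) (snd p))" .
  qed
qed

lemma sweedler_flip_mult:
  assumes "sweedler K C A B sw"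
  shows "sweedler K (C\<lparr>mult := l\<rparr>) (A\<lparr>mult := m\<rparr>) (B\<lparr>mult := n\<rparr>) sw"
proof -
  interpret sweedler K C A B sw by fact
  show ?thesis
    by (intro sweedler.intro sweedler_axioms.intro module_flip_mult field_axioms
        C.module_axioms A.module_axioms B.module_axioms) (simp add: sw_linear, use sw_rep in simp)
qed

context hopf_family
begin

text \<open>Reversing product and coproduct together interchanges the two antipode axioms, so S
  stays the antipode; reversing the coproduct alone would call for the inverse of S. The order of H
  is reversed because \<Delta>_(y,x) takes the place of \<Delta>_(x,y).\<close>

lemma opposite:
  "hopf_family K (H\<lparr>mult := \<lambda>x y. y \<cdot> x\<rparr>) (\<lambda>x. A x\<lparr>mult := \<lambda>a b. b \<otimes>\<^bsub>A x\<^esub> a\<rparr>)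
    (\<lambda>x y \<beta>. sw y x (\<lambda>p q. \<beta> q p)) \<epsilon> S"
  (is "hopf_family K ?H ?A ?sw \<epsilon> S")
proof (intro hopf_family.intro hopf_family_axioms.intro)
  show "field K" ..
  show "group ?H"
    by (rule H.opposite_group)
next
  fix x assume "x \<in> carrier ?H"
  then show "assoc_algebra K (?A x)"
    by (simp add: assoc_algebra_opposite algebra)
next
  fix x y assume "x \<in> carrier ?H" "y \<in> carrier ?H"
  then show "sweedler K (?A (x \<otimes>\<^bsub>?H\<^esub> y)) (?A x) (?A y) (?sw x y)"
    by (simp add: sweedler_flip_mult sweedler.flip sweedler)
next
  fix x y \<beta> a b
  assume x: "x \<in> carrier ?H" and y: "y \<in> carrier ?H" and \<beta>: "bilinear_form K (?A x) (?A y) \<beta>"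
    and a: "a \<in> carrier (?A (x \<otimes>\<^bsub>?H\<^esub> y))" and b: "b \<in> carrier (?A (x \<otimes>\<^bsub>?H\<^esub> y))"
  interpret s: sweedler K "A (y \<cdot> x)" "A y" "A x" "sw y x"
    using x y by (simp add: sweedler)
  have \<beta>': "bilinear_form K (A y) (A x) (\<lambda>p q. \<beta> q p)"
    using \<beta> by (simp add: bilinear_flip)
  have "sw y x (\<lambda>p q. \<beta> q p) (b \<otimes>\<^bsub>A (y \<cdot> x)\<^esub> a) =
      sw y x (\<lambda>p q. sw y x (\<lambda>r s. \<beta> (q \<otimes>\<^bsub>A x\<^esub> s) (p \<otimes>\<^bsub>A y\<^esub> r)) a) b"
    using sw_mult[of y x "\<lambda>p q. \<beta> q p" b a] x y a b \<beta>' by simp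
  \<comment> \<open>Reversing the product swaps a and b, and with them the order of their coproduct
    sums.\<close>
  also have "\<dots> = sw y x (\<lambda>r s. sw y x (\<lambda>p q. \<beta> (q \<otimes>\<^bsub>A x\<^esub> s) (p \<otimes>\<^bsub>A y\<^esub> r)) b) a"
  proof (rule s.sw_swap[OF s.sweedler_axioms])
    show "bilinear_form K (A y) (A x) (\<lambda>p q. \<beta> (q \<otimes>\<^bsub>A x\<^esub> s) (p \<otimes>\<^bsub>A y\<^esub> r))"
      if "r \<in> carrier (A y)" "s \<in> carrier (A x)" for r s
      using x y that by (intro bilinear_comp[OF \<beta>'] lin_mult_right lin_id) simp_all
    show "bilinear_form K (A y) (A x) (\<lambda>r s. \<beta> (q \<otimes>\<^bsub>A x\<^esub> s) (p \<otimes>\<^bsub>A y\<^esub> r))"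
      if "p \<in> carrier (A y)" "q \<in> carrier (A x)" for p q
      using x y that by (intro bilinear_comp[OF \<beta>'] lin_mult_left lin_id) simp_all
  qed (use x y a b in simp_all)
  finally show "?sw x y \<beta> (a \<otimes>\<^bsub>?A (x \<otimes>\<^bsub>?H\<^esub> y)\<^esub> b) =
      ?sw x y (\<lambda>p q. ?sw x y (\<lambda>r s. \<beta> (p \<otimes>\<^bsub>?A x\<^esub> r) (q \<otimes>\<^bsub>?A y\<^esub> s)) b) a"
    by simp
next
  fix x y \<beta>
  assume "x \<in> carrier ?H" "y \<in> carrier ?H" "bilinear_form K (?A x) (?A y) \<beta>"
  then show "?sw x y \<beta> \<one>\<^bsub>?A (x \<otimes>\<^bsub>?H\<^esub> y)\<^esub> = \<beta> \<one>\<^bsub>?A x\<^esub> \<one>\<^bsub>?A y\<^esub>"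
    using sw_one[of y x "\<lambda>p q. \<beta> q p"] by (simp add: bilinear_flip)
next
  fix x y z \<gamma> a
  assume "x \<in> carrier ?H" "y \<in> carrier ?H" "z \<in> carrier ?H" "trilinear_form K (?A x) (?A y) (?A z) \<gamma>"
    "a \<in> carrier (?A (x \<otimes>\<^bsub>?H\<^esub> y \<otimes>\<^bsub>?H\<^esub> z))"
  then show "?sw (x \<otimes>\<^bsub>?H\<^esub> y) z (\<lambda>t r. ?sw x y (\<lambda>p q. \<gamma> p q r) t) a = ?sw x (y \<otimes>\<^bsub>?H\<^esub> z) (\<lambda>p t. ?sw y z (\<gamma> p) t) a"
    using sw_assoc[of z y x "\<lambda>r q p. \<gamma> p q r" a] by (simp add: trilinear_flip H.m_assoc)
next
  show "linear_form K (?A \<one>\<^bsub>?H\<^esub>) \<epsilon>"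
    using counit_form by simp
  show "\<epsilon> \<one>\<^bsub>?A \<one>\<^bsub>?H\<^esub>\<^esub> = \<one>"
    using counit_one by simp
  show "\<exists>I v. dual_basis K (?A \<one>\<^bsub>?H\<^esub>) I v"
    using ex_dual_basis by simp
next
  fix a b assume "a \<in> carrier (?A \<one>\<^bsub>?H\<^esub>)" "b \<in> carrier (?A \<one>\<^bsub>?H\<^esub>)"
  then show "\<epsilon> (a \<otimes>\<^bsub>?A \<one>\<^bsub>?H\<^esub>\<^esub> b) = \<epsilon> a \<otimes> \<epsilon> b"
    using counit_mult[of b a] form_closed[OF counit_form] by (simp add: K.m_comm)
next
  fix x f a assume x: "x \<in> carrier ?H" and f: "linear_form K (?A x) f" and a: "a \<in> carrier (?A x)"
  interpret s: sweedler K "A x" "A x" "A e" "sw x e"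
    using x sweedler[of x e] by simp
  interpret t: sweedler K "A x" "A e" "A x" "sw e x"
    using x sweedler[of e x] by simp
  have fc: "f b \<in> carrier K" if "b \<in> carrier (A x)" for b
    using f that by (simp add: form_closed)
  have "sw x e (\<lambda>p q. \<epsilon> q \<otimes> f p) a = sw x e (\<lambda>p q. f p \<otimes> \<epsilon> q) a"
    by (rule s.sw_cong[symmetric])
      (use a f counit_form fc form_closed[OF counit_form] in \<open>simp_all add: form_tensor K.m_comm\<close>)
  then show "?sw \<one>\<^bsub>?H\<^esub> x (\<lambda>p q. \<epsilon> p \<otimes> f q) a = f a"
    using sw_counit_right[of x f a] x f a by simp
  have "sw e x (\<lambda>p q. f q \<otimes> \<epsilon> p) a = sw e x (\<lambda>p q. \<epsilon> p \<otimes> f q) a"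
    by (rule t.sw_cong[symmetric])
      (use a f counit_form fc form_closed[OF counit_form] in \<open>simp_all add: form_tensor K.m_comm\<close>)
  then show "?sw x \<one>\<^bsub>?H\<^esub> (\<lambda>p q. f p \<otimes> \<epsilon> q) a = f a"
    using sw_counit_left[of x f a] x f a by simp
next
  fix x assume "x \<in> carrier ?H"
  then show "S x \<in> module_hom K (?A (inv\<^bsub>?H\<^esub> x)) (?A x)"
    by (simp add: H.inv_opposite antipode_linear)
next
  fix x f a assume "x \<in> carrier ?H" "linear_form K (?A x) f" "a \<in> carrier (?A \<one>\<^bsub>?H\<^esub>)"
  then show "?sw (inv\<^bsub>?H\<^esub> x) x (\<lambda>p q. f (S x p \<otimes>\<^bsub>?A x\<^esub> q)) a = \<epsilon> a \<otimes> f \<one>\<^bsub>?A x\<^esub>"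
    and "?sw x (inv\<^bsub>?H\<^esub> x) (\<lambda>p q. f (p \<otimes>\<^bsub>?A x\<^esub> S x q)) a = \<epsilon> a \<otimes> f \<one>\<^bsub>?A x\<^esub>"
    by (simp_all add: H.inv_opposite sw_antipode_left sw_antipode_right)
next
  fix x assume "x \<in> carrier ?H" "\<one>\<^bsub>?A x\<^esub> \<noteq> \<zero>\<^bsub>?A x\<^esub>"
  then show "\<exists>f. linear_form K (?A x) f \<and> f \<one>\<^bsub>?A x\<^esub> = \<one>"
    using ex_normalized[of x] by simp
qed

end

section \<open>Coordinates and separating forms in finite dimension\<close>

lemma ex_coordinates:
  fixes K :: "('k, 'm) ring_scheme" and V :: "('k, 'a) module"
  assumes "vectorspace K V" "vectorspace.fin_dim K V"
  shows "\<exists>I v. finite I \<and> I \<subseteq> carrier V \<and> (\<forall>i\<in>I. linear_form K V (v i)) \<and>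
    (\<forall>i\<in>I. \<forall>j\<in>I. v i j = (if i = j then \<one>\<^bsub>K\<^esub> else \<zero>\<^bsub>K\<^esub>)) \<and>
    (\<forall>a\<in>carrier V. a = (\<Oplus>\<^bsub>V\<^esub>i\<in>I. v i a \<odot>\<^bsub>V\<^esub> i))"
proof -
  interpret vectorspace K V by fact
  obtain I where I: "finite I" "basis I"
    using finite_basis_exists[OF assms(2)] by blast
  then have IV: "I \<subseteq> carrier V"
    by (simp add: basis_def)
  have ex1: "\<exists>!c. c \<in> I \<rightarrow>\<^sub>E carrier K \<and> lincomb c I = a" if "a \<in> carrier V" for a
    using basis_criterion[OF I(1) IV] I(2) that by blast
  \<comment> \<open>Coefficient functions are extensional on I, which makes the coordinate function
    of a vector unique and justifies \<open>THE\<close>.\<close>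
  define co where "co a = (THE c. c \<in> I \<rightarrow>\<^sub>E carrier K \<and> lincomb c I = a)" for a
  have co: "co a \<in> I \<rightarrow>\<^sub>E carrier K" "lincomb (co a) I = a" if "a \<in> carrier V" for a
    using theI'[OF ex1[OF that]] by (simp_all add: co_def)
  \<comment> \<open>Any coefficients that represent a are the coordinates of a, after restriction to
    I. Linearity of the coordinates and their values on the basis are obtained by exhibiting such
    coefficients.\<close>
  have coI: "co a i = c i" if "a \<in> carrier V" "c \<in> I \<rightarrow> carrier K" "lincomb c I = a" "i \<in> I" for a c i
  proof -
    have "lincomb (restrict c I) I = lincomb c I"
      unfolding lincomb_def by (rule M.add.finprod_cong') (use that(2) IV in auto)
    then have "lincomb (restrict c I) I = a"
      using that(3) by simp
    then have "restrict c I = co a"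
      using ex1[OF that(1)] co[OF that(1)] that(2) by (metis restrict_PiE_iff Pi_iff)
    then show ?thesis
      using that(4) by (metis restrict_apply')
  qed
  have form: "linear_form K V (\<lambda>a. co a i)" if i: "i \<in> I" for i
  proof (rule linear_formI)
    show "co a i \<in> carrier K" if "a \<in> carrier V" for a
      using co(1)[OF that] i by blast
    show "co (a \<oplus>\<^bsub>V\<^esub> b) i = co a i \<oplus>\<^bsub>K\<^esub> co b i" if a: "a \<in> carrier V" and b: "b \<in> carrier V" for a b
    proof (rule coI[OF _ _ _ i])
      show "lincomb (\<lambda>i. co a i \<oplus>\<^bsub>K\<^esub> co b i) I = a \<oplus>\<^bsub>V\<^esub> b"
        using lincomb_sum[OF I(1) IV, of "co a" "co b"] co[OF a] co[OF b] by (auto simp: PiE_iff)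
      show "(\<lambda>i. co a i \<oplus>\<^bsub>K\<^esub> co b i) \<in> I \<rightarrow> carrier K"
        using co(1)[OF a] co(1)[OF b] by (auto simp: PiE_iff)
    qed (use a b in simp)
    show "co (c \<odot>\<^bsub>V\<^esub> a) i = c \<otimes>\<^bsub>K\<^esub> co a i" if c: "c \<in> carrier K" and a: "a \<in> carrier V" for c a
    proof (rule coI[OF _ _ _ i])
      show "lincomb (\<lambda>i. c \<otimes>\<^bsub>K\<^esub> co a i) I = c \<odot>\<^bsub>V\<^esub> a"
        using lincomb_smult[OF IV _ c, of "co a"] co[OF a] by (auto simp: PiE_iff)
      show "(\<lambda>i. c \<otimes>\<^bsub>K\<^esub> co a i) \<in> I \<rightarrow> carrier K"
        using co(1)[OF a] c by (auto simp: PiE_iff)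
    qed (use a c in simp)
  qed
  have delta: "co j i = (if i = j then \<one>\<^bsub>K\<^esub> else \<zero>\<^bsub>K\<^esub>)" if i: "i \<in> I" and j: "j \<in> I" for i j
  proof (rule coI[OF _ _ _ i])
    have jV: "j \<in> carrier V"
      using j IV by blast
    have "lincomb (\<lambda>i. if i = j then \<one>\<^bsub>K\<^esub> else \<zero>\<^bsub>K\<^esub>) I = (\<Oplus>\<^bsub>V\<^esub>i\<in>I. if j = i then i else \<zero>\<^bsub>V\<^esub>)"
      unfolding lincomb_def by (rule M.add.finprod_cong') (use IV in auto)
    also have "\<dots> = j"
      by (rule M.add.finprod_singleton[OF j I(1)]) (use IV in auto)
    finally show "lincomb (\<lambda>i. if i = j then \<one>\<^bsub>K\<^esub> else \<zero>\<^bsub>K\<^esub>) I = j" .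
  qed (use j IV in auto)
  have "\<forall>a\<in>carrier V. a = (\<Oplus>\<^bsub>V\<^esub>i\<in>I. co a i \<odot>\<^bsub>V\<^esub> i)"
    using co(2) by (simp add: lincomb_def)
  then show ?thesis
    using I(1) IV form delta by (intro exI[of _ I] exI[of _ "\<lambda>i a. co a i"]) simp
qed

lemma ex_dual_basis:
  fixes K :: "('k, 'm) ring_scheme" and V :: "('k, 'a) module"
  assumes "vectorspace K V" "vectorspace.fin_dim K V"
  shows "\<exists>I v. dual_basis K V I v"
proof -
  interpret vectorspace K V by fact
  obtain I v where Iv: "finite I \<and> I \<subseteq> carrier V \<and> (\<forall>i\<in>I. linear_form K V (v i)) \<and>
    (\<forall>i\<in>I. \<forall>j\<in>I. v i j = (if i = j then \<one>\<^bsub>K\<^esub> else \<zero>\<^bsub>K\<^esub>)) \<and>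
    (\<forall>a\<in>carrier V. a = (\<Oplus>\<^bsub>V\<^esub>i\<in>I. v i a \<odot>\<^bsub>V\<^esub> i))"
    using ex_coordinates[OF assms] by (elim exE)
  have "(\<Oplus>\<^bsub>K\<^esub>i\<in>I. v i a \<otimes>\<^bsub>K\<^esub> f i) = f a" if f: "linear_form K V f" and a: "a \<in> carrier V" for f a
  proof -
    have vi: "v i a \<in> carrier K" if "i \<in> I" for i
      using Iv that linear_formD(1)[of "v i" K V a] a by blast
    have "f a = f (\<Oplus>\<^bsub>V\<^esub>i\<in>I. v i a \<odot>\<^bsub>V\<^esub> i)"
      using Iv a by metis
    also have "\<dots> = (\<Oplus>\<^bsub>ground_algebra K\<^esub>i\<in>I. f (v i a \<odot>\<^bsub>V\<^esub> i))"
      by (rule module_hom_finsum[OF module_axioms R.ground_module f]) (use Iv vi in auto)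
    also have "\<dots> = (\<Oplus>\<^bsub>K\<^esub>i\<in>I. v i a \<otimes>\<^bsub>K\<^esub> f i)"
      unfolding finsum_ground_algebra
      by (rule R.add.finprod_cong') (use Iv vi linear_formD[OF f] in auto)
    finally show ?thesis
      by simp
  qed
  then show ?thesis
    using Iv by (intro exI[of _ I] exI[of _ v]) (simp add: dual_basis_def)
qed

text \<open>A nonzero vector has a nonzero coordinate, and dividing that coordinate form by its
  value normalizes it.\<close>

lemma linear_form_separates:
  fixes K :: "('k, 'm) ring_scheme" and V :: "('k, 'a) module"
  assumes "vectorspace K V" "vectorspace.fin_dim K V" and a: "a \<in> carrier V" "a \<noteq> \<zero>\<^bsub>V\<^esub>"
  shows "\<exists>f. linear_form K V f \<and> f a = \<one>\<^bsub>K\<^esub>"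
proof -
  interpret vectorspace K V by fact
  obtain I v where Iv: "finite I \<and> I \<subseteq> carrier V \<and> (\<forall>i\<in>I. linear_form K V (v i)) \<and>
    (\<forall>i\<in>I. \<forall>j\<in>I. v i j = (if i = j then \<one>\<^bsub>K\<^esub> else \<zero>\<^bsub>K\<^esub>)) \<and>
    (\<forall>a\<in>carrier V. a = (\<Oplus>\<^bsub>V\<^esub>i\<in>I. v i a \<odot>\<^bsub>V\<^esub> i))"
    using ex_coordinates[OF assms(1,2)] by (elim exE)
  have "\<exists>i\<in>I. v i a \<noteq> \<zero>\<^bsub>K\<^esub>"
  proof (rule ccontr)
    assume "\<not> ?thesis"
    then have "(\<Oplus>\<^bsub>V\<^esub>i\<in>I. v i a \<odot>\<^bsub>V\<^esub> i) = (\<Oplus>\<^bsub>V\<^esub>i\<in>I. \<zero>\<^bsub>V\<^esub>)"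
      using Iv by (intro M.add.finprod_cong') auto
    then show False
      using Iv a by (metis M.finsum_zero)
  qed
  then obtain i where i: "i \<in> I" "v i a \<noteq> \<zero>\<^bsub>K\<^esub>"
    by blast
  then have f: "linear_form K V (v i)"
    using Iv by blast
  have u: "v i a \<in> Units K"
    using i linear_formD(1)[OF f a(1)] by (simp add: field_Units)
  have "linear_form K V (\<lambda>b. inv\<^bsub>K\<^esub> (v i a) \<otimes>\<^bsub>K\<^esub> v i b)"
    using u by (intro R.linear_form_cmult f) simp
  moreover have "inv\<^bsub>K\<^esub> (v i a) \<otimes>\<^bsub>K\<^esub> v i a = \<one>\<^bsub>K\<^esub>"
    using u by simp
  ultimately show ?thesis
    by blast
qed


section \<open>Maps between tensor products\<close>

lemma module_hom_finsum_fun: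
  assumes "module K W" and f: "\<And>i. i \<in> I \<Longrightarrow> f i \<in> module_hom K Y W"
  shows "(\<lambda>y. \<Oplus>\<^bsub>W\<^esub>i\<in>I. f i y) \<in> module_hom K Y W"
proof -
  interpret W: module K W by fact
  have fc: "f i y \<in> carrier W" if "i \<in> I" "y \<in> carrier Y" for i y
    using module_hom_carrier[OF f] that by blast
  show ?thesis
  proof (rule module_homI)
    fix a b assume ab: "a \<in> carrier Y" "b \<in> carrier Y"
    have "(\<Oplus>\<^bsub>W\<^esub>i\<in>I. f i (a \<oplus>\<^bsub>Y\<^esub> b)) = (\<Oplus>\<^bsub>W\<^esub>i\<in>I. f i a \<oplus>\<^bsub>W\<^esub> f i b)"
      by (rule W.add.finprod_cong') (use ab fc module_hom_add[OF f] in auto)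
    also have "\<dots> = (\<Oplus>\<^bsub>W\<^esub>i\<in>I. f i a) \<oplus>\<^bsub>W\<^esub> (\<Oplus>\<^bsub>W\<^esub>i\<in>I. f i b)"
      by (rule W.finsum_addf) (use ab fc in auto)
    finally show "(\<Oplus>\<^bsub>W\<^esub>i\<in>I. f i (a \<oplus>\<^bsub>Y\<^esub> b)) = (\<Oplus>\<^bsub>W\<^esub>i\<in>I. f i a) \<oplus>\<^bsub>W\<^esub> (\<Oplus>\<^bsub>W\<^esub>i\<in>I. f i b)" .
  next
    fix c a assume ca: "c \<in> carrier K" "a \<in> carrier Y"
    have "(\<Oplus>\<^bsub>W\<^esub>i\<in>I. f i (c \<odot>\<^bsub>Y\<^esub> a)) = (\<Oplus>\<^bsub>W\<^esub>i\<in>I. c \<odot>\<^bsub>W\<^esub> f i a)"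
      by (rule W.add.finprod_cong') (use ca fc module_hom_smult[OF f] in auto)
    also have "\<dots> = c \<odot>\<^bsub>W\<^esub> (\<Oplus>\<^bsub>W\<^esub>i\<in>I. f i a)"
      by (rule W.finsum_smult[symmetric]) (use ca fc in auto)
    finally show "(\<Oplus>\<^bsub>W\<^esub>i\<in>I. f i (c \<odot>\<^bsub>Y\<^esub> a)) = c \<odot>\<^bsub>W\<^esub> (\<Oplus>\<^bsub>W\<^esub>i\<in>I. f i a)" .
  qed (use fc in \<open>auto intro: W.finsum_closed\<close>)
qed

lemma module_hom_smult_fun:
  assumes "module K W" and f: "f \<in> module_hom K Y W" and c: "c \<in> carrier K"
  shows "(\<lambda>y. c \<odot>\<^bsub>W\<^esub> f y) \<in> module_hom K Y W"
proof -
  interpret W: module K W by fact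
  show ?thesis
    by (rule module_homI)
      (use c module_hom_carrier[OF f] module_hom_add[OF f] module_hom_smult[OF f] in
        \<open>auto simp: W.smult_r_distr W.smult_assoc1[symmetric] W.R.m_comm\<close>)
qed

lemma (in bilinear_map) tensor_lift_cong:
  assumes t: "t \<in> carrier (tensor K A B)" and eq: "\<And>a b. \<lbrakk>a \<in> carrier A; b \<in> carrier B\<rbrakk> \<Longrightarrow> \<beta> a b = \<beta>' a b"
  shows "tensor_lift K W \<beta> t = tensor_lift K W \<beta>' t"
proof -
  have "tensor_eval K W \<beta> f = tensor_eval K W \<beta>' f" if "f \<in> t" for f
    unfolding tensor_eval_def
  proof (rule W.add.finprod_cong'[OF refl])
    have f: "f \<in> carrier F"
      using AB.tensor_memD(1)[OF t that] .
    have P: "p \<in> {p. f p \<noteq> \<zero>} \<Longrightarrow> fst p \<in> carrier A \<and> snd p \<in> carrier B" for p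
      using support_subset[OF f] by auto
    show "(\<lambda>p. f p \<odot>\<^bsub>W\<^esub> \<beta>' (fst p) (snd p)) \<in> {p. f p \<noteq> \<zero>} \<rightarrow> carrier W"
    proof
      fix p assume "p \<in> {p. f p \<noteq> \<zero>}"
      then show "f p \<odot>\<^bsub>W\<^esub> \<beta>' (fst p) (snd p) \<in> carrier W"
        using P A.free_closed[OF f] \<beta>_closed by (simp flip: eq)
    qed
    show "f p \<odot>\<^bsub>W\<^esub> \<beta> (fst p) (snd p) = f p \<odot>\<^bsub>W\<^esub> \<beta>' (fst p) (snd p)" if "p \<in> {p. f p \<noteq> \<zero>}" for p
      using P[OF that] eq by simp
  qed
  then show ?thesis
    unfolding tensor_lift_def tensor_eval_def[symmetric] by (metis (mono_tags, lifting) image_cong)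
qed

text \<open>One representative of t serves for all parameters y, so the lift is a fixed finite
  linear combination of the maps sending y to \<beta> y a b.\<close>

lemma tensor_lift_param:
  assumes A: "module K A" and B: "module K B" and W: "module K W" and Y: "module K Y"
    and t: "t \<in> carrier (tensor K A B)" and \<beta>: "\<And>y. y \<in> carrier Y \<Longrightarrow> bilinear K A B W (\<beta> y)"
    and lin: "\<And>a b. \<lbrakk>a \<in> carrier A; b \<in> carrier B\<rbrakk> \<Longrightarrow> (\<lambda>y. \<beta> y a b) \<in> module_hom K Y W"
  shows "(\<lambda>y. tensor_lift K W (\<beta> y) t) \<in> module_hom K Y W"
proof -
  interpret AB: tensor_product K A B
    using A B by (rule tensor_product.intro)
  obtain f where f: "f \<in> t"
    using AB.tensor_nonempty[OF t] by blast
  note fF = AB.tensor_memD(1)[OF t f]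
  have eq: "tensor_lift K W (\<beta> y) t = (\<Oplus>\<^bsub>W\<^esub>p\<in>{p. f p \<noteq> \<zero>\<^bsub>K\<^esub>}. f p \<odot>\<^bsub>W\<^esub> \<beta> y (fst p) (snd p))"
    if "y \<in> carrier Y" for y
  proof -
    interpret bilinear_map K A B W "\<beta> y"
      using A B W \<beta>[OF that] by (simp add: bilinear_map_def bilinear_map_axioms_def)
    show ?thesis
      using tensor_lift_eq[OF t f] by (simp add: tensor_eval_def)
  qed
  have "(\<lambda>y. \<Oplus>\<^bsub>W\<^esub>p\<in>{p. f p \<noteq> \<zero>\<^bsub>K\<^esub>}. f p \<odot>\<^bsub>W\<^esub> \<beta> y (fst p) (snd p)) \<in> module_hom K Y W"
  proof (intro module_hom_finsum_fun module_hom_smult_fun W)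
    fix p assume "p \<in> {p. f p \<noteq> \<zero>\<^bsub>K\<^esub>}"
    then have "p \<in> carrier A \<times> carrier B"
      using fF by (cases p) (force simp: AB.A.free_carrier_iff)
    then show "(\<lambda>y. \<beta> y (fst p) (snd p)) \<in> module_hom K Y W"
      by (intro lin) auto
    show "f p \<in> carrier K"
      by (rule AB.A.free_closed[OF fF])
  qed
  then show ?thesis
    using module_hom_cong[OF Y, of "\<lambda>y. tensor_lift K W (\<beta> y) t"
        "\<lambda>y. \<Oplus>\<^bsub>W\<^esub>p\<in>{p. f p \<noteq> \<zero>\<^bsub>K\<^esub>}. f p \<odot>\<^bsub>W\<^esub> \<beta> y (fst p) (snd p)" W] eq
    by blast
qed

lemma bilinear_mapI: "\<lbrakk>module K A; module K B; module K W; bilinear K A B W \<beta>\<rbrakk> \<Longrightarrow> bilinear_map K A B W \<beta>"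
  by (simp add: bilinear_map_def bilinear_map_axioms_def)

lemma module_tensor: "\<lbrakk>module K A; module K B\<rbrakk> \<Longrightarrow> module K (tensor K A B)"
  by (simp add: tensor_product.tensor_module tensor_product.intro)

lemma
  assumes "module K A" "module K B" "module K A'" "module K B'"
    and f: "f \<in> module_hom K A A'" and g: "g \<in> module_hom K B B'" and t: "t \<in> carrier (tensor K A B)"
  shows tensor_map_closed: "tensor_map K A' B' f g t \<in> carrier (tensor K A' B')"
    and tensor_lift_map: "\<lbrakk>module K W; bilinear K A' B' W \<beta>\<rbrakk> \<Longrightarrow>
      tensor_lift K W \<beta> (tensor_map K A' B' f g t) = tensor_lift K W (\<lambda>a b. \<beta> (f a) (g b)) t"
proof -
  interpret T: tensor_product K A' B'
    using assms by (simp add: tensor_product_def)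
  interpret m: bilinear_map K A B "tensor K A' B'" "\<lambda>a b. pure_tensor K A' B' (f a) (g b)"
    using assms bilinear_comp[OF T.pure_tensor_bilinear f g] by (intro bilinear_mapI T.tensor_module)
  show "tensor_map K A' B' f g t \<in> carrier (tensor K A' B')"
    unfolding tensor_map_def using module_hom_carrier[OF m.tensor_lift_hom t] .
  assume W: "module K W" and \<beta>: "bilinear K A' B' W \<beta>"
  interpret b: bilinear_map K A' B' W \<beta>
    using assms W \<beta> by (intro bilinear_mapI)
  interpret c: bilinear_map K A B W "\<lambda>a b. \<beta> (f a) (g b)"
    using assms W bilinear_comp[OF \<beta> f g] by (intro bilinear_mapI)
  have "tensor_lift K W \<beta> (tensor_map K A' B' f g t) =
      tensor_lift K W (\<lambda>a b. tensor_lift K W \<beta> (pure_tensor K A' B' (f a) (g b))) t"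
    unfolding tensor_map_def by (rule m.tensor_lift_comp[OF W b.tensor_lift_hom t])
  also have "\<dots> = tensor_lift K W (\<lambda>a b. \<beta> (f a) (g b)) t"
    by (rule c.tensor_lift_cong[OF t, symmetric])
      (simp add: b.tensor_lift_pure module_hom_carrier[OF f] module_hom_carrier[OF g])
  finally show "tensor_lift K W \<beta> (tensor_map K A' B' f g t) = tensor_lift K W (\<lambda>a b. \<beta> (f a) (g b)) t" .
qed

lemma bilinear_tensor_lift:
  assumes A: "module K A" and B: "module K B" and C: "module K C" and W: "module K W"
    and ab: "\<And>c. c \<in> carrier C \<Longrightarrow> bilinear K A B W (\<lambda>a b. \<gamma> a b c)"
    and c: "\<And>a b. \<lbrakk>a \<in> carrier A; b \<in> carrier B\<rbrakk> \<Longrightarrow> \<gamma> a b \<in> module_hom K C W"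
  shows "bilinear K (tensor K A B) C W (\<lambda>s c. tensor_lift K W (\<lambda>a b. \<gamma> a b c) s)"
proof (rule bilinearI)
  fix s assume "s \<in> carrier (tensor K A B)"
  then show "(\<lambda>c. tensor_lift K W (\<lambda>a b. \<gamma> a b c) s) \<in> module_hom K C W"
    by (rule tensor_lift_param[OF A B W C _ ab c])
next
  fix c assume "c \<in> carrier C"
  then interpret bilinear_map K A B W "\<lambda>a b. \<gamma> a b c"
    by (intro bilinear_mapI A B W ab)
  show "(\<lambda>s. tensor_lift K W (\<lambda>a b. \<gamma> a b c) s) \<in> module_hom K (tensor K A B) W"
    by (rule tensor_lift_hom)
qed

text \<open>This makes coassociativity accessible to trilinear maps. As \<open>tensor_assoc\<close>
  is itself a double lift, two uses of \<open>tensor_lift_comp\<close> reduce the claim to a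
  \<otimes> (b \<otimes> c), where both sides are \<gamma> a b c.\<close>

lemma tensor_lift_assoc:
  assumes A: "module K A" and B: "module K B" and C: "module K C" and W: "module K W"
    and \<gamma>1: "\<And>b c. \<lbrakk>b \<in> carrier B; c \<in> carrier C\<rbrakk> \<Longrightarrow> (\<lambda>a. \<gamma> a b c) \<in> module_hom K A W"
    and \<gamma>2: "\<And>a c. \<lbrakk>a \<in> carrier A; c \<in> carrier C\<rbrakk> \<Longrightarrow> (\<lambda>b. \<gamma> a b c) \<in> module_hom K B W"
    and \<gamma>3: "\<And>a b. \<lbrakk>a \<in> carrier A; b \<in> carrier B\<rbrakk> \<Longrightarrow> (\<lambda>c. \<gamma> a b c) \<in> module_hom K C W"
    and t: "t \<in> carrier (tensor K (tensor K A B) C)"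
  shows "tensor_lift K W (\<lambda>a s. tensor_lift K W (\<gamma> a) s) (tensor_assoc K A B C t) =
    tensor_lift K W (\<lambda>s c. tensor_lift K W (\<lambda>a b. \<gamma> a b c) s) t"
proof -
  interpret AB: tensor_product K A B
    using A B by (rule tensor_product.intro)
  interpret BC: tensor_product K B C
    using B C by (rule tensor_product.intro)
  interpret A_BC: tensor_product K A "tensor K B C"
    using A BC.tensor_module by (rule tensor_product.intro)
  let ?T = "tensor K A (tensor K B C)"
  let ?p = "\<lambda>a b c. pure_tensor K A (tensor K B C) a (pure_tensor K B C b c)"
  have p1: "(\<lambda>a. ?p a b c) \<in> module_hom K A ?T" if "b \<in> carrier B" "c \<in> carrier C" for b c
    by (rule bilinearD(2)[OF A_BC.pure_tensor_bilinear]) (use that in simp)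
  have p2: "(\<lambda>b. ?p a b c) \<in> module_hom K B ?T" if "a \<in> carrier A" "c \<in> carrier C" for a c
    by (rule module_hom_comp[OF bilinearD(2)[OF BC.pure_tensor_bilinear] bilinearD(1)[OF A_BC.pure_tensor_bilinear]])
      (use that in simp_all)
  have p3: "(\<lambda>c. ?p a b c) \<in> module_hom K C ?T" if "a \<in> carrier A" "b \<in> carrier B" for a b
    by (rule module_hom_comp[OF bilinearD(1)[OF BC.pure_tensor_bilinear] bilinearD(1)[OF A_BC.pure_tensor_bilinear]])
      (use that in simp_all)
  have g: "bilinear K A (tensor K B C) W (\<lambda>a s. tensor_lift K W (\<gamma> a) s)"
  proof (rule bilinear_flip[OF bilinear_tensor_lift[OF B C A W, where \<gamma> = "\<lambda>b c a. \<gamma> a b c"]])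
    show "bilinear K B C W (\<lambda>b c. \<gamma> a b c)" if "a \<in> carrier A" for a
      by (intro bilinearI \<gamma>2 \<gamma>3 that)
  qed (rule \<gamma>1)
  interpret G: bilinear_map K A "tensor K B C" W "\<lambda>a s. tensor_lift K W (\<gamma> a) s"
    by (intro bilinear_mapI A BC.tensor_module W g)
  have q: "bilinear K (tensor K A B) C ?T (\<lambda>s c. tensor_lift K ?T (\<lambda>a b. ?p a b c) s)"
    by (intro bilinear_tensor_lift A B C A_BC.tensor_module bilinearI p1 p2 p3)
  interpret Q: bilinear_map K "tensor K A B" C ?T "\<lambda>s c. tensor_lift K ?T (\<lambda>a b. ?p a b c) s"
    by (intro bilinear_mapI AB.tensor_module C A_BC.tensor_module q)
  have r: "bilinear K (tensor K A B) C W (\<lambda>s c. tensor_lift K W (\<lambda>a b. \<gamma> a b c) s)"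
    by (intro bilinear_tensor_lift A B C W bilinearI \<gamma>1 \<gamma>2 \<gamma>3)
  interpret R: bilinear_map K "tensor K A B" C W "\<lambda>s c. tensor_lift K W (\<lambda>a b. \<gamma> a b c) s"
    by (intro bilinear_mapI AB.tensor_module C W r)
  have "tensor_lift K W (\<lambda>a s. tensor_lift K W (\<gamma> a) s) (tensor_assoc K A B C t) =
      tensor_lift K W (\<lambda>s c. tensor_lift K W (\<lambda>a s. tensor_lift K W (\<gamma> a) s) (tensor_lift K ?T (\<lambda>a b. ?p a b c) s)) t"
    unfolding tensor_assoc_def Let_def by (rule Q.tensor_lift_comp[OF W G.tensor_lift_hom t])
  also have "\<dots> = tensor_lift K W (\<lambda>s c. tensor_lift K W (\<lambda>a b. \<gamma> a b c) s) t"
  proof (rule R.tensor_lift_cong[OF t, symmetric])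
    fix s c assume s: "s \<in> carrier (tensor K A B)" and c: "c \<in> carrier C"
    interpret P: bilinear_map K A B ?T "\<lambda>a b. ?p a b c"
      by (intro bilinear_mapI A B A_BC.tensor_module bilinearI p1 p2 c)
    interpret U: bilinear_map K A B W "\<lambda>a b. \<gamma> a b c"
      by (intro bilinear_mapI A B W bilinearI \<gamma>1 \<gamma>2 c)
    have "tensor_lift K W (\<lambda>a s. tensor_lift K W (\<gamma> a) s) (tensor_lift K ?T (\<lambda>a b. ?p a b c) s) =
        tensor_lift K W (\<lambda>a b. tensor_lift K W (\<lambda>a s. tensor_lift K W (\<gamma> a) s) (?p a b c)) s"
      by (rule P.tensor_lift_comp[OF W G.tensor_lift_hom s])
    also have "\<dots> = tensor_lift K W (\<lambda>a b. \<gamma> a b c) s"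
    proof (rule U.tensor_lift_cong[OF s, symmetric])
      fix a b assume a: "a \<in> carrier A" and b: "b \<in> carrier B"
      interpret V: bilinear_map K B C W "\<gamma> a"
        by (intro bilinear_mapI B C W bilinearI \<gamma>2 \<gamma>3 a)
      show "\<gamma> a b c = tensor_lift K W (\<lambda>a s. tensor_lift K W (\<gamma> a) s) (?p a b c)"
        using a b c by (simp add: G.tensor_lift_pure V.tensor_lift_pure)
    qed
    finally show "tensor_lift K W (\<lambda>a b. \<gamma> a b c) s =
      tensor_lift K W (\<lambda>a s. tensor_lift K W (\<gamma> a) s) (tensor_lift K ?T (\<lambda>a b. ?p a b c) s)" by simp
  qed
  finally show ?thesis .
qed

lemma (in abelian_monoid) finsum_cartesian_product:
  assumes "finite I" "finite J" "\<And>i j. \<lbrakk>i \<in> I; j \<in> J\<rbrakk> \<Longrightarrow> f (i, j) \<in> carrier G"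
  shows "(\<Oplus>u\<in>I \<times> J. f u) = (\<Oplus>i\<in>I. \<Oplus>j\<in>J. f (i, j))"
  using assms(1,3)
proof (induct I)
  case empty
  then show ?case by simp
next
  case (insert k I)
  have "(\<Oplus>u\<in>insert k I \<times> J. f u) = (\<Oplus>u\<in>Pair k ` J \<union> I \<times> J. f u)"
    by (rule arg_cong[where f = "finsum G f"]) auto
  also have "\<dots> = (\<Oplus>u\<in>Pair k ` J. f u) \<oplus> (\<Oplus>u\<in>I \<times> J. f u)"
    by (rule finsum_Un_disjoint) (use insert assms(2) in auto)
  also have "(\<Oplus>u\<in>Pair k ` J. f u) = (\<Oplus>j\<in>J. f (k, j))"
    by (rule finsum_reindex) (use insert in \<open>auto simp: inj_on_def\<close>)
  also have "(\<Oplus>u\<in>I \<times> J. f u) = (\<Oplus>i\<in>I. \<Oplus>j\<in>J. f (i, j))"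
    using insert by simp
  also have "(\<Oplus>j\<in>J. f (k, j)) \<oplus> (\<Oplus>i\<in>I. \<Oplus>j\<in>J. f (i, j)) = (\<Oplus>i\<in>insert k I. \<Oplus>j\<in>J. f (i, j))"
    using insert by (subst finsum_insert) (auto intro!: finsum_closed)
  finally show ?case .
qed

section \<open>The product of the monoid algebra\<close>

context cring
begin

abbreviation supp :: "('g \<Rightarrow> 'a) \<Rightarrow> 'g set"
  where "supp f \<equiv> {p. f p \<noteq> \<zero>}"

context
  fixes G :: "('g, 'n) monoid_scheme" and f g :: "'g \<Rightarrow> 'a"
  assumes f: "f \<in> carrier (monoid_algebra R G)" and g: "g \<in> carrier (monoid_algebra R G)"
begin

text \<open>The index set in the definition depends on r. Spreading the sum over the whole rectangle
  of supports, with zero where the product differs from r, makes sums over r exchangeable with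
  it.\<close>

lemma free_mult_eq:
  "(f \<otimes>\<^bsub>monoid_algebra R G\<^esub> g) r = (\<Oplus>p\<in>(supp f). \<Oplus>q\<in>(supp g). if p \<otimes>\<^bsub>G\<^esub> q = r then f p \<otimes> g q else \<zero>)"
proof -
  have "{(p, q). f p \<noteq> \<zero> \<and> g q \<noteq> \<zero> \<and> p \<otimes>\<^bsub>G\<^esub> q = r} = {u \<in> (supp f) \<times> (supp g). fst u \<otimes>\<^bsub>G\<^esub> snd u = r}"
    by auto
  then have "(f \<otimes>\<^bsub>monoid_algebra R G\<^esub> g) r = (\<Oplus>u\<in>{u \<in> (supp f) \<times> (supp g). fst u \<otimes>\<^bsub>G\<^esub> snd u = r}. f (fst u) \<otimes> g (snd u))"
    by (simp add: monoid_algebra_def)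
  also have "\<dots> = (\<Oplus>u\<in>(supp f) \<times> (supp g). if fst u \<otimes>\<^bsub>G\<^esub> snd u = r then f (fst u) \<otimes> g (snd u) else \<zero>)"
    by (rule add.finprod_mono_neutral_cong_left)
      (use free_finite[OF f] free_finite[OF g] free_closed[OF f] free_closed[OF g] in auto)
  also have "\<dots> = (\<Oplus>p\<in>(supp f). \<Oplus>q\<in>(supp g). if p \<otimes>\<^bsub>G\<^esub> q = r then f p \<otimes> g q else \<zero>)"
  proof -
    let ?h = "\<lambda>u. if fst u \<otimes>\<^bsub>G\<^esub> snd u = r then f (fst u) \<otimes> g (snd u) else \<zero>"
    have "(\<Oplus>u\<in>(supp f) \<times> (supp g). ?h u) = (\<Oplus>p\<in>(supp f). \<Oplus>q\<in>(supp g). ?h (p, q))"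
      by (rule finsum_cartesian_product[OF free_finite[OF f] free_finite[OF g]])
        (simp add: free_closed[OF f] free_closed[OF g])
    then show ?thesis
      unfolding fst_conv snd_conv .
  qed
  finally show ?thesis .
qed

lemma free_mult_support: "{r. (f \<otimes>\<^bsub>monoid_algebra R G\<^esub> g) r \<noteq> \<zero>} \<subseteq> (\<lambda>(p, q). p \<otimes>\<^bsub>G\<^esub> q) ` ((supp f) \<times> (supp g))"
proof
  fix r assume r: "r \<in> {r. (f \<otimes>\<^bsub>monoid_algebra R G\<^esub> g) r \<noteq> \<zero>}"
  show "r \<in> (\<lambda>(p, q). p \<otimes>\<^bsub>G\<^esub> q) ` ((supp f) \<times> (supp g))"
  proof (rule ccontr)
    assume n: "r \<notin> (\<lambda>(p, q). p \<otimes>\<^bsub>G\<^esub> q) ` ((supp f) \<times> (supp g))"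
    have "(\<Oplus>p\<in>(supp f). \<Oplus>q\<in>(supp g). if p \<otimes>\<^bsub>G\<^esub> q = r then f p \<otimes> g q else \<zero>) = (\<Oplus>p\<in>(supp f). \<Oplus>q\<in>(supp g). \<zero>)"
      by (intro add.finprod_cong') (use n in auto)
    then show False
      using r free_mult_eq by simp
  qed
qed

lemma free_mult_closed:
  assumes "\<And>p q. \<lbrakk>p \<in> carrier G; q \<in> carrier G\<rbrakk> \<Longrightarrow> p \<otimes>\<^bsub>G\<^esub> q \<in> carrier G"
  shows "f \<otimes>\<^bsub>monoid_algebra R G\<^esub> g \<in> carrier (monoid_algebra R G)"
  unfolding free_carrier_iff
proof (intro conjI allI impI)
  show "(f \<otimes>\<^bsub>monoid_algebra R G\<^esub> g) r \<in> carrier R" for r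
    unfolding free_mult_eq by (intro finsum_closed Pi_I) (use free_closed[OF f] free_closed[OF g] in simp)
  show "finite {r. (f \<otimes>\<^bsub>monoid_algebra R G\<^esub> g) r \<noteq> \<zero>}"
    by (rule finite_subset[OF free_mult_support]) (use free_finite[OF f] free_finite[OF g] in simp)
  fix r assume r: "r \<notin> carrier G"
  have "p \<otimes>\<^bsub>G\<^esub> q \<in> carrier G" if "f p \<noteq> \<zero>" "g q \<noteq> \<zero>" for p q
    using that f g by (intro assms) (auto simp: free_carrier_iff)
  then show "(f \<otimes>\<^bsub>monoid_algebra R G\<^esub> g) r = \<zero>"
    using r free_mult_support by auto
qed

text \<open>After exchanging the sums, each pair (p, q) meets exactly one nonzero position r, namely
  the product of p and q. The outer index set is the set of all such products, which contains the
  support of the product.\<close>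

lemma free_mult_eval:
  assumes cl: "\<And>p q. \<lbrakk>p \<in> carrier G; q \<in> carrier G\<rbrakk> \<Longrightarrow> p \<otimes>\<^bsub>G\<^esub> q \<in> carrier G"
    and h: "\<And>p. p \<in> carrier G \<Longrightarrow> h p \<in> carrier R"
  shows "(\<Oplus>r\<in>(\<lambda>(p, q). p \<otimes>\<^bsub>G\<^esub> q) ` ((supp f) \<times> (supp g)). (f \<otimes>\<^bsub>monoid_algebra R G\<^esub> g) r \<otimes> h r) =
    (\<Oplus>p\<in>(supp f). \<Oplus>q\<in>(supp g). f p \<otimes> (g q \<otimes> h (p \<otimes>\<^bsub>G\<^esub> q)))"
proof -
  let ?R = "(\<lambda>(p, q). p \<otimes>\<^bsub>G\<^esub> q) ` ((supp f) \<times> (supp g))"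
  let ?t = "\<lambda>p q r. if p \<otimes>\<^bsub>G\<^esub> q = r then f p \<otimes> (g q \<otimes> h r) else \<zero>"
  have fin: "finite (supp f)" "finite (supp g)" "finite ?R"
    using free_finite[OF f] free_finite[OF g] by auto
  have c: "f p \<in> carrier R" "g p \<in> carrier R" for p
    using free_closed[OF f] free_closed[OF g] by auto
  have PQ: "p \<in> carrier G" if "f p \<noteq> \<zero> \<or> g p \<noteq> \<zero>" for p
    using that f g by (auto simp: free_carrier_iff)
  have hR: "h r \<in> carrier R" if "r \<in> ?R" for r
    using that PQ by (auto intro!: h cl)
  have t: "?t p q r \<in> carrier R" if "r \<in> ?R" for p q r
    using c hR[OF that] by simp
  have "(\<Oplus>r\<in>?R. (f \<otimes>\<^bsub>monoid_algebra R G\<^esub> g) r \<otimes> h r) = (\<Oplus>r\<in>?R. \<Oplus>p\<in>(supp f). \<Oplus>q\<in>(supp g). ?t p q r)"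
  proof (rule add.finprod_cong'[OF refl])
    fix r assume r: "r \<in> ?R"
    have "(\<Oplus>p\<in>(supp f). \<Oplus>q\<in>(supp g). if p \<otimes>\<^bsub>G\<^esub> q = r then f p \<otimes> g q else \<zero>) \<otimes> h r =
        (\<Oplus>p\<in>(supp f). (\<Oplus>q\<in>(supp g). if p \<otimes>\<^bsub>G\<^esub> q = r then f p \<otimes> g q else \<zero>) \<otimes> h r)"
      by (rule finsum_ldistr[OF fin(1) hR[OF r]]) (auto intro!: finsum_closed simp: c)
    also have "\<dots> = (\<Oplus>p\<in>(supp f). \<Oplus>q\<in>(supp g). ?t p q r)"
    proof (rule add.finprod_cong'[OF refl])
      fix p
      have "(\<Oplus>q\<in>(supp g). if p \<otimes>\<^bsub>G\<^esub> q = r then f p \<otimes> g q else \<zero>) \<otimes> h r =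
          (\<Oplus>q\<in>(supp g). (if p \<otimes>\<^bsub>G\<^esub> q = r then f p \<otimes> g q else \<zero>) \<otimes> h r)"
        by (rule finsum_ldistr[OF fin(2) hR[OF r]]) (auto simp: c)
      also have "\<dots> = (\<Oplus>q\<in>(supp g). ?t p q r)"
        by (rule add.finprod_cong') (use c hR[OF r] in \<open>auto simp: m_assoc\<close>)
      finally show "(\<Oplus>q\<in>(supp g). if p \<otimes>\<^bsub>G\<^esub> q = r then f p \<otimes> g q else \<zero>) \<otimes> h r = (\<Oplus>q\<in>(supp g). ?t p q r)" .
    qed (intro Pi_I finsum_closed t r)
    finally show "(f \<otimes>\<^bsub>monoid_algebra R G\<^esub> g) r \<otimes> h r = (\<Oplus>p\<in>(supp f). \<Oplus>q\<in>(supp g). ?t p q r)"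
      unfolding free_mult_eq .
  qed (intro Pi_I finsum_closed t)
  also have "\<dots> = (\<Oplus>p\<in>(supp f). \<Oplus>r\<in>?R. \<Oplus>q\<in>(supp g). ?t p q r)"
    by (rule finsum_swap[OF fin(3,1)]) (intro finsum_closed Pi_I t)
  also have "\<dots> = (\<Oplus>p\<in>(supp f). \<Oplus>q\<in>(supp g). \<Oplus>r\<in>?R. ?t p q r)"
    by (intro add.finprod_cong' refl finsum_swap[OF fin(3,2)] Pi_I finsum_closed t)
  also have "\<dots> = (\<Oplus>p\<in>(supp f). \<Oplus>q\<in>(supp g). f p \<otimes> (g q \<otimes> h (p \<otimes>\<^bsub>G\<^esub> q)))"
  proof (intro add.finprod_cong' refl)
    have fgh: "f p \<otimes> (g q \<otimes> h r) \<in> carrier R" if "r \<in> ?R" for p q r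
      using c hR[OF that] by simp
    show "(\<Oplus>r\<in>?R. ?t p q r) = f p \<otimes> (g q \<otimes> h (p \<otimes>\<^bsub>G\<^esub> q))" if "p \<in> (supp f)" "q \<in> (supp g)" for p q
      using that by (intro add.finprod_singleton fin Pi_I fgh) auto
    show "(\<lambda>p. \<Oplus>q\<in>(supp g). f p \<otimes> (g q \<otimes> h (p \<otimes>\<^bsub>G\<^esub> q))) \<in> (supp f) \<rightarrow> carrier R"
      by (intro Pi_I finsum_closed fgh) auto
    show "(\<lambda>q. f p \<otimes> (g q \<otimes> h (p \<otimes>\<^bsub>G\<^esub> q))) \<in> (supp g) \<rightarrow> carrier R" if "p \<in> (supp f)" for p
      using that by (intro Pi_I fgh) auto
  qed
  finally show ?thesis .
qed

end

end

text \<open>The product of two cosets is a union over representatives, and \<open>st\<close>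
  guarantees that this union is a single coset, so it may be evaluated at the product f g of two
  chosen representatives. In the application \<open>st\<close> comes from \<Delta>(a) \<Delta>(b) =
  \<Delta>(a b).\<close>

lemma tensor_lift_mult:
  assumes A: "assoc_algebra K A" and B: "assoc_algebra K B" and K: "field K"
    and \<beta>: "bilinear_form K A B \<beta>"
    and s: "s \<in> carrier (tensor K A B)" and t: "t \<in> carrier (tensor K A B)"
    and st: "s \<otimes>\<^bsub>tensor K A B\<^esub> t \<in> carrier (tensor K A B)"
  shows "tensor_lift K (ground_algebra K) \<beta> (s \<otimes>\<^bsub>tensor K A B\<^esub> t) =
    tensor_lift K (ground_algebra K) (\<lambda>p q. tensor_lift K (ground_algebra K)
      (\<lambda>p' q'. \<beta> (p \<otimes>\<^bsub>A\<^esub> p') (q \<otimes>\<^bsub>B\<^esub> q')) t) s"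
proof -
  interpret K: field K by fact
  interpret A: assoc_algebra K A by fact
  interpret B: assoc_algebra K B by fact
  interpret rA: ring A by (rule A.ring)
  interpret rB: ring B by (rule B.ring)
  let ?W = "ground_algebra K"
  interpret b: bilinear_map K A B ?W \<beta>
    by (intro bilinear_mapI A.module_axioms B.module_axioms K.ground_module \<beta>)
  have l: "(\<lambda>p'. p \<otimes>\<^bsub>A\<^esub> p') \<in> module_hom K A A" "(\<lambda>p. p \<otimes>\<^bsub>A\<^esub> p') \<in> module_hom K A A"
    if "p \<in> carrier A" "p' \<in> carrier A" for p p'
    using that by (auto intro!: module_homI simp: rA.l_distr rA.r_distr A.smult_mult_left A.smult_mult_right)
  have r: "(\<lambda>q'. q \<otimes>\<^bsub>B\<^esub> q') \<in> module_hom K B B" "(\<lambda>q. q \<otimes>\<^bsub>B\<^esub> q') \<in> module_hom K B B"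
    if "q \<in> carrier B" "q' \<in> carrier B" for q q'
    using that by (auto intro!: module_homI simp: rB.l_distr rB.r_distr B.smult_mult_left B.smult_mult_right)
  have \<beta>': "bilinear_form K A B (\<lambda>p' q'. \<beta> (p \<otimes>\<^bsub>A\<^esub> p') (q \<otimes>\<^bsub>B\<^esub> q'))"
    if "p \<in> carrier A" "q \<in> carrier B" for p q
    using that by (intro bilinear_comp[OF \<beta>] l(1)[of p p] r(1)[of q q])
  have \<beta>'': "bilinear_form K A B (\<lambda>p q. tensor_lift K ?W (\<lambda>p' q'. \<beta> (p \<otimes>\<^bsub>A\<^esub> p') (q \<otimes>\<^bsub>B\<^esub> q')) t)"
  proof (rule bilinearI)
    fix p assume p: "p \<in> carrier A"
    show "linear_form K B (\<lambda>q. tensor_lift K ?W (\<lambda>p' q'. \<beta> (p \<otimes>\<^bsub>A\<^esub> p') (q \<otimes>\<^bsub>B\<^esub> q')) t)"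
    proof (rule tensor_lift_param[OF A.module_axioms B.module_axioms K.ground_module B.module_axioms t \<beta>'[OF p]])
      fix p' q' assume p': "p' \<in> carrier A" "q' \<in> carrier B"
      show "linear_form K B (\<lambda>y. \<beta> (p \<otimes>\<^bsub>A\<^esub> p') (y \<otimes>\<^bsub>B\<^esub> q'))"
        by (rule module_hom_comp[OF r(2)[OF p'(2) p'(2)] bilinearD(1)[OF \<beta>]]) (use p p' in simp)
    qed
  next
    fix q assume q: "q \<in> carrier B"
    show "linear_form K A (\<lambda>p. tensor_lift K ?W (\<lambda>p' q'. \<beta> (p \<otimes>\<^bsub>A\<^esub> p') (q \<otimes>\<^bsub>B\<^esub> q')) t)"
    proof (rule tensor_lift_param[OF A.module_axioms B.module_axioms K.ground_module A.module_axioms t \<beta>'[OF _ q]])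
      fix p' q' assume p': "p' \<in> carrier A" "q' \<in> carrier B"
      show "linear_form K A (\<lambda>y. \<beta> (y \<otimes>\<^bsub>A\<^esub> p') (q \<otimes>\<^bsub>B\<^esub> q'))"
        by (rule module_hom_comp[OF l(2)[OF p'(1) p'(1)] bilinearD(2)[OF \<beta>]]) (use q p' in simp)
    qed
  qed
  interpret c: bilinear_map K A B ?W "\<lambda>p q. tensor_lift K ?W (\<lambda>p' q'. \<beta> (p \<otimes>\<^bsub>A\<^esub> p') (q \<otimes>\<^bsub>B\<^esub> q')) t"
    by (intro bilinear_mapI A.module_axioms B.module_axioms K.ground_module \<beta>'')
  obtain f g where f: "f \<in> s" and g: "g \<in> t"
    using b.AB.tensor_nonempty[OF s] b.AB.tensor_nonempty[OF t] by blast
  note fF = b.AB.tensor_memD(1)[OF s f] and gF = b.AB.tensor_memD(1)[OF t g]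
  let ?F = "monoid_algebra K (A \<times>\<times> B)"
  let ?P = "{p. f p \<noteq> \<zero>\<^bsub>K\<^esub>}" and ?Q = "{p. g p \<noteq> \<zero>\<^bsub>K\<^esub>}"
  note P = b.support_subset[OF fF] K.free_finite[OF fF] and Q = b.support_subset[OF gF] K.free_finite[OF gF]
  have fK: "f p \<in> carrier K" and gK: "g p \<in> carrier K" for p
    using K.free_closed[OF fF] K.free_closed[OF gF] by auto
  have cl: "p \<otimes>\<^bsub>A \<times>\<times> B\<^esub> q \<in> carrier (A \<times>\<times> B)" if "p \<in> carrier (A \<times>\<times> B)" "q \<in> carrier (A \<times>\<times> B)" for p q
    using that by (auto simp: DirProd_def)
  note fgF = K.free_mult_closed[OF fF gF cl]
  let ?R = "(\<lambda>(p, q). p \<otimes>\<^bsub>A \<times>\<times> B\<^esub> q) ` (?P \<times> ?Q)"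
  have R: "finite ?R" "?R \<subseteq> carrier A \<times> carrier B"
    using P Q cl by (auto simp: DirProd_def)
  have "f \<otimes>\<^bsub>?F\<^esub> g \<in> s \<otimes>\<^bsub>tensor K A B\<^esub> t"
    unfolding b.AB.tensor_mult_eq using f g b.AB.coset_self[OF fgF] by blast
  then have "tensor_lift K ?W \<beta> (s \<otimes>\<^bsub>tensor K A B\<^esub> t) = tensor_eval K ?W \<beta> (f \<otimes>\<^bsub>?F\<^esub> g)"
    by (rule b.tensor_lift_eq[OF st])
  also have "\<dots> = (\<Oplus>\<^bsub>K\<^esub>r\<in>?R. (f \<otimes>\<^bsub>?F\<^esub> g) r \<otimes>\<^bsub>K\<^esub> \<beta> (fst r) (snd r))"
    using b.tensor_eval_superset[OF fgF R(1) K.free_mult_support[OF fF gF] R(2)] by simp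
  also have "\<dots> = (\<Oplus>\<^bsub>K\<^esub>p\<in>?P. \<Oplus>\<^bsub>K\<^esub>q\<in>?Q. f p \<otimes>\<^bsub>K\<^esub>
      (g q \<otimes>\<^bsub>K\<^esub> \<beta> (fst (p \<otimes>\<^bsub>A \<times>\<times> B\<^esub> q)) (snd (p \<otimes>\<^bsub>A \<times>\<times> B\<^esub> q))))"
    by (rule K.free_mult_eval[OF fF gF cl]) (use b.\<beta>_closed in auto)
  also have "\<dots> = (\<Oplus>\<^bsub>K\<^esub>p\<in>?P. f p \<otimes>\<^bsub>K\<^esub> tensor_lift K ?W (\<lambda>p' q'. \<beta> (fst p \<otimes>\<^bsub>A\<^esub> p') (snd p \<otimes>\<^bsub>B\<^esub> q')) t)"
  proof (rule K.add.finprod_cong'[OF refl])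
    fix p assume "p \<in> ?P"
    then have p: "fst p \<in> carrier A" "snd p \<in> carrier B"
      using P(1) by (cases p; auto)+
    interpret d: bilinear_map K A B ?W "\<lambda>p' q'. \<beta> (fst p \<otimes>\<^bsub>A\<^esub> p') (snd p \<otimes>\<^bsub>B\<^esub> q')"
      by (intro bilinear_mapI A.module_axioms B.module_axioms K.ground_module \<beta>' p)
    have lift: "tensor_lift K ?W (\<lambda>p' q'. \<beta> (fst p \<otimes>\<^bsub>A\<^esub> p') (snd p \<otimes>\<^bsub>B\<^esub> q')) t =
        (\<Oplus>\<^bsub>K\<^esub>q\<in>?Q. g q \<otimes>\<^bsub>K\<^esub> \<beta> (fst p \<otimes>\<^bsub>A\<^esub> fst q) (snd p \<otimes>\<^bsub>B\<^esub> snd q))"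
      using d.tensor_lift_eq[OF t g] by (simp add: tensor_eval_def)
    have q: "\<beta> (fst p \<otimes>\<^bsub>A\<^esub> fst q) (snd p \<otimes>\<^bsub>B\<^esub> snd q) \<in> carrier K" if "q \<in> ?Q" for q
      using that Q(1) d.\<beta>_closed[of "fst q" "snd q"] by (cases q) auto
    show "(\<Oplus>\<^bsub>K\<^esub>q\<in>?Q. f p \<otimes>\<^bsub>K\<^esub> (g q \<otimes>\<^bsub>K\<^esub> \<beta> (fst (p \<otimes>\<^bsub>A \<times>\<times> B\<^esub> q)) (snd (p \<otimes>\<^bsub>A \<times>\<times> B\<^esub> q)))) =
        f p \<otimes>\<^bsub>K\<^esub> tensor_lift K ?W (\<lambda>p' q'. \<beta> (fst p \<otimes>\<^bsub>A\<^esub> p') (snd p \<otimes>\<^bsub>B\<^esub> q')) t"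
      unfolding lift
      by (subst K.finsum_rdistr[OF Q(2)]) (use fK gK q in \<open>auto simp: DirProd_def case_prod_beta\<close>)
  next
    show "(\<lambda>p. f p \<otimes>\<^bsub>K\<^esub> tensor_lift K ?W (\<lambda>p' q'. \<beta> (fst p \<otimes>\<^bsub>A\<^esub> p') (snd p \<otimes>\<^bsub>B\<^esub> q')) t) \<in> ?P \<rightarrow> carrier K"
    proof
      fix p assume "p \<in> ?P"
      then have "fst p \<in> carrier A" "snd p \<in> carrier B"
        using P(1) by (cases p; auto)+
      then show "f p \<otimes>\<^bsub>K\<^esub> tensor_lift K ?W (\<lambda>p' q'. \<beta> (fst p \<otimes>\<^bsub>A\<^esub> p') (snd p \<otimes>\<^bsub>B\<^esub> q')) t \<in> carrier K"
        using fK c.\<beta>_closed by simp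
    qed
  qed
  also have "\<dots> = tensor_lift K ?W (\<lambda>p q. tensor_lift K ?W (\<lambda>p' q'. \<beta> (p \<otimes>\<^bsub>A\<^esub> p') (q \<otimes>\<^bsub>B\<^esub> q')) t) s"
    using c.tensor_lift_eq[OF s f] by (simp add: tensor_eval_def)
  finally show ?thesis .
qed


lemma tensor_lift_one:
  assumes "module K A" "module K B" "bilinear K A B W \<beta>" "module K W" "\<one>\<^bsub>A\<^esub> \<in> carrier A" "\<one>\<^bsub>B\<^esub> \<in> carrier B"
  shows "tensor_lift K W \<beta> \<one>\<^bsub>tensor K A B\<^esub> = \<beta> \<one>\<^bsub>A\<^esub> \<one>\<^bsub>B\<^esub>"
proof -
  interpret bilinear_map K A B W \<beta>
    using assms by (intro bilinear_mapI)
  have "\<one>\<^bsub>F\<^esub> = free_gen K (\<one>\<^bsub>A\<^esub>, \<one>\<^bsub>B\<^esub>)"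
    by (simp add: monoid_algebra_def)
  then have "\<one>\<^bsub>tensor K A B\<^esub> = pure_tensor K A B \<one>\<^bsub>A\<^esub> \<one>\<^bsub>B\<^esub>"
    by (simp add: AB.tensor_one_eq pure_tensor_def)
  then show ?thesis
    using assms by (simp add: tensor_lift_pure)
qed

text \<open>The support and the coefficients of one representative of \<Delta> c provide the formal
  sum demanded by \<open>sw_rep\<close>, uniformly in \<beta>.\<close>

lemma sweedler_tensor_lift:
  assumes "field K" "module K A" "module K B" "module K C" and \<Delta>: "\<Delta> \<in> module_hom K C (tensor K A B)"
  shows "sweedler K C A B (\<lambda>\<beta> c. tensor_lift K (ground_algebra K) \<beta> (\<Delta> c))"
proof -
  interpret K: field K by fact
  show ?thesis
  proof (intro sweedler.intro sweedler_axioms.intro assms(1-4))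
    fix \<beta> assume \<beta>: "bilinear_form K A B \<beta>"
    interpret bilinear_map K A B "ground_algebra K" \<beta>
      by (intro bilinear_mapI assms K.ground_module \<beta>)
    show "linear_form K C (\<lambda>c. tensor_lift K (ground_algebra K) \<beta> (\<Delta> c))"
      by (rule module_hom_comp[OF \<Delta> tensor_lift_hom])
  next
    fix c assume "c \<in> carrier C"
    then have t: "\<Delta> c \<in> carrier (tensor K A B)"
      by (rule module_hom_carrier[OF \<Delta>])
    interpret AB: tensor_product K A B
      using assms by (simp add: tensor_product_def)
    obtain f where f: "f \<in> \<Delta> c"
      using AB.tensor_nonempty[OF t] by blast
    note fF = AB.tensor_memD(1)[OF t f]
    show "\<exists>P k. finite P \<and> P \<subseteq> carrier A \<times> carrier B \<and> k \<in> P \<rightarrow> carrier K \<and>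
      (\<forall>\<beta>. bilinear_form K A B \<beta> \<longrightarrow> tensor_lift K (ground_algebra K) \<beta> (\<Delta> c) =
        (\<Oplus>\<^bsub>K\<^esub>p\<in>P. k p \<otimes>\<^bsub>K\<^esub> \<beta> (fst p) (snd p)))"
    proof (intro exI conjI allI impI)
      show "finite {p. f p \<noteq> \<zero>\<^bsub>K\<^esub>}"
        by (rule K.free_finite[OF fF])
      show "{p. f p \<noteq> \<zero>\<^bsub>K\<^esub>} \<subseteq> carrier A \<times> carrier B"
        using fF by (force simp: K.free_carrier_iff)
      show "f \<in> {p. f p \<noteq> \<zero>\<^bsub>K\<^esub>} \<rightarrow> carrier K"
        using K.free_closed[OF fF] by blast
      fix \<beta> assume \<beta>: "bilinear_form K A B \<beta>"
      interpret bilinear_map K A B "ground_algebra K" \<beta>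
        by (intro bilinear_mapI assms K.ground_module \<beta>)
      show "tensor_lift K (ground_algebra K) \<beta> (\<Delta> c) = (\<Oplus>\<^bsub>K\<^esub>p\<in>{p. f p \<noteq> \<zero>\<^bsub>K\<^esub>}. f p \<otimes>\<^bsub>K\<^esub> \<beta> (fst p) (snd p))"
        using tensor_lift_eq[OF t f] by (simp add: tensor_eval_def)
    qed
  qed
qed


section \<open>Hopf coalgebras over a crossed module\<close>

context hopf_chi_coalgebra
begin

abbreviation "G \<equiv> ground_algebra K"

definition sw :: "'h \<Rightarrow> 'h \<Rightarrow> ('a \<Rightarrow> 'a \<Rightarrow> 'k) \<Rightarrow> 'a \<Rightarrow> 'k"
  where "sw x y \<beta> a = tensor_lift K G \<beta> (\<Delta> x y a)"

lemma module_A: "x \<in> carrier H \<Longrightarrow> module K (A x)"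
  using algebras by (simp add: assoc_algebra_def vectorspace_def)

lemma ring_A: "x \<in> carrier H \<Longrightarrow> ring (A x)"
  using algebras by (simp add: assoc_algebra_def assoc_algebra_axioms_def)

lemma one_A: "x \<in> carrier H \<Longrightarrow> \<one>\<^bsub>A x\<^esub> \<in> carrier (A x)"
  using ring_A by (simp add: ring.ring_simprules)

lemma comult_linear:
  "\<lbrakk>x \<in> carrier H; y \<in> carrier H\<rbrakk> \<Longrightarrow> \<Delta> x y \<in> module_hom K (A (x \<otimes>\<^bsub>H\<^esub> y)) (tensor K (A x) (A y))"
  using comult_hom by (simp add: algebra_hom_def)

lemma comult_closed:
  "\<lbrakk>x \<in> carrier H; y \<in> carrier H; a \<in> carrier (A (x \<otimes>\<^bsub>H\<^esub> y))\<rbrakk> \<Longrightarrow> \<Delta> x y a \<in> carrier (tensor K (A x) (A y))"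
  using module_hom_carrier[OF comult_linear] .

lemma counit_linear: "linear_form K (A \<one>\<^bsub>H\<^esub>) \<epsilon>"
  using counit_hom by (simp add: algebra_hom_def)

lemma antipode_linear: "x \<in> carrier H \<Longrightarrow> S x \<in> module_hom K (A (inv\<^bsub>H\<^esub> x)) (A x)"
  using antipode_iso by (simp add: linear_iso_def)

lemma phi_linear:
  "\<lbrakk>x \<in> carrier H; e \<in> carrier E\<rbrakk> \<Longrightarrow> \<phi> x e \<in> module_hom K (A x) (A (\<chi> e \<otimes>\<^bsub>H\<^esub> x))"
  using phi_hom by (simp add: algebra_hom_def)

lemma phi_unit: "\<lbrakk>x \<in> carrier H; e \<in> carrier E\<rbrakk> \<Longrightarrow> \<phi> x e \<one>\<^bsub>A x\<^esub> = \<one>\<^bsub>A (\<chi> e \<otimes>\<^bsub>H\<^esub> x)\<^esub>"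
  using phi_hom[of x e] by (auto simp: algebra_hom_def dest: ring_hom_one)

lemma chi_closed: "e \<in> carrier E \<Longrightarrow> \<chi> e \<in> carrier H"
  using hom by (auto simp: hom_def)

lemma id_linear: "id \<in> module_hom K M M"
  by (auto simp: module_hom_def)

lemma mult_bilinear: "x \<in> carrier H \<Longrightarrow> bilinear K (A x) (A x) (A x) (mult (A x))"
proof -
  assume x: "x \<in> carrier H"
  interpret assoc_algebra K "A x" by (rule algebras[OF x])
  interpret r: ring "A x" by (rule ring)
  show ?thesis
    by (intro bilinearI module_homI) (auto simp: r.l_distr r.r_distr smult_mult_left smult_mult_right)
qed

lemma smult_bilinear:
  assumes "module K M"
  shows "bilinear K M G M (\<lambda>a c. c \<odot>\<^bsub>M\<^esub> a)" "bilinear K G M M (\<lambda>c a. c \<odot>\<^bsub>M\<^esub> a)"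
proof -
  interpret M: module K M by fact
  show "bilinear K M G M (\<lambda>a c. c \<odot>\<^bsub>M\<^esub> a)"
    by (intro bilinearI module_homI)
      (auto simp: M.smult_l_distr M.smult_r_distr M.smult_assoc1[symmetric] m_comm)
  then show "bilinear K G M M (\<lambda>c a. c \<odot>\<^bsub>M\<^esub> a)"
    by (rule bilinear_flip)
qed

text \<open>The counit and antipode axioms and the integral equations all have the shape of a lift
  after f \<otimes> g after \<Delta>; composing with a form h rewrites each of them as a
  pairing.\<close>

lemma sw_map:
  assumes xy: "x \<in> carrier H" "y \<in> carrier H" and a: "a \<in> carrier (A (x \<otimes>\<^bsub>H\<^esub> y))"
    and M: "module K M" "module K N" "module K W"
    and f: "f \<in> module_hom K (A x) M" and g: "g \<in> module_hom K (A y) N"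
    and \<beta>: "bilinear K M N W \<beta>" and h: "linear_form K W h"
  shows "h (tensor_lift K W \<beta> (tensor_map K M N f g (\<Delta> x y a))) = sw x y (\<lambda>p q. h (\<beta> (f p) (g q))) a"
proof -
  interpret bilinear_map K "A x" "A y" W "\<lambda>p q. \<beta> (f p) (g q)"
    using xy M by (intro bilinear_mapI module_A bilinear_comp[OF \<beta> f g])
  have "tensor_lift K W \<beta> (tensor_map K M N f g (\<Delta> x y a)) = tensor_lift K W (\<lambda>p q. \<beta> (f p) (g q)) (\<Delta> x y a)"
    by (rule tensor_lift_map[OF module_A[OF xy(1)] module_A[OF xy(2)] M(1,2) f g comult_closed[OF xy a] M(3) \<beta>])
  then show ?thesis
    unfolding sw_def using tensor_lift_comp[OF ground_module h comult_closed[OF xy a]] by simp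
qed

text \<open>The translation of the tensor axioms into pairings: multiplicativity by
  \<open>tensor_lift_mult\<close>, coassociativity by \<open>tensor_lift_assoc\<close>, counit and
  antipode by \<open>sw_map\<close>.\<close>

lemma hopf_family:
  assumes fd: "\<And>x. x \<in> carrier H \<Longrightarrow> vectorspace.fin_dim K (A x)"
  shows "hopf_family K H A sw \<epsilon> S"
proof (intro hopf_family.intro hopf_family_axioms.intro)
  show "field K" ..
  show "group H" ..
  show "assoc_algebra K (A x)" if "x \<in> carrier H" for x
    by (rule algebras[OF that])
  have vs: "vectorspace K (A x)" if "x \<in> carrier H" for x
    using algebras[OF that] by (simp add: assoc_algebra_def)
  show "\<exists>I v. dual_basis K (A \<one>\<^bsub>H\<^esub>) I v"
    by (intro ex_dual_basis vs fd) simp_all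
  show "\<exists>f. linear_form K (A x) f \<and> f \<one>\<^bsub>A x\<^esub> = \<one>" if "x \<in> carrier H" "\<one>\<^bsub>A x\<^esub> \<noteq> \<zero>\<^bsub>A x\<^esub>" for x
    by (intro linear_form_separates vs fd one_A that)
  show "sweedler K (A (x \<otimes>\<^bsub>H\<^esub> y)) (A x) (A y) (sw x y)" if "x \<in> carrier H" "y \<in> carrier H" for x y
    unfolding sw_def[abs_def]
    by (intro sweedler_tensor_lift field_axioms module_A comult_linear H.m_closed that)
  show "linear_form K (A \<one>\<^bsub>H\<^esub>) \<epsilon>"
    by (rule counit_linear)
  show "\<epsilon> \<one>\<^bsub>A \<one>\<^bsub>H\<^esub>\<^esub> = \<one>"
    using counit_hom by (auto simp: algebra_hom_def dest: ring_hom_one)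
  show "\<epsilon> (a \<otimes>\<^bsub>A \<one>\<^bsub>H\<^esub>\<^esub> b) = \<epsilon> a \<otimes> \<epsilon> b" if "a \<in> carrier (A \<one>\<^bsub>H\<^esub>)" "b \<in> carrier (A \<one>\<^bsub>H\<^esub>)" for a b
    using counit_hom ring_hom_mult[of \<epsilon> "A \<one>\<^bsub>H\<^esub>" G a b] that by (simp add: algebra_hom_def)
  show "S x \<in> module_hom K (A (inv\<^bsub>H\<^esub> x)) (A x)" if "x \<in> carrier H" for x
    by (rule antipode_linear[OF that])
next
  fix x y \<beta> a b
  assume x: "x \<in> carrier H" and y: "y \<in> carrier H" and \<beta>: "bilinear_form K (A x) (A y) \<beta>"
    and a: "a \<in> carrier (A (x \<otimes>\<^bsub>H\<^esub> y))" and b: "b \<in> carrier (A (x \<otimes>\<^bsub>H\<^esub> y))"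
  have "\<Delta> x y \<in> ring_hom (A (x \<otimes>\<^bsub>H\<^esub> y)) (tensor K (A x) (A y))"
    using comult_hom[OF x y] by (simp add: algebra_hom_def)
  note ab = ring_hom_mult[OF this a b]
  have "a \<otimes>\<^bsub>A (x \<otimes>\<^bsub>H\<^esub> y)\<^esub> b \<in> carrier (A (x \<otimes>\<^bsub>H\<^esub> y))"
    using ring_A[of "x \<otimes>\<^bsub>H\<^esub> y"] x y a b by (simp add: ring.ring_simprules)
  \<comment> \<open>The product of the two coproducts is an element of the tensor product because it
    equals \<Delta>(a b).\<close>
  from comult_closed[OF x y this]
  have "\<Delta> x y a \<otimes>\<^bsub>tensor K (A x) (A y)\<^esub> \<Delta> x y b \<in> carrier (tensor K (A x) (A y))"
    unfolding ab .
  then show "sw x y \<beta> (a \<otimes>\<^bsub>A (x \<otimes>\<^bsub>H\<^esub> y)\<^esub> b) =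
      sw x y (\<lambda>p q. sw x y (\<lambda>r s. \<beta> (p \<otimes>\<^bsub>A x\<^esub> r) (q \<otimes>\<^bsub>A y\<^esub> s)) b) a"
    unfolding sw_def ab
    by (rule tensor_lift_mult[OF algebras[OF x] algebras[OF y] field_axioms \<beta> comult_closed[OF x y a] comult_closed[OF x y b]])
next
  fix x y \<beta>
  assume x: "x \<in> carrier H" and y: "y \<in> carrier H" and \<beta>: "bilinear_form K (A x) (A y) \<beta>"
  have "\<Delta> x y \<one>\<^bsub>A (x \<otimes>\<^bsub>H\<^esub> y)\<^esub> = \<one>\<^bsub>tensor K (A x) (A y)\<^esub>"
    using comult_hom[OF x y] by (auto simp: algebra_hom_def dest: ring_hom_one)
  then show "sw x y \<beta> \<one>\<^bsub>A (x \<otimes>\<^bsub>H\<^esub> y)\<^esub> = \<beta> \<one>\<^bsub>A x\<^esub> \<one>\<^bsub>A y\<^esub>"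
    unfolding sw_def using x y by (simp add: tensor_lift_one module_A one_A ground_module \<beta>)
next
  fix x y z \<gamma> a
  assume x: "x \<in> carrier H" and y: "y \<in> carrier H" and z: "z \<in> carrier H"
    and \<gamma>: "trilinear_form K (A x) (A y) (A z) \<gamma>" and a: "a \<in> carrier (A (x \<otimes>\<^bsub>H\<^esub> y \<otimes>\<^bsub>H\<^esub> z))"
  have xy: "x \<otimes>\<^bsub>H\<^esub> y \<in> carrier H" and yz: "y \<otimes>\<^bsub>H\<^esub> z \<in> carrier H"
    using x y z by simp_all
  have a': "a \<in> carrier (A (x \<otimes>\<^bsub>H\<^esub> (y \<otimes>\<^bsub>H\<^esub> z)))"
    using a x y z by (simp add: H.m_assoc)
  have g1: "linear_form K (A x) (\<lambda>p. \<gamma> p q r)" if "q \<in> carrier (A y)" "r \<in> carrier (A z)" for q r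
    using \<gamma> that by (simp add: trilinear_form_def)
  have g2: "linear_form K (A y) (\<lambda>q. \<gamma> p q r)" if "p \<in> carrier (A x)" "r \<in> carrier (A z)" for p r
    using \<gamma> that bilinear_formD(2)[of K "A y" "A z" "\<gamma> p" r] by (simp add: trilinear_form_def)
  have g3: "linear_form K (A z) (\<lambda>r. \<gamma> p q r)" if "p \<in> carrier (A x)" "q \<in> carrier (A y)" for p q
    using \<gamma> that bilinear_formD(1)[of K "A y" "A z" "\<gamma> p" q] by (simp add: trilinear_form_def)
  note m = module_A[OF x] module_A[OF y] module_A[OF z]
  have L: "bilinear_form K (tensor K (A x) (A y)) (A z) (\<lambda>s c. tensor_lift K G (\<lambda>a b. \<gamma> a b c) s)"
    by (intro bilinear_tensor_lift m ground_module bilinearI g1 g2 g3)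
  have R: "bilinear_form K (A x) (tensor K (A y) (A z)) (\<lambda>a s. tensor_lift K G (\<gamma> a) s)"
  proof (rule bilinear_flip[OF bilinear_tensor_lift[OF m(2,3,1) ground_module, where \<gamma> = "\<lambda>b c a. \<gamma> a b c"]])
    show "bilinear_form K (A y) (A z) (\<lambda>b c. \<gamma> a b c)" if "a \<in> carrier (A x)" for a
      by (intro bilinearI g2 g3 that)
  qed (rule g1)
  have "sw (x \<otimes>\<^bsub>H\<^esub> y) z (\<lambda>t r. sw x y (\<lambda>p q. \<gamma> p q r) t) a =
      tensor_lift K G (\<lambda>s c. tensor_lift K G (\<lambda>a b. \<gamma> a b c) s)
        (tensor_map K (tensor K (A x) (A y)) (A z) (\<Delta> x y) id (\<Delta> (x \<otimes>\<^bsub>H\<^esub> y) z a))"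
    unfolding sw_def
    by (subst tensor_lift_map[OF module_A[OF xy] m(3) module_tensor[OF m(1,2)] m(3) comult_linear[OF x y] id_linear
          comult_closed[OF xy z a] ground_module L]) simp
  also have "\<dots> = tensor_lift K G (\<lambda>a s. tensor_lift K G (\<gamma> a) s) (tensor_assoc K (A x) (A y) (A z)
        (tensor_map K (tensor K (A x) (A y)) (A z) (\<Delta> x y) id (\<Delta> (x \<otimes>\<^bsub>H\<^esub> y) z a)))"
    by (rule tensor_lift_assoc[OF m ground_module g1 g2 g3
          tensor_map_closed[OF module_A[OF xy] m(3) module_tensor[OF m(1,2)] m(3) comult_linear[OF x y] id_linear
          comult_closed[OF xy z a]], symmetric])
  also have "\<dots> = tensor_lift K G (\<lambda>a s. tensor_lift K G (\<gamma> a) s)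
      (tensor_map K (A x) (tensor K (A y) (A z)) id (\<Delta> y z) (\<Delta> x (y \<otimes>\<^bsub>H\<^esub> z) a))"
    by (simp add: coassoc[OF x y z a])
  also have "\<dots> = sw x (y \<otimes>\<^bsub>H\<^esub> z) (\<lambda>p t. sw y z (\<gamma> p) t) a"
    unfolding sw_def
    by (subst tensor_lift_map[OF m(1) module_A[OF yz] m(1) module_tensor[OF m(2,3)] id_linear comult_linear[OF y z]
          comult_closed[OF x yz a'] ground_module R]) simp
  finally show "sw (x \<otimes>\<^bsub>H\<^esub> y) z (\<lambda>t r. sw x y (\<lambda>p q. \<gamma> p q r) t) a = sw x (y \<otimes>\<^bsub>H\<^esub> z) (\<lambda>p t. sw y z (\<gamma> p) t) a" .
next
  fix x f a assume x: "x \<in> carrier H" and f: "linear_form K (A x) f" and a: "a \<in> carrier (A x)"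
  have a': "a \<in> carrier (A (x \<otimes>\<^bsub>H\<^esub> \<one>\<^bsub>H\<^esub>))" "a \<in> carrier (A (\<one>\<^bsub>H\<^esub> \<otimes>\<^bsub>H\<^esub> x))"
    using x a by simp_all
  have o: "\<one>\<^bsub>H\<^esub> \<in> carrier H"
    by simp
  note m = module_A[OF x] module_A[OF o]
  interpret s1: sweedler K "A (\<one>\<^bsub>H\<^esub> \<otimes>\<^bsub>H\<^esub> x)" "A \<one>\<^bsub>H\<^esub>" "A x" "sw \<one>\<^bsub>H\<^esub> x"
    unfolding sw_def[abs_def] by (intro sweedler_tensor_lift field_axioms module_A comult_linear H.m_closed x o)
  interpret s2: sweedler K "A (x \<otimes>\<^bsub>H\<^esub> \<one>\<^bsub>H\<^esub>)" "A x" "A \<one>\<^bsub>H\<^esub>" "sw x \<one>\<^bsub>H\<^esub>"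
    unfolding sw_def[abs_def] by (intro sweedler_tensor_lift field_axioms module_A comult_linear H.m_closed x o)
  note ec = linear_formD(1)[OF counit_linear] and fc = linear_formD(1,3)[OF f]
  have "f a = sw \<one>\<^bsub>H\<^esub> x (\<lambda>p q. f (\<epsilon> p \<odot>\<^bsub>A x\<^esub> id q)) a"
    unfolding sw_map[OF o x a'(2) ground_module m(1,1) counit_linear id_linear smult_bilinear(2)[OF m(1)] f, symmetric]
    using counit_left[OF x a] by (simp add: tensor_unit_left_def)
  also have "\<dots> = sw \<one>\<^bsub>H\<^esub> x (\<lambda>p q. \<epsilon> p \<otimes> f q) a"
    by (rule s1.sw_cong[OF a'(2), symmetric])
      (auto intro!: bilinearI linear_form_cmult linear_form_multc counit_linear f ec simp: fc ec)
  finally show "sw \<one>\<^bsub>H\<^esub> x (\<lambda>p q. \<epsilon> p \<otimes> f q) a = f a"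
    by simp
  have "f a = sw x \<one>\<^bsub>H\<^esub> (\<lambda>p q. f (\<epsilon> q \<odot>\<^bsub>A x\<^esub> id p)) a"
    unfolding sw_map[OF x o a'(1) m(1) ground_module m(1) id_linear counit_linear smult_bilinear(1)[OF m(1)] f, symmetric]
    using counit_right[OF x a] by (simp add: tensor_unit_right_def)
  also have "\<dots> = sw x \<one>\<^bsub>H\<^esub> (\<lambda>p q. f p \<otimes> \<epsilon> q) a"
    by (rule s2.sw_cong[OF a'(1), symmetric])
      (auto intro!: bilinearI linear_form_cmult linear_form_multc counit_linear f ec simp: fc ec m_comm)
  finally show "sw x \<one>\<^bsub>H\<^esub> (\<lambda>p q. f p \<otimes> \<epsilon> q) a = f a"
    by simp
next
  fix x f a assume x: "x \<in> carrier H" and f: "linear_form K (A x) f" and a: "a \<in> carrier (A \<one>\<^bsub>H\<^esub>)"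
  let ?i = "inv\<^bsub>H\<^esub> x"
  have i: "?i \<in> carrier H"
    using x by simp
  have a': "a \<in> carrier (A (?i \<otimes>\<^bsub>H\<^esub> x))" "a \<in> carrier (A (x \<otimes>\<^bsub>H\<^esub> ?i))"
    using x a by simp_all
  note m = module_A[OF x] module_A[OF i]
  have "f (unit_map (A x) (\<epsilon> a)) = \<epsilon> a \<otimes> f \<one>\<^bsub>A x\<^esub>"
    unfolding unit_map_def
    by (rule linear_formD(3)[OF f linear_formD(1)[OF counit_linear a] one_A[OF x]])
  then show "sw ?i x (\<lambda>p q. f (S x p \<otimes>\<^bsub>A x\<^esub> q)) a = \<epsilon> a \<otimes> f \<one>\<^bsub>A x\<^esub>"
    and "sw x ?i (\<lambda>p q. f (p \<otimes>\<^bsub>A x\<^esub> S x q)) a = \<epsilon> a \<otimes> f \<one>\<^bsub>A x\<^esub>"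
    using sw_map[OF i x a'(1) m(1,1,1) antipode_linear[OF x] id_linear mult_bilinear[OF x] f]
      sw_map[OF x i a'(2) m(1,1,1) id_linear antipode_linear[OF x] mult_bilinear[OF x] f]
      antipode_left[OF x a] antipode_right[OF x a]
    by (simp_all add: mult_map_def)
qed

end


section \<open>Spaces of integrals\<close>

text \<open>The singleton of m is a basis: it spans by the description of L, and a vanishing
  multiple of m with nonzero coefficient would give m = 0 after division.\<close>

lemma one_dimensional_multiples:
  fixes M :: "('k, 'a) module"
  assumes K: "field K" and M: "module K M" and m: "m \<in> carrier M" "m \<noteq> \<zero>\<^bsub>M\<^esub>"
    and L: "L = {c \<odot>\<^bsub>M\<^esub> m | c. c \<in> carrier K}"
  shows "one_dimensional K (M\<lparr>carrier := L\<rparr>)"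
proof -
  interpret field K by fact
  interpret M: module K M by fact
  let ?V = "M\<lparr>carrier := L\<rparr>"
  have "submodule K L M"
  proof (rule submodule.intro[OF M])
    show "L \<subseteq> carrier M"
      using L m by auto
    show "v \<oplus>\<^bsub>M\<^esub> w \<in> L" if vw: "v \<in> L" "w \<in> L" for v w
    proof -
      obtain c d where c: "c \<in> carrier K" "v = c \<odot>\<^bsub>M\<^esub> m" and d: "d \<in> carrier K" "w = d \<odot>\<^bsub>M\<^esub> m"
        using vw L by blast
      then have "v \<oplus>\<^bsub>M\<^esub> w = (c \<oplus>\<^bsub>K\<^esub> d) \<odot>\<^bsub>M\<^esub> m"
        using m by (simp add: M.smult_l_distr)
      then show ?thesis
        using L c d by blast
    qed
    show "\<zero>\<^bsub>M\<^esub> \<in> L"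
      using L m by (auto intro!: exI[of _ "\<zero>\<^bsub>K\<^esub>"])
    show "c \<odot>\<^bsub>M\<^esub> v \<in> L" if cv: "c \<in> carrier K" "v \<in> L" for c v
    proof -
      obtain d where d: "d \<in> carrier K" "v = d \<odot>\<^bsub>M\<^esub> m"
        using cv L by blast
      then have "c \<odot>\<^bsub>M\<^esub> v = (c \<otimes>\<^bsub>K\<^esub> d) \<odot>\<^bsub>M\<^esub> m"
        using m cv by (simp add: M.smult_assoc1)
      then show ?thesis
        using L cv d by blast
    qed
  qed
  then have "module K ?V"
    by (rule M.submodule_is_module)
  then interpret V: vectorspace K ?V
    using K by (simp add: vectorspace_def)
  have "m = \<one>\<^bsub>K\<^esub> \<odot>\<^bsub>M\<^esub> m"
    using m by simp
  then have mL: "m \<in> carrier ?V"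
    using L by auto
  have lc: "V.lincomb a {m} = a m \<odot>\<^bsub>M\<^esub> m" if "a m \<in> carrier K" for a
    unfolding V.lincomb_def using that mL V.smult_closed[of "a m" m] m by simp
  have "V.lin_indpt {m}"
  proof (rule V.finite_lin_indpt2)
    fix a assume a: "a \<in> {m} \<rightarrow> carrier K" "V.lincomb a {m} = \<zero>\<^bsub>?V\<^esub>"
    then have am: "a m \<in> carrier K" "a m \<odot>\<^bsub>M\<^esub> m = \<zero>\<^bsub>M\<^esub>"
      using lc[of a] by auto
    have "a m = \<zero>\<^bsub>K\<^esub>"
    proof (rule ccontr)
      assume "a m \<noteq> \<zero>\<^bsub>K\<^esub>"
      then have u: "a m \<in> Units K"
        using am by (simp add: field_Units)
      then have "m = inv\<^bsub>K\<^esub> (a m) \<odot>\<^bsub>M\<^esub> (a m \<odot>\<^bsub>M\<^esub> m)"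
        using m am(1) by (subst M.smult_assoc1[symmetric]) simp_all
      then show False
        using am u m by simp
    qed
    then show "\<forall>v\<in>{m}. a v = \<zero>\<^bsub>K\<^esub>"
      by simp
  qed (use mL in auto)
  moreover have "V.span {m} = carrier ?V"
  proof
    show "V.span {m} \<subseteq> carrier ?V"
      using V.span_is_subset2[of "{m}"] mL by blast
    show "carrier ?V \<subseteq> V.span {m}"
    proof
      fix w assume "w \<in> carrier ?V"
      then obtain c where c: "c \<in> carrier K" "w = c \<odot>\<^bsub>M\<^esub> m"
        using L by auto
      then have "V.lincomb (\<lambda>_. c) {m} = w"
        using lc[of "\<lambda>_. c"] by simp
      then show "w \<in> V.span {m}"
        unfolding V.span_def using c by blast
    qed
  qed
  ultimately have "V.basis {m}"
    using mL by (simp add: V.basis_def)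
  then have "V.dim = 1"
    using V.dim_basis[of "{m}"] by simp
  moreover have "V.fin_dim"
    unfolding V.fin_dim_def using \<open>V.basis {m}\<close> by (intro exI[of _ "{m}"]) (simp add: V.basis_def)
  ultimately show ?thesis
    using V.vectorspace_axioms by (simp add: one_dimensional_def)
qed

section \<open>The module of families of linear forms\<close>

context field
begin

lemma form_families_carrier:
  "l \<in> carrier (form_families R H A) \<longleftrightarrow> l \<in> extensional (carrier H) \<and>
    (\<forall>x\<in>carrier H. linear_form R (A x) (l x) \<and> l x \<in> extensional (carrier (A x)))"
  by (auto simp: form_families_def Let_def PiE_iff)

lemma form_families_simps:
  "\<zero>\<^bsub>form_families R H A\<^esub> = (\<lambda>x\<in>carrier H. \<lambda>a\<in>carrier (A x). \<zero>)"
  "l \<oplus>\<^bsub>form_families R H A\<^esub> l' = (\<lambda>x\<in>carrier H. \<lambda>a\<in>carrier (A x). l x a \<oplus> l' x a)"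
  "c \<odot>\<^bsub>form_families R H A\<^esub> l = (\<lambda>x\<in>carrier H. \<lambda>a\<in>carrier (A x). c \<otimes> l x a)"
  by (simp_all add: form_families_def Let_def)

text \<open>Families are extensional in the index and in the argument, so equality on the carriers
  is equality of functions.\<close>

lemma form_families_eqI:
  assumes "l \<in> carrier (form_families R H A)" "l' \<in> carrier (form_families R H A)"
    and "\<And>x a. \<lbrakk>x \<in> carrier H; a \<in> carrier (A x)\<rbrakk> \<Longrightarrow> l x a = l' x a"
  shows "l = l'"
proof (rule extensionalityI[of _ "carrier H"])
  fix x assume "x \<in> carrier H"
  then show "l x = l' x"
    using assms by (intro extensionalityI[of _ "carrier (A x)"]) (auto simp: form_families_carrier)
qed (use assms in \<open>simp_all add: form_families_carrier\<close>)

lemma form_families_restrict: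
  assumes "\<And>x. x \<in> carrier H \<Longrightarrow> module R (A x)" "\<And>x. x \<in> carrier H \<Longrightarrow> linear_form R (A x) (f x)"
  shows "(\<lambda>x\<in>carrier H. \<lambda>a\<in>carrier (A x). f x a) \<in> carrier (form_families R H A)"
proof -
  have "linear_form R (A x) (\<lambda>a\<in>carrier (A x). f x a)" if "x \<in> carrier H" for x
    by (rule iffD1[OF module_hom_cong[OF assms(1)[OF that]] assms(2)[OF that]]) simp
  then show ?thesis
    by (auto simp: form_families_carrier)
qed

lemma linear_form_add:
  assumes "linear_form R A f" "linear_form R A g"
  shows "linear_form R A (\<lambda>a. f a \<oplus> g a)"
  using linear_formD[OF assms(1)] linear_formD[OF assms(2)]
  by (intro linear_formI) (auto simp: a_ac r_distr)

lemma form_families_module: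
  assumes A: "\<And>x. x \<in> carrier H \<Longrightarrow> module R (A x)"
  shows "module R (form_families R H A)"
proof -
  let ?F = "form_families R H A"
  have form: "linear_form R (A x) (l x)" if "l \<in> carrier ?F" "x \<in> carrier H" for l x
    using that by (simp add: form_families_carrier)
  have cl: "l x a \<in> carrier R" if "l \<in> carrier ?F" "x \<in> carrier H" "a \<in> carrier (A x)" for l x a
    using linear_formD(1)[OF form[OF that(1,2)] that(3)] .
  have zero: "\<zero>\<^bsub>?F\<^esub> \<in> carrier ?F"
    unfolding form_families_simps by (rule form_families_restrict[OF A]) (auto intro: linear_formI)
  have add: "l \<oplus>\<^bsub>?F\<^esub> l' \<in> carrier ?F" if "l \<in> carrier ?F" "l' \<in> carrier ?F" for l l'
    unfolding form_families_simps by (intro form_families_restrict linear_form_add form that A)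
  have smult: "c \<odot>\<^bsub>?F\<^esub> l \<in> carrier ?F" if "c \<in> carrier R" "l \<in> carrier ?F" for c l
    unfolding form_families_simps by (intro form_families_restrict linear_form_cmult form that A)
  show ?thesis
  proof (rule moduleI)
    show "abelian_group ?F"
    proof (rule abelian_groupI)
      fix l assume l: "l \<in> carrier ?F"
      have "(\<ominus> \<one>) \<odot>\<^bsub>?F\<^esub> l \<oplus>\<^bsub>?F\<^esub> l = \<zero>\<^bsub>?F\<^esub>"
        by (rule form_families_eqI[OF add[OF smult[OF _ l] l] zero])
          (use l cl in \<open>simp_all add: form_families_simps l_minus l_neg\<close>)
      then show "\<exists>l'\<in>carrier ?F. l' \<oplus>\<^bsub>?F\<^esub> l = \<zero>\<^bsub>?F\<^esub>"
        using smult[of "\<ominus> \<one>" l] l by blast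
      show "\<zero>\<^bsub>?F\<^esub> \<oplus>\<^bsub>?F\<^esub> l = l"
        by (rule form_families_eqI[OF add[OF zero l] l]) (use l cl in \<open>simp add: form_families_simps\<close>)
    next
      fix l l' assume l: "l \<in> carrier ?F" "l' \<in> carrier ?F"
      show "l \<oplus>\<^bsub>?F\<^esub> l' \<in> carrier ?F"
        by (rule add[OF l])
      show "l \<oplus>\<^bsub>?F\<^esub> l' = l' \<oplus>\<^bsub>?F\<^esub> l"
        by (rule form_families_eqI[OF add[OF l] add[OF l(2,1)]]) (use l cl in \<open>simp add: form_families_simps a_comm\<close>)
      fix l'' assume l'': "l'' \<in> carrier ?F"
      show "l \<oplus>\<^bsub>?F\<^esub> l' \<oplus>\<^bsub>?F\<^esub> l'' = l \<oplus>\<^bsub>?F\<^esub> (l' \<oplus>\<^bsub>?F\<^esub> l'')"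
        by (rule form_families_eqI[OF add[OF add[OF l] l''] add[OF l(1) add[OF l(2) l'']]])
          (use l l'' cl in \<open>simp add: form_families_simps a_assoc\<close>)
    qed (rule zero)
  next
    fix c l assume c: "c \<in> carrier R" and l: "l \<in> carrier ?F"
    show "c \<odot>\<^bsub>?F\<^esub> l \<in> carrier ?F"
      by (rule smult[OF c l])
    {
      fix d assume d: "d \<in> carrier R"
      show "(c \<oplus> d) \<odot>\<^bsub>?F\<^esub> l = c \<odot>\<^bsub>?F\<^esub> l \<oplus>\<^bsub>?F\<^esub> d \<odot>\<^bsub>?F\<^esub> l"
        by (rule form_families_eqI[OF smult[OF a_closed[OF c d] l] add[OF smult[OF c l] smult[OF d l]]])
          (use c d l cl in \<open>simp add: form_families_simps l_distr\<close>)
      show "(c \<otimes> d) \<odot>\<^bsub>?F\<^esub> l = c \<odot>\<^bsub>?F\<^esub> (d \<odot>\<^bsub>?F\<^esub> l)"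
        by (rule form_families_eqI[OF smult[OF m_closed[OF c d] l] smult[OF c smult[OF d l]]])
          (use c d l cl in \<open>simp add: form_families_simps m_assoc\<close>)
    }
    fix l' assume l': "l' \<in> carrier ?F"
    show "c \<odot>\<^bsub>?F\<^esub> (l \<oplus>\<^bsub>?F\<^esub> l') = c \<odot>\<^bsub>?F\<^esub> l \<oplus>\<^bsub>?F\<^esub> c \<odot>\<^bsub>?F\<^esub> l'"
      by (rule form_families_eqI[OF smult[OF c add[OF l l']] add[OF smult[OF c l] smult[OF c l']]])
        (use c l l' cl in \<open>simp add: form_families_simps r_distr\<close>)
  next
    fix l assume l: "l \<in> carrier ?F"
    show "\<one> \<odot>\<^bsub>?F\<^esub> l = l"
      by (rule form_families_eqI[OF smult[OF one_closed l] l]) (use l cl in \<open>simp add: form_families_simps\<close>)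
  qed (rule is_cring)
qed

end

context hopf_family
begin

lemma left_integral_family_cmult:
  assumes l: "left_integral_family l" and c: "c \<in> carrier K"
    and l': "\<And>x a. \<lbrakk>x \<in> carrier H; a \<in> carrier (A x)\<rbrakk> \<Longrightarrow> l' x a = c \<otimes> l x a"
  shows "left_integral_family l'"
  unfolding left_integral_family_def
proof (intro conjI ballI allI impI)
  fix x assume x: "x \<in> carrier H"
  show "form x (l' x)"
    by (rule iffD1[OF module_hom_cong[OF module[OF x]] K.linear_form_cmult[OF c left_integral_familyD(1)[OF l x]]])
      (simp add: l'[OF x])
next
  fix x y a f assume x: "x \<in> carrier H" and y: "y \<in> carrier H" and a: "a \<in> carrier (A (x \<cdot> y))" and f: "form x f"
  note ly = left_integral_familyD(1)[OF l y]
  have xy: "x \<cdot> y \<in> carrier H"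
    using x y by simp
  have "sw x y (\<lambda>p q. f p \<otimes> l' y q) a = sw x y (\<lambda>p q. c \<otimes> (f p \<otimes> l y q)) a"
  proof (rule sw_cong[OF x y a, symmetric])
    show "bform x y (\<lambda>p q. c \<otimes> (f p \<otimes> l y q))"
      by (intro bilinearI K.linear_form_cmult K.linear_form_multc c f ly form_closed[OF f] form_closed[OF ly])
  qed (simp add: l'[OF y] form_closed[OF f] form_closed[OF ly] c K.m_lcomm)
  also have "\<dots> = c \<otimes> (f \<one>\<^bsub>A x\<^esub> \<otimes> l (x \<cdot> y) a)"
    using left_integral_familyD(2)[OF l x y a f] by (simp add: sw_cmult[OF x y a c form_tensor[OF f ly]])
  also have "\<dots> = f \<one>\<^bsub>A x\<^esub> \<otimes> l' (x \<cdot> y) a"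
    using l'[OF xy a] c x form_closed[OF f, of "\<one>\<^bsub>A x\<^esub>"] form_closed[OF left_integral_familyD(1)[OF l xy] a]
    by (simp add: K.m_lcomm)
  finally show "sw x y (\<lambda>p q. f p \<otimes> l' y q) a = f \<one>\<^bsub>A x\<^esub> \<otimes> l' (x \<cdot> y) a" .
qed

lemma one_dimensional_left_integral_families:
  "one_dimensional K ((form_families K H A)\<lparr>carrier :=
    {l \<in> carrier (form_families K H A). left_integral_family l}\<rparr>)"
proof -
  let ?F = "form_families K H A"
  obtain l where l: "left_integral_family l" and nz: "\<exists>a\<in>carrier (A e). l e a \<noteq> \<zero>"
    and uniq: "\<And>l'. left_integral_family l' \<Longrightarrow>
      \<exists>c\<in>carrier K. \<forall>x\<in>carrier H. \<forall>a\<in>carrier (A x). l' x a = c \<otimes> l x a"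
    using left_integral_family_unique by blast
  \<comment> \<open>The integral l is constrained only on the carriers; its extensional restriction
    is the vector of the ambient module that spans the integrals.\<close>
  define m where "m = (\<lambda>x\<in>carrier H. \<lambda>a\<in>carrier (A x). l x a)"
  have lc: "l x a \<in> carrier K" if "x \<in> carrier H" "a \<in> carrier (A x)" for x a
    using form_closed[OF left_integral_familyD(1)[OF l that(1)] that(2)] .
  have mF: "m \<in> carrier ?F"
    unfolding m_def by (rule K.form_families_restrict[OF module left_integral_familyD(1)[OF l]])
  interpret F: module K ?F
    by (rule K.form_families_module[OF module])
  have mult: "(c \<odot>\<^bsub>?F\<^esub> m) x a = c \<otimes> l x a" if "x \<in> carrier H" "a \<in> carrier (A x)" for c x a
    using that by (simp add: K.form_families_simps m_def)
  show ?thesis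
  proof (rule one_dimensional_multiples[OF K.field_axioms F.module_axioms mF])
    obtain a where a: "a \<in> carrier (A e)" "l e a \<noteq> \<zero>"
      using nz by blast
    show "m \<noteq> \<zero>\<^bsub>?F\<^esub>"
    proof
      assume "m = \<zero>\<^bsub>?F\<^esub>"
      then have "m e a = \<zero>"
        using a by (simp add: K.form_families_simps)
      then show False
        using a by (simp add: m_def)
    qed
    show "{l \<in> carrier ?F. left_integral_family l} = {c \<odot>\<^bsub>?F\<^esub> m | c. c \<in> carrier K}"
    proof (intro equalityI subsetI)
      fix l' assume "l' \<in> {l \<in> carrier ?F. left_integral_family l}"
      then have l': "l' \<in> carrier ?F" "left_integral_family l'"
        by auto
      then obtain c where c: "c \<in> carrier K" "\<forall>x\<in>carrier H. \<forall>a\<in>carrier (A x). l' x a = c \<otimes> l x a"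
        using uniq by blast
      then have "l' = c \<odot>\<^bsub>?F\<^esub> m"
        by (intro K.form_families_eqI[OF l'(1) F.smult_closed[OF c(1) mF]]) (simp add: mult)
      then show "l' \<in> {c \<odot>\<^bsub>?F\<^esub> m | c. c \<in> carrier K}"
        using c(1) by blast
    next
      fix l' assume "l' \<in> {c \<odot>\<^bsub>?F\<^esub> m | c. c \<in> carrier K}"
      then obtain c where c: "c \<in> carrier K" "l' = c \<odot>\<^bsub>?F\<^esub> m"
        by blast
      then have "left_integral_family l'"
        by (intro left_integral_family_cmult[OF l c(1)]) (simp add: mult)
      then show "l' \<in> {l \<in> carrier ?F. left_integral_family l}"
        using c mF by simp
    qed
  qed
qed

end

section \<open>From pairings back to integrals of the given coalgebra\<close>

context hopf_chi_coalgebra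
begin

text \<open>The way back from scalars to elements: a nonzero difference is detected by a form with
  value one at it.\<close>

lemma eq_iff_linear_forms:
  assumes x: "x \<in> carrier H" and fd: "vectorspace.fin_dim K (A x)"
    and a: "a \<in> carrier (A x)" and b: "b \<in> carrier (A x)"
  shows "a = b \<longleftrightarrow> (\<forall>f. linear_form K (A x) f \<longrightarrow> f a = f b)"
proof -
  have vs: "vectorspace K (A x)"
    using algebras[OF x] by (simp add: assoc_algebra_def)
  interpret A: vectorspace K "A x"
    by (rule vs)
  have "a = b" if eq: "\<forall>f. linear_form K (A x) f \<longrightarrow> f a = f b"
  proof (rule ccontr)
    assume "a \<noteq> b"
    then have "a \<ominus>\<^bsub>A x\<^esub> b \<noteq> \<zero>\<^bsub>A x\<^esub>"
      using a b by simp
    then obtain f where f: "linear_form K (A x) f" "f (a \<ominus>\<^bsub>A x\<^esub> b) = \<one>"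
      using linear_form_separates[OF vs fd, of "a \<ominus>\<^bsub>A x\<^esub> b"] a b by auto
    interpret f: mod_hom K "A x" G f
      using f(1) A.module_axioms ground_module by (simp add: mod_hom_def mod_hom_axioms_def)
    have "f (a \<ominus>\<^bsub>A x\<^esub> b) = f a \<ominus>\<^bsub>G\<^esub> f b"
      by (rule f.f_minus[OF a b])
    also have "f a = f b"
      using eq f(1) by blast
    also have "f b \<ominus>\<^bsub>G\<^esub> f b = \<zero>"
      using linear_formD(1)[OF f(1) b] abelian_group.r_neg[OF module.axioms(2)[OF ground_module], of "f b"]
      by (simp add: a_minus_def)
    finally show False
      using f(2) by simp
  qed
  then show ?thesis
    by blast
qed

text \<open>Both sides of the integral equation lie in \<open>A x\<close>, where forms separate
  points; \<open>sw_map\<close> computes the value of a form at the left side.\<close>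

lemma left_condition:
  assumes x: "x \<in> carrier H" and y: "y \<in> carrier H" and fd: "vectorspace.fin_dim K (A x)"
    and a: "a \<in> carrier (A (x \<otimes>\<^bsub>H\<^esub> y))" and g: "linear_form K (A y) g" and c: "c \<in> carrier K"
  shows "tensor_unit_right K (A x) (tensor_map K (A x) G id g (\<Delta> x y a)) = unit_map (A x) c \<longleftrightarrow>
    (\<forall>f. linear_form K (A x) f \<longrightarrow> sw x y (\<lambda>p q. f p \<otimes> g q) a = f \<one>\<^bsub>A x\<^esub> \<otimes> c)"
proof -
  interpret A: module K "A x"
    by (rule module_A[OF x])
  interpret s: sweedler K "A (x \<otimes>\<^bsub>H\<^esub> y)" "A x" "A y" "sw x y"
    unfolding sw_def[abs_def] by (intro sweedler_tensor_lift field_axioms module_A comult_linear H.m_closed x y)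
  interpret b: bilinear_map K "A x" G "A x" "\<lambda>a c. c \<odot>\<^bsub>A x\<^esub> a"
    by (intro bilinear_mapI module_A x ground_module smult_bilinear)
  let ?w = "tensor_unit_right K (A x) (tensor_map K (A x) G id g (\<Delta> x y a))"
  have w: "?w \<in> carrier (A x)"
    unfolding tensor_unit_right_def
    by (rule module_hom_carrier[OF b.tensor_lift_hom tensor_map_closed[OF module_A[OF x] module_A[OF y]
            module_A[OF x] ground_module id_linear g comult_closed[OF x y a]]])
  have u: "unit_map (A x) c \<in> carrier (A x)"
    using c one_A[OF x] by (simp add: unit_map_def)
  have "f ?w = sw x y (\<lambda>p q. f p \<otimes> g q) a \<and> f (unit_map (A x) c) = f \<one>\<^bsub>A x\<^esub> \<otimes> c"
    if f: "linear_form K (A x) f" for f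
  proof
    have "f ?w = sw x y (\<lambda>p q. f (g q \<odot>\<^bsub>A x\<^esub> id p)) a"
      unfolding tensor_unit_right_def
      by (rule sw_map[OF x y a module_A[OF x] ground_module module_A[OF x] id_linear g smult_bilinear(1)[OF module_A[OF x]] f])
    also have "\<dots> = sw x y (\<lambda>p q. f p \<otimes> g q) a"
      by (rule s.sw_cong[OF a, symmetric])
        (use linear_formD(1)[OF g] linear_formD(1,3)[OF f] in
          \<open>auto intro!: bilinearI linear_form_cmult linear_form_multc f g simp: m_comm\<close>)
    finally show "f ?w = sw x y (\<lambda>p q. f p \<otimes> g q) a" .
    show "f (unit_map (A x) c) = f \<one>\<^bsub>A x\<^esub> \<otimes> c"
      using linear_formD(1)[OF f one_A[OF x]] c linear_formD(3)[OF f c one_A[OF x]] by (simp add: unit_map_def m_comm)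
  qed
  then show ?thesis
    unfolding eq_iff_linear_forms[OF x fd w u] by simp
qed

lemma right_condition:
  assumes x: "x \<in> carrier H" and y: "y \<in> carrier H" and fd: "vectorspace.fin_dim K (A y)"
    and a: "a \<in> carrier (A (x \<otimes>\<^bsub>H\<^esub> y))" and g: "linear_form K (A x) g" and c: "c \<in> carrier K"
  shows "tensor_unit_left K (A y) (tensor_map K G (A y) g id (\<Delta> x y a)) = unit_map (A y) c \<longleftrightarrow>
    (\<forall>f. linear_form K (A y) f \<longrightarrow> sw x y (\<lambda>p q. f q \<otimes> g p) a = f \<one>\<^bsub>A y\<^esub> \<otimes> c)"
proof -
  interpret A: module K "A y"
    by (rule module_A[OF y])
  interpret s: sweedler K "A (x \<otimes>\<^bsub>H\<^esub> y)" "A x" "A y" "sw x y"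
    unfolding sw_def[abs_def] by (intro sweedler_tensor_lift field_axioms module_A comult_linear H.m_closed x y)
  interpret b: bilinear_map K G "A y" "A y" "\<lambda>c a. c \<odot>\<^bsub>A y\<^esub> a"
    by (intro bilinear_mapI module_A y ground_module smult_bilinear)
  let ?w = "tensor_unit_left K (A y) (tensor_map K G (A y) g id (\<Delta> x y a))"
  have w: "?w \<in> carrier (A y)"
    unfolding tensor_unit_left_def
    by (rule module_hom_carrier[OF b.tensor_lift_hom tensor_map_closed[OF module_A[OF x] module_A[OF y]
            ground_module module_A[OF y] g id_linear comult_closed[OF x y a]]])
  have u: "unit_map (A y) c \<in> carrier (A y)"
    using c one_A[OF y] by (simp add: unit_map_def)
  have "f ?w = sw x y (\<lambda>p q. f q \<otimes> g p) a \<and> f (unit_map (A y) c) = f \<one>\<^bsub>A y\<^esub> \<otimes> c"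
    if f: "linear_form K (A y) f" for f
  proof
    have "f ?w = sw x y (\<lambda>p q. f (g p \<odot>\<^bsub>A y\<^esub> id q)) a"
      unfolding tensor_unit_left_def
      by (rule sw_map[OF x y a ground_module module_A[OF y] module_A[OF y] g id_linear smult_bilinear(2)[OF module_A[OF y]] f])
    also have "\<dots> = sw x y (\<lambda>p q. f q \<otimes> g p) a"
      by (rule s.sw_cong[OF a, symmetric])
        (use linear_formD(1)[OF g] linear_formD(1,3)[OF f] in
          \<open>auto intro!: bilinearI linear_form_cmult linear_form_multc f g simp: m_comm\<close>)
    finally show "f ?w = sw x y (\<lambda>p q. f q \<otimes> g p) a" .
    show "f (unit_map (A y) c) = f \<one>\<^bsub>A y\<^esub> \<otimes> c"
      using linear_formD(1)[OF f one_A[OF y]] c linear_formD(3)[OF f c one_A[OF y]] by (simp add: unit_map_def m_comm)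
  qed
  then show ?thesis
    unfolding eq_iff_linear_forms[OF y fd w u] by simp
qed

lemma sw_phi:
  assumes x: "x \<in> carrier H" and y: "y \<in> carrier H" and e: "e \<in> carrier E" and f: "f \<in> carrier E"
    and \<beta>: "bilinear_form K (A (\<chi> e \<otimes>\<^bsub>H\<^esub> x)) (A (\<chi> f \<otimes>\<^bsub>H\<^esub> y)) \<beta>" and a: "a \<in> carrier (A (x \<otimes>\<^bsub>H\<^esub> y))"
  shows "sw (\<chi> e \<otimes>\<^bsub>H\<^esub> x) (\<chi> f \<otimes>\<^bsub>H\<^esub> y) \<beta> (\<phi> (x \<otimes>\<^bsub>H\<^esub> y) (e \<otimes>\<^bsub>E\<^esub> act x f) a) =
    sw x y (\<lambda>p q. \<beta> (\<phi> x e p) (\<phi> y f q)) a"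
proof -
  have z: "\<chi> e \<otimes>\<^bsub>H\<^esub> x \<in> carrier H" "\<chi> f \<otimes>\<^bsub>H\<^esub> y \<in> carrier H"
    using x y e f chi_closed by auto
  show ?thesis
    unfolding sw_def phi_comult[OF x y e f a, symmetric]
    by (rule tensor_lift_map[OF module_A[OF x] module_A[OF y] module_A[OF z(1)] module_A[OF z(2)]
          phi_linear[OF x e] phi_linear[OF y f] comult_closed[OF x y a] ground_module \<beta>])
qed

lemma chi_one: "\<chi> \<one>\<^bsub>E\<^esub> = \<one>\<^bsub>H\<^esub>"
  using hom_one[OF hom E.is_group H.is_group] .

lemma act_one: "x \<in> carrier H \<Longrightarrow> act x \<one>\<^bsub>E\<^esub> = \<one>\<^bsub>E\<^esub>"
  using hom_one[OF act_hom E.is_group E.is_group] .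

lemma one_act: "e \<in> carrier E \<Longrightarrow> act \<one>\<^bsub>H\<^esub> e = e"
  using group_action.id_eq_one[OF action] by (metis restrict_apply')

text \<open>The compatibility axiom with the unit of E in the second slot: there
  \<open>act x\<close> fixes the unit, \<chi> sends it to the unit of H, and the second \<phi> is
  the identity.\<close>

lemma sw_phi_left:
  assumes x: "x \<in> carrier H" and e: "e \<in> carrier E"
    and \<beta>: "bilinear_form K (A (\<chi> e \<otimes>\<^bsub>H\<^esub> x)) (A \<one>\<^bsub>H\<^esub>) \<beta>" and a: "a \<in> carrier (A x)"
  shows "sw (\<chi> e \<otimes>\<^bsub>H\<^esub> x) \<one>\<^bsub>H\<^esub> \<beta> (\<phi> x e a) = sw x \<one>\<^bsub>H\<^esub> (\<lambda>p q. \<beta> (\<phi> x e p) q) a"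
proof -
  interpret s: sweedler K "A (x \<otimes>\<^bsub>H\<^esub> \<one>\<^bsub>H\<^esub>)" "A x" "A \<one>\<^bsub>H\<^esub>" "sw x \<one>\<^bsub>H\<^esub>"
    unfolding sw_def[abs_def] by (intro sweedler_tensor_lift field_axioms module_A comult_linear H.m_closed x H.one_closed)
  have "sw (\<chi> e \<otimes>\<^bsub>H\<^esub> x) \<one>\<^bsub>H\<^esub> \<beta> (\<phi> x e a) = sw x \<one>\<^bsub>H\<^esub> (\<lambda>p q. \<beta> (\<phi> x e p) (\<phi> \<one>\<^bsub>H\<^esub> \<one>\<^bsub>E\<^esub> q)) a"
    using sw_phi[of x "\<one>\<^bsub>H\<^esub>" e "\<one>\<^bsub>E\<^esub>" \<beta> a] x e a \<beta> by (simp add: chi_one act_one)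
  also have "\<dots> = sw x \<one>\<^bsub>H\<^esub> (\<lambda>p q. \<beta> (\<phi> x e p) q) a"
    by (rule s.sw_cong[symmetric])
      (use x a phi_one[of "\<one>\<^bsub>H\<^esub>"] bilinear_comp[OF \<beta> phi_linear[OF x e] id_linear] in simp_all)
  finally show ?thesis .
qed

text \<open>The mirror image, with the unit of E in the first slot; the remaining factor is e acted
  on by the unit of H, which is e.\<close>

lemma sw_phi_right:
  assumes x: "x \<in> carrier H" and e: "e \<in> carrier E"
    and \<beta>: "bilinear_form K (A \<one>\<^bsub>H\<^esub>) (A (\<chi> e \<otimes>\<^bsub>H\<^esub> x)) \<beta>" and a: "a \<in> carrier (A x)"
  shows "sw \<one>\<^bsub>H\<^esub> (\<chi> e \<otimes>\<^bsub>H\<^esub> x) \<beta> (\<phi> x e a) = sw \<one>\<^bsub>H\<^esub> x (\<lambda>p q. \<beta> p (\<phi> x e q)) a"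
proof -
  interpret s: sweedler K "A (\<one>\<^bsub>H\<^esub> \<otimes>\<^bsub>H\<^esub> x)" "A \<one>\<^bsub>H\<^esub>" "A x" "sw \<one>\<^bsub>H\<^esub> x"
    unfolding sw_def[abs_def] by (intro sweedler_tensor_lift field_axioms module_A comult_linear H.m_closed x H.one_closed)
  have "sw \<one>\<^bsub>H\<^esub> (\<chi> e \<otimes>\<^bsub>H\<^esub> x) \<beta> (\<phi> x e a) = sw \<one>\<^bsub>H\<^esub> x (\<lambda>p q. \<beta> (\<phi> \<one>\<^bsub>H\<^esub> \<one>\<^bsub>E\<^esub> p) (\<phi> x e q)) a"
    using sw_phi[of "\<one>\<^bsub>H\<^esub>" x "\<one>\<^bsub>E\<^esub>" e \<beta> a] x e a \<beta> by (simp add: chi_one one_act)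
  also have "\<dots> = sw \<one>\<^bsub>H\<^esub> x (\<lambda>p q. \<beta> p (\<phi> x e q)) a"
    by (rule s.sw_cong[symmetric])
      (use x a phi_one[of "\<one>\<^bsub>H\<^esub>"] bilinear_comp[OF \<beta> id_linear phi_linear[OF x e]] in simp_all)
  finally show ?thesis .
qed

text \<open>By \<open>phi_mult\<close>, the map \<phi> for the inverse of e carries the unit of the
  target back to the unit of \<open>A x\<close>; being linear, it sends zero to zero.\<close>

lemma phi_trivial:
  assumes x: "x \<in> carrier H" and e: "e \<in> carrier E"
    and z: "\<one>\<^bsub>A (\<chi> e \<otimes>\<^bsub>H\<^esub> x)\<^esub> = \<zero>\<^bsub>A (\<chi> e \<otimes>\<^bsub>H\<^esub> x)\<^esub>"
  shows "\<one>\<^bsub>A x\<^esub> = \<zero>\<^bsub>A x\<^esub>"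
proof -
  let ?z = "\<chi> e \<otimes>\<^bsub>H\<^esub> x" and ?i = "inv\<^bsub>E\<^esub> e"
  have i: "?i \<in> carrier E" and zH: "?z \<in> carrier H"
    using x e chi_closed by auto
  have "\<chi> ?i \<otimes>\<^bsub>H\<^esub> ?z = \<chi> (?i \<otimes>\<^bsub>E\<^esub> e) \<otimes>\<^bsub>H\<^esub> x"
    using hom_mult[OF hom i e] x e i chi_closed by (simp add: H.m_assoc)
  then have x': "\<chi> ?i \<otimes>\<^bsub>H\<^esub> ?z = x"
    using x e by (simp add: chi_one)
  interpret p: mod_hom K "A ?z" "A x" "\<phi> ?z ?i"
    using phi_linear[OF zH i] module_A[OF zH] module_A[OF x] x' by (simp add: mod_hom_def mod_hom_axioms_def)
  have "\<one>\<^bsub>A x\<^esub> = \<phi> x (?i \<otimes>\<^bsub>E\<^esub> e) \<one>\<^bsub>A x\<^esub>"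
    using x e one_A[OF x] by (simp add: phi_one)
  also have "\<dots> = \<phi> ?z ?i (\<phi> x e \<one>\<^bsub>A x\<^esub>)"
    by (rule phi_mult[OF x e i one_A[OF x], symmetric])
  also have "\<dots> = \<phi> ?z ?i \<zero>\<^bsub>A ?z\<^esub>"
    by (simp add: phi_unit[OF x e] z)
  also have "\<dots> = \<zero>\<^bsub>A x\<^esub>"
    by (rule p.f0_is_0)
  finally show ?thesis .
qed

theorem one_dimensional_left_integrals:
  assumes fd: "\<And>x. x \<in> carrier H \<Longrightarrow> vectorspace.fin_dim K (A x)"
  shows "one_dimensional K (left_integral_space K E H \<chi> A \<Delta> \<phi>)"
proof -
  interpret L: hopf_family K H A sw \<epsilon> S
    by (rule hopf_family[OF fd])
  have "left_integrals K E H \<chi> A \<Delta> \<phi> = {l \<in> carrier (form_families K H A). L.left_integral_family l}"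
    unfolding left_integrals_def
  proof (intro Collect_cong conj_cong refl)
    fix l assume l: "l \<in> carrier (form_families K H A)"
    then have form: "linear_form K (A x) (l x)" if "x \<in> carrier H" for x
      using that by (simp add: form_families_carrier)
    have "(\<forall>x\<in>carrier H. \<forall>y\<in>carrier H. \<forall>a\<in>carrier (A (x \<otimes>\<^bsub>H\<^esub> y)).
        tensor_unit_right K (A x) (tensor_map K (A x) G id (l y) (\<Delta> x y a)) = unit_map (A x) (l (x \<otimes>\<^bsub>H\<^esub> y) a)) \<longleftrightarrow>
      L.left_integral_family l"
      unfolding L.left_integral_family_def using form
      by (auto simp: left_condition fd linear_formD(1)[OF form])
    \<comment> \<open>Invariance follows from the integral equation, so the conjunction defining
      \<open>left_integrals\<close> reduces to that equation.\<close>
    moreover have "phi_invariant E H \<chi> A \<phi> l" if "L.left_integral_family l"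
      unfolding phi_invariant_def
    proof (intro ballI)
      fix x e a assume x: "x \<in> carrier H" and e: "e \<in> carrier E" and a: "a \<in> carrier (A x)"
      show "l (\<chi> e \<otimes>\<^bsub>H\<^esub> x) (\<phi> x e a) = l x a"
        by (rule L.left_integral_family_invariant[OF that x _ phi_linear[OF x e] phi_unit[OF x e]
              sw_phi_left[OF x e] phi_trivial[OF x e] a])
          (use x e chi_closed in simp_all)
    qed
    ultimately show "phi_invariant E H \<chi> A \<phi> l \<and> (\<forall>x\<in>carrier H. \<forall>y\<in>carrier H. \<forall>a\<in>carrier (A (x \<otimes>\<^bsub>H\<^esub> y)).
        tensor_unit_right K (A x) (tensor_map K (A x) G id (l y) (\<Delta> x y a)) = unit_map (A x) (l (x \<otimes>\<^bsub>H\<^esub> y) a)) \<longleftrightarrow>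
      L.left_integral_family l"
      by blast
  qed
  then show ?thesis
    unfolding left_integral_space_def using L.one_dimensional_left_integral_families by simp
qed

theorem one_dimensional_right_integrals:
  assumes fd: "\<And>x. x \<in> carrier H \<Longrightarrow> vectorspace.fin_dim K (A x)"
  shows "one_dimensional K (right_integral_space K E H \<chi> A \<Delta> \<phi>)"
proof -
  interpret L: hopf_family K H A sw \<epsilon> S
    by (rule hopf_family[OF fd])
  let ?H = "H\<lparr>mult := \<lambda>x y. y \<otimes>\<^bsub>H\<^esub> x\<rparr>" and ?A = "\<lambda>x. A x\<lparr>mult := \<lambda>a b. b \<otimes>\<^bsub>A x\<^esub> a\<rparr>"
  interpret R: hopf_family K ?H ?A "\<lambda>x y \<beta>. sw y x (\<lambda>p q. \<beta> q p)" \<epsilon> S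
    by (rule L.opposite)
  \<comment> \<open>The ambient space reads only carriers and linear structure, so it is literally
    the same for the opposite family.\<close>
  have ff: "form_families K ?H ?A = form_families K H A"
    by (simp add: form_families_def)
  have "right_integrals K E H \<chi> A \<Delta> \<phi> = {l \<in> carrier (form_families K H A). R.left_integral_family l}"
    unfolding right_integrals_def
  proof (intro Collect_cong conj_cong refl)
    fix l assume l: "l \<in> carrier (form_families K H A)"
    then have form: "linear_form K (A x) (l x)" if "x \<in> carrier H" for x
      using that by (simp add: form_families_carrier)
    have "(\<forall>x\<in>carrier H. \<forall>y\<in>carrier H. \<forall>a\<in>carrier (A (x \<otimes>\<^bsub>H\<^esub> y)).
        tensor_unit_left K (A y) (tensor_map K G (A y) (l x) id (\<Delta> x y a)) = unit_map (A y) (l (x \<otimes>\<^bsub>H\<^esub> y) a)) \<longleftrightarrow>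
      R.left_integral_family l"
      unfolding R.left_integral_family_def using form
      by (auto simp: right_condition fd linear_formD(1)[OF form])
    moreover have "phi_invariant E H \<chi> A \<phi> l" if "R.left_integral_family l"
      unfolding phi_invariant_def
    proof (intro ballI)
      fix x e a assume x: "x \<in> carrier H" and e: "e \<in> carrier E" and a: "a \<in> carrier (A x)"
      show "l (\<chi> e \<otimes>\<^bsub>H\<^esub> x) (\<phi> x e a) = l x a"
      proof (rule R.left_integral_family_invariant[OF that, where x = x and \<phi> = "\<phi> x e"])
        \<comment> \<open>For the opposite family, compatibility at (x, e) concerns the original
          coproduct with first index the unit of H, which \<open>sw_phi_right\<close>
          covers.\<close>
        fix \<beta> b assume "bilinear_form K (?A (\<chi> e \<otimes>\<^bsub>H\<^esub> x)) (?A \<one>\<^bsub>?H\<^esub>) \<beta>" "b \<in> carrier (?A x)"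
        then show "sw \<one>\<^bsub>?H\<^esub> (\<chi> e \<otimes>\<^bsub>H\<^esub> x) (\<lambda>p q. \<beta> q p) (\<phi> x e b) = sw \<one>\<^bsub>?H\<^esub> x (\<lambda>p q. \<beta> (\<phi> x e q) p) b"
          using sw_phi_right[OF x e, of "\<lambda>p q. \<beta> q p" b] by (simp add: bilinear_flip)
      qed (use x e a chi_closed phi_linear[OF x e] phi_unit[OF x e] phi_trivial[OF x e] in simp_all)
    qed
    ultimately show "phi_invariant E H \<chi> A \<phi> l \<and> (\<forall>x\<in>carrier H. \<forall>y\<in>carrier H. \<forall>a\<in>carrier (A (x \<otimes>\<^bsub>H\<^esub> y)).
        tensor_unit_left K (A y) (tensor_map K G (A y) (l x) id (\<Delta> x y a)) = unit_map (A y) (l (x \<otimes>\<^bsub>H\<^esub> y) a)) \<longleftrightarrow>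
      R.left_integral_family l"
      by blast
  qed
  then show ?thesis
    unfolding right_integral_space_def using R.one_dimensional_left_integral_families by (simp add: ff)
qed

end

theorem theorem9p2:
  fixes K :: "('k, 'm) ring_scheme"
    and E :: "('e, 'p) monoid_scheme" and H :: "('h, 'q) monoid_scheme"
    and \<chi> :: "'e \<Rightarrow> 'h" and act :: "'h \<Rightarrow> 'e \<Rightarrow> 'e"
    and A :: "'h \<Rightarrow> ('k, 'a) module"
    and \<Delta> :: "'h \<Rightarrow> 'h \<Rightarrow> 'a \<Rightarrow> ('a \<times> 'a \<Rightarrow> 'k) set"
    and \<epsilon> :: "'a \<Rightarrow> 'k"
    and S :: "'h \<Rightarrow> 'a \<Rightarrow> 'a"
    and \<phi> :: "'h \<Rightarrow> 'e \<Rightarrow> 'a \<Rightarrow> 'a"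
  assumes "hopf_chi_coalgebra K E H \<chi> act A \<Delta> \<epsilon> S \<phi>"
    and "\<forall>x\<in>carrier H. vectorspace.fin_dim K (A x)"
  shows "one_dimensional K (left_integral_space K E H \<chi> A \<Delta> \<phi>)
    \<and> one_dimensional K (right_integral_space K E H \<chi> A \<Delta> \<phi>)"
  using assms hopf_chi_coalgebra.one_dimensional_left_integrals[OF assms(1)]
    hopf_chi_coalgebra.one_dimensional_right_integrals[OF assms(1)] by blast

end
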